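(* Let $P_{X,Y}$ be a joint probability distribution on $\mathcal X\times\mathcal Y$ (finite sets), let $\pi$ be a correct two-party quantum protocol for $P_{X,Y}$, and let $|\psi\rangle\in\mathcal H_{AA'}\otimes\mathcal H_{BB'}$ be the embedding of $P_{X,Y}$ produced by $\pi$. If $\pi$ is weakly self-composable, then $\pi$ is trivial, i.e. $S(X\searrow Y\,|\,BB')=0$ or $S(Y\searrow X\,|\,AA')=0$.
   Context: **Dependent part.** For random variables $X,Y$, put $f_X(x):=P_{Y|X=x}$ and $X\searrow Y:=f_X(X)$ (so $X\searrow Y$ is the function of $X$ that records the conditional distribution of $Y$ given $X$). $Y\searrow X$ is defined symmetrically. **Protocols, correctness, embeddings.** All actions of both players in a two-party quantum protocol $\pi$ are purified (classical randomness replaced by quantum registers, measurements postponed to the very end). Just before the final measurements the players share a pure state $|\psi\rangle\in\mathcal H_{AA'}\otimes\mathcal H_{BB'}$ (all spaces finite-dimensional), Alice holding $A,A'$ and Bob holding $B,B'$. The honest players obtain their outputs $X\in\mathcal X$, $Y\in\mathcal Y$ by measuring $A$, respectively $B$, in the computational basis, and $(X,Y)$ has distribution $P_{X,Y}$; $A',B'$ are auxiliary working registers. The protocol is *correct* for $P_{X,Y}$ if $S(X;YB')=S(XA';Y)=I(X;Y)$, where $S(\cdot\,;\cdot)$ is quantum mutual information, evaluated after the indicated honest measurements. The state $|\psi\rangle$ produced by the purification of a correct protocol for $P_{X,Y}$ is called an *embedding* of $P_{X,Y}$. **Triviality.** $S(\cdot|\cdot)$ denotes conditional von Neumann entropy,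 $S(U|V)=S(UV)-S(V)$. $S(X\searrow Y|BB')$ is computed on the state obtained when $A$ is measured in the computational basis to give $X$, from which $X\searrow Y$ is computed, while $BB'$ is left unmeasured; $S(Y\searrow X|AA')$ symmetrically. The embedding is *trivial* if $S(Y\searrow X|AA')=0$ or $S(X\searrow Y|BB')=0$, and *non-trivial* otherwise. A correct protocol is trivial (non-trivial) if the embedding it produces is. **Ideal functionality.** An ideal functionality $\mathsf{ID}_\psi$ for $|\psi\rangle$ is a classical interface to one copy of $|\psi\rangle$. Each party submits an element of $[0,1]$. Each $s\in[0,1]$ encodes a measurement (POVM) acting locally on the submitting party's share ($\mathcal H_{AA'}$ for Alice, $\mathcal H_{BB'}$ for Bob) of that single copy; this measurement is applied and the classical outcome is returned immediately to the submitting party, irrespective of whether the other party has submitted anything. Input $0$ encodes the honest computational-basis measurement. A party may query repeatedly, each new measurement being applied to the residual state. The encoding of measurements by $[0,1]$ is arbitrary; in particular all possible local POVMs may be available. **Weak self-composability.** An attack by dishonest Bob against $|\psi\rangle^{\otimes m}$ is a POVM, possibly acting jointly (coherently), on Bob's share of all $m$ copies, while Alice honestly measures to obtain $X_1,\dots,X_m$; attacks by dishonest Alice are defined symmetrically. An attack is *simulated* by calls to $m$ copies of $\mathsf{ID}_\psi$ if the adversary, interacting only with $m$ independent ideal functionalities $\mathsf{ID}_\psi$ (one per copy of $|\psi\rangle$), with queries to each chosen possibly adaptively depending on previously received classical outcomes, and using classical post-processing, can produce a classical value having the same joint distribution with the honest party's outputs as the outcome of the attack. The embedding $|\psi\rangle$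 is *weakly self-composable* if there exists an ideal functionality $\mathsf{ID}_\psi$ such that for every $m>0$ all attacks against $|\psi\rangle^{\otimes m}$ can be simulated by appropriate calls to $m$ copies of $\mathsf{ID}_\psi$. A correct protocol is weakly self-composable if the embedding it produces is. *)

theory Defs
  imports
    "HOL-Probability.Probability"
    "Jordan_Normal_Form.Spectral_Radius"
begin

text \<open>
  A Hilbert space is given by the finite index set of its computational basis: a vector is a
  function from basis labels to \<open>complex\<close>, and an operator is a function of a row label and a
  column label.  Product labels index tensor products.

  Alice's share is indexed by \<open>'x \<times> 'a\<close> (output register \<open>A\<close>, working register \<open>A'\<close>) and Bob's by
  \<open>'y \<times> 'b\<close> (output register \<open>B\<close>, working register \<open>B'\<close>).  A purified protocol enters all notions
  below only through the pure state that it produces just before the final measurements, and every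
  bipartite pure state is produced by some protocol; statements about protocols are therefore
  expressed as statements about this state.
\<close>

type_synonym 'i opr = "'i \<Rightarrow> 'i \<Rightarrow> complex"
type_synonym ('x, 'a, 'y, 'b) state = "('x \<times> 'a) \<times> ('y \<times> 'b) \<Rightarrow> complex"

definition swap_state :: "('x, 'a, 'y, 'b) state \<Rightarrow> ('y, 'b, 'x, 'a) state" where
  "swap_state \<psi> = \<psi> \<circ> prod.swap"


section \<open>Reduced states and entropies\<close>

text \<open>
  The operator \<open>\<rho>\<close> on a finite index set \<open>I\<close> as a library matrix; the enumeration of \<open>I\<close> that is
  used does not influence the spectrum.
\<close>

definition matrix_on :: "'i set \<Rightarrow> 'i opr \<Rightarrow> complex mat" where
  "matrix_on I \<rho> = mat (card I) (card I) (\<lambda>(j, k). \<rho> (from_nat_into I j) (from_nat_into I k))"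

text \<open>
  \<open>- Tr (\<rho> log \<rho>)\<close> as the sum over the eigenvalues, counted with multiplicity; an eigenvalue \<open>0\<close>
  contributes \<open>0\<close>.
\<close>

definition vn_entropy :: "'i set \<Rightarrow> 'i opr \<Rightarrow> real" where
  "vn_entropy I \<rho> =
     - (\<Sum>e\<in>spectrum (matrix_on I \<rho>).
          real (Polynomial.order e (char_poly (matrix_on I \<rho>))) * (Re e * log 2 (Re e)))"

text \<open>
  Let \<open>\<phi>\<close> be a pure state on the basis \<open>'n\<close>, and let the isometry sending the basis vector \<open>n\<close> to
  the basis vector \<open>(keep n, env n)\<close> be applied to it (all uses have \<open>n \<mapsto> (keep n, env n)\<close>
  injective).  The reduced state is what remains after tracing out the part \<open>env\<close>.  A register that
  occurs only in \<open>keep\<close> stays quantum; a register that occurs only in \<open>env\<close> is discarded; a register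
  whose value occurs in \<open>env\<close> has been measured in the computational basis, and functions of its
  value may then occur as classical registers in \<open>keep\<close>.
\<close>

definition reduced_state :: "('n::finite \<Rightarrow> complex) \<Rightarrow> ('n \<Rightarrow> 'k) \<Rightarrow> ('n \<Rightarrow> 'e) \<Rightarrow> 'k opr" where
  "reduced_state \<phi> keep env i j =
     (\<Sum>n | keep n = i. \<Sum>n' | keep n' = j \<and> env n' = env n. \<phi> n * cnj (\<phi> n'))"

definition qentropy :: "('n::finite \<Rightarrow> complex) \<Rightarrow> ('n \<Rightarrow> 'k) \<Rightarrow> ('n \<Rightarrow> 'e) \<Rightarrow> real" where
  "qentropy \<phi> keep env = vn_entropy (range keep) (reduced_state \<phi> keep env)"

text \<open>\<open>S(U|V)\<close> and \<open>S(U;V)\<close> for registers \<open>U\<close>, \<open>V\<close> read off by \<open>u\<close>, \<open>v\<close>, with environment \<open>env\<close>.\<close>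

definition cond_qentropy ::
  "('n::finite \<Rightarrow> complex) \<Rightarrow> ('n \<Rightarrow> 'u) \<Rightarrow> ('n \<Rightarrow> 'v) \<Rightarrow> ('n \<Rightarrow> 'e) \<Rightarrow> real" where
  "cond_qentropy \<phi> u v env =
     qentropy \<phi> (\<lambda>n. (u n, v n)) env - qentropy \<phi> v (\<lambda>n. (u n, env n))"

definition mutual_qinfo ::
  "('n::finite \<Rightarrow> complex) \<Rightarrow> ('n \<Rightarrow> 'u) \<Rightarrow> ('n \<Rightarrow> 'v) \<Rightarrow> ('n \<Rightarrow> 'e) \<Rightarrow> real" where
  "mutual_qinfo \<phi> u v env =
     qentropy \<phi> u (\<lambda>n. (v n, env n)) + qentropy \<phi> v (\<lambda>n. (u n, env n))
       - qentropy \<phi> (\<lambda>n. (u n, v n)) env"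


section \<open>Embeddings and triviality\<close>

definition classical_mutual_info :: "('x \<times> 'y) pmf \<Rightarrow> real" where
  "classical_mutual_info P =
     prob_space.mutual_information (measure_pmf P) 2 (count_space UNIV) (count_space UNIV) fst snd"

text \<open>Measuring \<open>A\<close> and \<open>B\<close> in the computational basis yields \<open>P\<close>; in particular \<open>\<psi>\<close> is a unit vector.\<close>

definition honest_outputs ::
  "('x::finite \<times> 'y::finite) pmf \<Rightarrow> ('x, 'a::finite, 'y, 'b::finite) state \<Rightarrow> bool" where
  "honest_outputs P \<psi> \<longleftrightarrow>
     (\<forall>x y. pmf P (x, y) = (\<Sum>a\<in>UNIV. \<Sum>b\<in>UNIV. (cmod (\<psi> ((x, a), (y, b))))\<^sup>2))"

text \<open>In \<open>S(X;YB')\<close> and \<open>S(XA';Y)\<close> both output registers are measured.\<close>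

definition embedding ::
  "('x::finite \<times> 'y::finite) pmf \<Rightarrow> ('x, 'a::finite, 'y, 'b::finite) state \<Rightarrow> bool" where
  "embedding P \<psi> \<longleftrightarrow>
     honest_outputs P \<psi> \<and>
     mutual_qinfo \<psi> (\<lambda>((x, a), (y, b)). x) (\<lambda>((x, a), (y, b)). (y, b)) (\<lambda>((x, a), (y, b)). (x, y, a))
       = classical_mutual_info P \<and>
     mutual_qinfo \<psi> (\<lambda>((x, a), (y, b)). (x, a)) (\<lambda>((x, a), (y, b)). y) (\<lambda>((x, a), (y, b)). (x, y, b))
       = classical_mutual_info P"

text \<open>
  \<open>dependent_part P x\<close> is the conditional distribution of \<open>Y\<close> given \<open>X = x\<close>.  It is an unspecified
  distribution when \<open>x\<close> has probability \<open>0\<close>; such \<open>x\<close> have no weight in the entropy below.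
\<close>

definition dependent_part :: "('x \<times> 'y) pmf \<Rightarrow> 'x \<Rightarrow> 'y pmf" where
  "dependent_part P x = map_pmf snd (cond_pmf P {p. fst p = x})"

text \<open>\<open>S(X\<searrow>Y | BB')\<close>: \<open>A\<close> is measured, \<open>BB'\<close> is not, and \<open>A'\<close> is discarded.\<close>

definition dependent_part_entropy ::
  "('x::finite \<times> 'y::finite) pmf \<Rightarrow> ('x, 'a::finite, 'y, 'b::finite) state \<Rightarrow> real" where
  "dependent_part_entropy P \<psi> =
     cond_qentropy \<psi> (\<lambda>((x, a), yb). dependent_part P x) (\<lambda>((x, a), yb). yb) (\<lambda>((x, a), yb). (x, a))"

definition trivial_embedding ::
  "('x::finite \<times> 'y::finite) pmf \<Rightarrow> ('x, 'a::finite, 'y, 'b::finite) state \<Rightarrow> bool" where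
  "trivial_embedding P \<psi> \<longleftrightarrow>
     dependent_part_entropy P \<psi> = 0 \<or>
     dependent_part_entropy (map_pmf prod.swap P) (swap_state \<psi>) = 0"


section \<open>Ideal functionalities\<close>

text \<open>
  A measurement is given by its measurement operators \<open>K o\<close>, which determine the POVM elements
  \<open>(K o)\<^sup>\<dagger> (K o)\<close> and the residual states.  Outcomes are labelled by natural numbers; labels with
  \<open>K o = 0\<close> never occur.
\<close>

type_synonym 'i measurement = "nat \<Rightarrow> 'i opr"

definition outcomes :: "'i measurement \<Rightarrow> nat set" where
  "outcomes K = {r. \<exists>i j. K r i j \<noteq> 0}"

definition is_measurement :: "('i::finite) measurement \<Rightarrow> bool" where
  "is_measurement K \<longleftrightarrow>
     finite (outcomes K) \<and>
     (\<forall>i j. (\<Sum>r\<in>outcomes K. \<Sum>k\<in>UNIV. cnj (K r k i) * K r k j) = (if i = j then 1 else 0))"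

definition honest_measurement :: "('x::finite \<times> 'a) measurement" where
  "honest_measurement r i j = (if i = j \<and> r = to_nat (fst i) then 1 else 0)"

text \<open>
  An ideal functionality is given by the two encodings of local measurements by elements of the unit
  interval, for Alice and for Bob.
\<close>

definition ideal_functionality ::
  "(real \<Rightarrow> ('x::finite \<times> 'a::finite) measurement) \<Rightarrow>
   (real \<Rightarrow> ('y::finite \<times> 'b::finite) measurement) \<Rightarrow> bool" where
  "ideal_functionality M N \<longleftrightarrow>
     (\<forall>s\<in>{0..1}. is_measurement (M s) \<and> is_measurement (N s)) \<and>
     M 0 = honest_measurement \<and> N 0 = honest_measurement"


section \<open>Weak self-composability\<close>

text \<open>
  In this section the first share belongs to the honest party and the second share to the adversary.
  The space of \<open>m\<close> copies of a share is indexed by lists of length \<open>m\<close>.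
\<close>

definition positive_on :: "'i set \<Rightarrow> 'i opr \<Rightarrow> bool" where
  "positive_on I E \<longleftrightarrow> (\<forall>v. (\<Sum>i\<in>I. \<Sum>j\<in>I. cnj (v i) * E i j * v j) \<in> \<real>\<^sub>\<ge>\<^sub>0)"

definition is_povm :: "'i set \<Rightarrow> nat \<Rightarrow> (nat \<Rightarrow> 'i opr) \<Rightarrow> bool" where
  "is_povm I n E \<longleftrightarrow>
     (\<forall>z<n. positive_on I (E z)) \<and>
     (\<forall>i\<in>I. \<forall>j\<in>I. (\<Sum>z<n. E z i j) = (if i = j then 1 else 0))"

definition copies :: "nat \<Rightarrow> 'i list set" where
  "copies m = {is. length is = m}"

definition tensor_power :: "nat \<Rightarrow> ('p \<times> 'q \<Rightarrow> complex) \<Rightarrow> 'p list \<Rightarrow> 'q list \<Rightarrow> complex" where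
  "tensor_power m \<psi> ps qs = (\<Prod>k<m. \<psi> (ps ! k, qs ! k))"

text \<open>
  The probability that the honest outputs are \<open>xs\<close> and the joint measurement \<open>E\<close> of the adversary on
  all \<open>m\<close> copies yields \<open>z\<close>.
\<close>

definition attack_prob ::
  "('x::finite, 'a::finite, 'y::finite, 'b::finite) state \<Rightarrow> nat \<Rightarrow>
   (nat \<Rightarrow> ('y \<times> 'b) list opr) \<Rightarrow> 'x list \<Rightarrow> nat \<Rightarrow> real" where
  "attack_prob \<psi> m E xs z =
     Re (\<Sum>ps | ps \<in> copies m \<and> map fst ps = xs. \<Sum>qs\<in>copies m. \<Sum>qs'\<in>copies m.
           cnj (tensor_power m \<psi> ps qs) * E z qs qs' * tensor_power m \<psi> ps qs')"

text \<open>
  A strategy of the adversary in the interaction with several ideal functionalities: output a value;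
  submit \<open>s\<close> to the \<open>k\<close>-th functionality and continue depending on the outcome; or draw private
  randomness and continue depending on it.
\<close>

datatype strategy =
    Output nat
  | Query nat real "nat \<Rightarrow> strategy"
  | Randomize "nat pmf" "nat \<Rightarrow> strategy"

primrec valid_strategy :: "nat \<Rightarrow> strategy \<Rightarrow> bool" where
  "valid_strategy m (Output z) \<longleftrightarrow> True"
| "valid_strategy m (Query k s f) \<longleftrightarrow> k < m \<and> s \<in> {0..1} \<and> (\<forall>r. valid_strategy m (f r))"
| "valid_strategy m (Randomize p f) \<longleftrightarrow> (\<forall>r. valid_strategy m (f r))"

definition apply_fst :: "('p::finite) opr \<Rightarrow> ('p \<times> 'q \<Rightarrow> complex) \<Rightarrow> ('p \<times> 'q \<Rightarrow> complex)" where
  "apply_fst K \<phi> = (\<lambda>(p, q). \<Sum>p'\<in>UNIV. K p p' * \<phi> (p', q))"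

definition apply_snd :: "('q::finite) opr \<Rightarrow> ('p \<times> 'q \<Rightarrow> complex) \<Rightarrow> ('p \<times> 'q \<Rightarrow> complex)" where
  "apply_snd K \<phi> = (\<lambda>(p, q). \<Sum>q'\<in>UNIV. K q q' * \<phi> (p, q'))"

definition norm_sq :: "('n::finite \<Rightarrow> complex) \<Rightarrow> real" where
  "norm_sq \<phi> = (\<Sum>n\<in>UNIV. (cmod (\<phi> n))\<^sup>2)"

text \<open>
  \<open>simulation_prob M N m \<sigma> \<phi> xs z\<close> is the probability that, when the \<open>k\<close>-th of \<open>m\<close> ideal
  functionalities (with encodings \<open>M\<close>, \<open>N\<close>) holds the residual state \<open>\<phi> k\<close>, the strategy \<open>\<sigma>\<close> outputs
  \<open>z\<close> and the honest party, who submits \<open>0\<close> to every functionality, obtains \<open>xs\<close>.  Residual states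
  are left unnormalized, so that their squared norms carry the probabilities of the outcomes obtained
  so far.  The honest queries are evaluated last; they commute with those of the adversary.
\<close>

primrec simulation_prob ::
  "(real \<Rightarrow> ('x::finite \<times> 'a::finite) measurement) \<Rightarrow>
   (real \<Rightarrow> ('y::finite \<times> 'b::finite) measurement) \<Rightarrow> nat \<Rightarrow> strategy \<Rightarrow>
   (nat \<Rightarrow> ('x, 'a, 'y, 'b) state) \<Rightarrow> 'x list \<Rightarrow> nat \<Rightarrow> real" where
  "simulation_prob M N m (Output w) \<phi> xs z =
     (if w = z then \<Prod>k<m. norm_sq (apply_fst (M 0 (to_nat (xs ! k))) (\<phi> k)) else 0)"
| "simulation_prob M N m (Query k s f) \<phi> xs z =
     (\<Sum>r\<in>outcomes (N s). simulation_prob M N m (f r) (\<phi>(k := apply_snd (N s r) (\<phi> k))) xs z)"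
| "simulation_prob M N m (Randomize p f) \<phi> xs z =
     measure_pmf.expectation p (\<lambda>r. simulation_prob M N m (f r) \<phi> xs z)"

definition attacks_simulated ::
  "(real \<Rightarrow> ('x::finite \<times> 'a::finite) measurement) \<Rightarrow>
   (real \<Rightarrow> ('y::finite \<times> 'b::finite) measurement) \<Rightarrow> ('x, 'a, 'y, 'b) state \<Rightarrow> nat \<Rightarrow> bool" where
  "attacks_simulated M N \<psi> m \<longleftrightarrow>
     (\<forall>n E. is_povm (copies m) n E \<longrightarrow>
        (\<exists>\<sigma>. valid_strategy m \<sigma> \<and>
           (\<forall>xs\<in>copies m. \<forall>z<n.
              simulation_prob M N m \<sigma> (\<lambda>k. \<psi>) xs z = attack_prob \<psi> m E xs z)))"

definition weakly_self_composable ::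
  "('x::finite, 'a::finite, 'y::finite, 'b::finite) state \<Rightarrow> bool" where
  "weakly_self_composable \<psi> \<longleftrightarrow>
     (\<exists>M N. ideal_functionality M N \<and>
        (\<forall>m>0. attacks_simulated M N \<psi> m \<and> attacks_simulated N M (swap_state \<psi>) m))"

end

theory Submission
  imports Defs
begin

text \<open>
  Let \<open>|\<psi>\<^sub>x\<^sub>,\<^sub>a\<rangle>\<close> be Bob's unnormalized state when Alice's registers are \<open>x, a\<close>.  If \<open>\<psi>\<^sub>x\<^sub>,\<^sub>a\<close> and \<open>\<psi>\<^sub>x\<^sub>'\<^sub>,\<^sub>a\<^sub>'\<close>
  are orthogonal whenever \<open>x\<close> and \<open>x'\<close> have different dependent parts, then \<open>S(X\<searrow>Y|BB') = 0\<close>.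
  So suppose that two values \<open>x\<^sub>0, x\<^sub>1\<close> with different dependent parts violate this.

  Correctness and the equality case of Klein's inequality show that the state of \<open>B'\<close> given
  \<open>x, y\<close> does not depend on \<open>x\<close>, and that of \<open>A'\<close> does not depend on \<open>y\<close>.  Hence the Gram matrix
  of \<open>(\<psi>\<^sub>x\<^sub>0\<^sub>,\<^sub>a)\<^sub>a\<close> commutes with \<open>T T\<^sup>*\<close>, where \<open>T\<close> is the matrix of inner products of the \<open>\<psi>\<^sub>x\<^sub>0\<^sub>,\<^sub>a\<close>
  with the \<open>\<psi>\<^sub>x\<^sub>1\<^sub>,\<^sub>a\<^sub>'\<close>, so the eigenvectors of Bob's two conditional states are at the same time principal
  vectors, with principal values \<open>D\<^sub>k\<close>.  A pair with \<open>D\<^sub>k > 0\<close> is not parallel, because its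
  members have the distinct \<open>Y\<close>-distributions \<open>P(\<cdot>|x\<^sub>0)\<close> and \<open>P(\<cdot>|x\<^sub>1)\<close>.

  Queries to ideal functionalities act on each copy separately and preserve the sum over the
  outcomes of the overlaps.  By Cauchy-Schwarz, every strategy on two copies satisfies
  \<open>\<Sum>\<^sub>z \<surd>(p\<^sub>z(u\<^sub>z) p\<^sub>z(v\<^sub>z)) \<ge> (\<Sum>\<^sub>k D\<^sub>k)\<^sup>2\<close> for any complementary pairs \<open>u\<^sub>z, v\<^sub>z \<in> {x\<^sub>0, x\<^sub>1}\<^sup>2\<close>.  The product
  measurement in the eigenbasis for \<open>x\<^sub>0\<close> attains this bound, and rotating it to an entangled one
  in the plane spanned by one of its vectors and a vector excluding \<open>x\<^sub>0\<close> on both copies violates it.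
\<close>


section \<open>The spectral theorem\<close>

text \<open>A single copy offers no advantage, since an ideal functionality may provide every local
  POVM; the separation has to come from measuring two copies jointly. Against a pair fixed in
  advance even a joint measurement gains nothing: the sum of the \<open>D k\<close> is the trace
  norm of \<open>T\<close>, that is, the unnormalized fidelity of Bob's two conditional states, and
  no measurement pushes the statistical overlap of two states below their fidelity. This is why the
  pairs must be allowed to depend on the outcome. Separate queries cannot exploit this freedom,
  because the modulus of an overlap is unchanged when \<open>x0\<close> and \<open>x1\<close> are
  exchanged on one copy. The entangled measurement can: one of its outcomes is judged on
  \<open>x0 x1\<close> against \<open>x1 x0\<close>, all others on \<open>x0 x0\<close> against
  \<open>x1 x1\<close>. The commutation relation makes the eigenbasis for \<open>x0\<close> an
  optimal measurement for the fidelity, and non-parallelism provides a direction that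
  \<open>x0\<close> never yields but \<open>x1\<close> does, which is what the rotation
  needs.\<close>

definition ip :: "'i set \<Rightarrow> ('i \<Rightarrow> complex) \<Rightarrow> ('i \<Rightarrow> complex) \<Rightarrow> complex" where
  "ip I u v = (\<Sum>i\<in>I. cnj (u i) * v i)"

definition orthonormal :: "'i set \<Rightarrow> 'k set \<Rightarrow> ('k \<Rightarrow> 'i \<Rightarrow> complex) \<Rightarrow> bool" where
  "orthonormal I K e \<longleftrightarrow> (\<forall>k\<in>K. \<forall>l\<in>K. ip I (e k) (e l) = (if k = l then 1 else 0))"

text \<open>Completeness is required besides orthonormality, which avoids dimension counts.
  Labelling the vectors by \<open>I\<close> itself lets bases of subsets of \<open>I\<close> be
  glued together.\<close>

definition onb :: "'i set \<Rightarrow> ('i \<Rightarrow> 'i \<Rightarrow> complex) \<Rightarrow> bool" where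
  "onb I e \<longleftrightarrow> orthonormal I I e \<and>
     (\<forall>i\<in>I. \<forall>j\<in>I. (\<Sum>k\<in>I. e k i * cnj (e k j)) = (if i = j then 1 else 0))"

definition hermitian_on :: "'i set \<Rightarrow> 'i opr \<Rightarrow> bool" where
  "hermitian_on I \<rho> \<longleftrightarrow> (\<forall>i\<in>I. \<forall>j\<in>I. \<rho> j i = cnj (\<rho> i j))"

lemma cnj_ip: "cnj (ip I u v) = ip I v u"
  by (simp add: ip_def mult.commute)

lemma ip_self: "ip I u u = of_real (\<Sum>i\<in>I. (cmod (u i))\<^sup>2)"
  by (simp add: ip_def complex_norm_square mult.commute del: of_real_power)

lemma ip_add_right: "ip I u (\<lambda>i. v i + w i) = ip I u v + ip I u w"
  by (simp add: ip_def algebra_simps sum.distrib)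

lemma ip_diff_right: "ip I u (\<lambda>i. v i - w i) = ip I u v - ip I u w"
  by (simp add: ip_def algebra_simps sum_subtractf)

lemma ip_scale_right: "ip I u (\<lambda>i. c * v i) = c * ip I u v"
  by (simp add: ip_def sum_distrib_left algebra_simps)

lemma ip_scale_left: "ip I (\<lambda>i. c * u i) v = cnj c * ip I u v"
  by (simp add: ip_def sum_distrib_left algebra_simps)

lemma ip_sum_right: "ip I u (\<lambda>i. \<Sum>k\<in>K. f k i) = (\<Sum>k\<in>K. ip I u (f k))"
  unfolding ip_def sum_distrib_left by (rule sum.swap)

lemma ip_sum_left: "ip I (\<lambda>i. \<Sum>k\<in>K. f k i) v = (\<Sum>k\<in>K. ip I (f k) v)"
  unfolding ip_def cnj_sum sum_distrib_right by (rule sum.swap)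

lemma ip_cong: "(\<And>i. i \<in> I \<Longrightarrow> u i = u' i) \<Longrightarrow> (\<And>i. i \<in> I \<Longrightarrow> v i = v' i) \<Longrightarrow> ip I u v = ip I u' v'"
  by (simp add: ip_def)

lemma onb_expand:
  assumes "finite I" "onb I e" "i \<in> I"
  shows "v i = (\<Sum>k\<in>I. ip I (e k) v * e k i)"
proof -
  have "(\<Sum>k\<in>I. ip I (e k) v * e k i) = (\<Sum>k\<in>I. \<Sum>j\<in>I. v j * (e k i * cnj (e k j)))"
    by (simp add: ip_def sum_distrib_right sum_distrib_left algebra_simps)
  also have "\<dots> = (\<Sum>j\<in>I. v j * (\<Sum>k\<in>I. e k i * cnj (e k j)))"
    by (subst sum.swap) (simp add: sum_distrib_left)
  also have "\<dots> = (\<Sum>j\<in>I. v j * (if i = j then 1 else 0))"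
    using assms by (intro sum.cong) (auto simp: onb_def)
  also have "\<dots> = v i" using assms by (simp add: if_distrib cong: if_cong)
  finally show ?thesis by simp
qed

lemma onb_parseval:
  assumes "finite I" "onb I e"
  shows "ip I u v = (\<Sum>k\<in>I. ip I u (e k) * ip I (e k) v)"
proof -
  have "ip I u v = ip I u (\<lambda>i. \<Sum>k\<in>I. ip I (e k) v * e k i)"
    using onb_expand[OF assms] by (intro ip_cong) auto
  also have "\<dots> = (\<Sum>k\<in>I. ip I u (e k) * ip I (e k) v)"
    unfolding ip_sum_right ip_scale_right by (simp add: mult.commute)
  finally show ?thesis .
qed

text \<open>A nonempty complex matrix has nonempty spectrum; the enumeration \<open>g\<close>
  carries an eigenvector back to a function on \<open>I\<close>.\<close>

lemma eigenvector_exists: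
  fixes \<rho> :: "'i opr"
  assumes "finite I" "I \<noteq> {}"
  shows "\<exists>v \<mu>. (\<exists>i\<in>I. v i \<noteq> 0) \<and> (\<forall>i\<in>I. (\<Sum>j\<in>I. \<rho> i j * v j) = \<mu> * v i)"
proof -
  define n where "n = card I"
  define g where "g = from_nat_into I"
  have g: "bij_betw g {..<n} I"
    unfolding g_def n_def by (rule bij_betw_from_nat_into_finite[OF assms(1)])
  define h where "h = the_inv_into {..<n} g"
  have hg: "h (g l) = l" if "l < n" for l
    unfolding h_def using g that by (simp add: bij_betw_def the_inv_into_f_f)
  let ?A = "matrix_on I \<rho>"
  have A: "?A \<in> carrier_mat n n" by (simp add: matrix_on_def n_def)
  have "n \<noteq> 0" using assms by (simp add: n_def)
  then obtain \<mu> where "\<mu> \<in> spectrum ?A" using spectrum_non_empty[OF A] by auto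
  then obtain w where "eigenvector ?A w \<mu>" by (auto simp: spectrum_def eigenvalue_def)
  then have w: "w \<in> carrier_vec n" "w \<noteq> 0\<^sub>v n" and ev: "?A *\<^sub>v w = \<mu> \<cdot>\<^sub>v w"
    using A by (auto simp: eigenvector_def)
  define v where "v i = w $ h i" for i
  have eig: "(\<Sum>j\<in>I. \<rho> (g l) j * v j) = \<mu> * v (g l)" if l: "l < n" for l
  proof -
    have "(\<Sum>j\<in>I. \<rho> (g l) j * v j) = (\<Sum>k<n. \<rho> (g l) (g k) * v (g k))"
      using sum.reindex_bij_betw[OF g, of "\<lambda>j. \<rho> (g l) j * v j"] by simp
    also have "\<dots> = (\<Sum>k<n. \<rho> (g l) (g k) * w $ k)" by (simp add: v_def hg)
    also have "\<dots> = (?A *\<^sub>v w) $ l"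
      using l w by (auto simp: matrix_on_def scalar_prod_def g_def n_def atLeast0LessThan intro!: sum.cong)
    also have "\<dots> = \<mu> * v (g l)" using ev l w by (simp add: v_def hg)
    finally show ?thesis .
  qed
  obtain l where l: "l < n" "w $ l \<noteq> 0"
    using w by (metis carrier_vecD eq_vecI index_zero_vec(1) index_zero_vec(2))
  have "v (g l) \<noteq> 0" using l by (simp add: v_def hg)
  moreover have "g l \<in> I" using g l by (auto simp: bij_betw_def)
  moreover have "(\<Sum>j\<in>I. \<rho> i j * v j) = \<mu> * v i" if "i \<in> I" for i
    using that g eig unfolding bij_betw_def by auto
  ultimately show ?thesis by blast
qed

text \<open>The condition \<open>r \<le> 0\<close> keeps \<open>v\<close> away from the basis vector at \<open>c\<close>, with which the reflection exchanges it.\<close>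

lemma householder_onb:
  assumes I: "finite I" "c \<in> I" and v: "ip I v v = 1" and vc: "v c = of_real r" "r \<le> 0"
  shows "\<exists>e. onb I e \<and> e c = v"
proof -
  define w where "w i = v i - (if i = c then 1 else 0)" for i
  \<comment> \<open>This is 2 divided by the squared norm of \<open>w\<close>, so that
    \<open>H\<close> below is the reflection in the hyperplane orthogonal to
    \<open>w\<close>.\<close>
  define s :: complex where "s = of_real (1 / (1 - r))"
  have r: "1 - r \<noteq> 0" using vc by simp
  have r': "1 - complex_of_real r \<noteq> 0" using r by (metis of_real_1 of_real_diff of_real_eq_0_iff)
  have d: "(\<Sum>i\<in>I. (if i = c then 1 else 0) * f i) = f c" "(\<Sum>i\<in>I. f i * (if i = c then 1 else 0)) = f c"
    for f :: "_ \<Rightarrow> complex"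
    using I by (simp_all add: if_distrib if_distribR cong: if_cong)
  have ww: "ip I w w = of_real (2 * (1 - r))"
  proof -
    have "ip I w w = (\<Sum>i\<in>I. cnj (v i) * v i) - (\<Sum>i\<in>I. (if i = c then 1 else 0) * v i)
        - (\<Sum>i\<in>I. cnj (v i) * (if i = c then 1 else 0)) + (\<Sum>i\<in>I. (if i = c then 1 else 0) * (if i = c then 1 else 0))"
      unfolding ip_def w_def sum_subtractf[symmetric] sum.distrib[symmetric]
      by (rule sum.cong) (auto simp: algebra_simps)
    then show ?thesis using v vc by (simp only: d) (simp add: ip_def)
  qed
  define H where "H j i = (if i = j then 1 else 0) - s * w i * cnj (w j)" for i j
  have cs: "cnj s = s" by (simp add: s_def)
  have dd: "(\<Sum>i\<in>I. (if i = j then 1 else 0) * f i) = f j" "(\<Sum>i\<in>I. f i * (if i = j then 1 else 0)) = f j"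
    if "j \<in> I" for f :: "_ \<Rightarrow> complex" and j
    using I that by (simp_all add: if_distrib if_distribR cong: if_cong)
  have sq: "(\<Sum>i\<in>I. cnj (H j i) * H k i) = (if j = k then 1 else 0)" if "j \<in> I" "k \<in> I" for j k
  proof -
    have "(\<Sum>i\<in>I. cnj (H j i) * H k i) =
        (\<Sum>i\<in>I. (if i = j then 1 else 0) * (if i = k then 1 else 0))
        - (\<Sum>i\<in>I. (if i = j then 1 else 0) * (s * w i * cnj (w k)))
        - (\<Sum>i\<in>I. (s * cnj (w i) * w j) * (if i = k then 1 else 0))
        + (\<Sum>i\<in>I. s * s * w j * cnj (w k) * (cnj (w i) * w i))"
      unfolding H_def sum_subtractf[symmetric] sum.distrib[symmetric]
      by (rule sum.cong) (auto simp: algebra_simps cs)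
    also have "\<dots> = (if j = k then 1 else 0) - 2 * s * w j * cnj (w k) + s * s * w j * cnj (w k) * ip I w w"
      using that by (simp only: dd) (simp add: ip_def sum_distrib_left)
    also have "s * s * w j * cnj (w k) * ip I w w = 2 * s * w j * cnj (w k)"
    proof -
      have "1 / (1 - r) * (2 * (1 - r)) = 2" using r by (simp add: divide_eq_eq)
      then have "s * ip I w w = 2" unfolding ww s_def by (metis of_real_mult of_real_numeral)
      then show ?thesis by (simp add: mult.assoc mult.left_commute)
    qed
    finally show ?thesis by simp
  qed
  have Hcnj: "H j i = cnj (H i j)" for i j by (simp add: H_def cs algebra_simps)
  have "onb I H"
    unfolding onb_def orthonormal_def
  proof (intro conjI ballI)
    fix j k assume "j \<in> I" "k \<in> I"
    then show "ip I (H j) (H k) = (if j = k then 1 else 0)" using sq by (simp add: ip_def)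
    have "(\<Sum>i\<in>I. H i j * cnj (H i k)) = (\<Sum>i\<in>I. cnj (H j i) * H k i)"
    proof (rule sum.cong[OF refl])
      fix i show "H i j * cnj (H i k) = cnj (H j i) * H k i"
        by (simp only: Hcnj[of j i] Hcnj[of k i] complex_cnj_cnj)
    qed
    then show "(\<Sum>i\<in>I. H i j * cnj (H i k)) = (if j = k then 1 else 0)" using sq \<open>j \<in> I\<close> \<open>k \<in> I\<close> by simp
  qed
  moreover have "H c = v"
  proof
    fix i
    have "s * cnj (w c) = -1" using r' vc by (simp add: w_def s_def field_simps)
    then have "s * w i * cnj (w c) = - w i" by (metis mult.commute mult.left_commute mult_minus1)
    then show "H c i = v i" by (simp add: H_def w_def)
  qed
  ultimately show ?thesis by blast
qed

lemma onb_through: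
  assumes I: "finite I" "c \<in> I" and v: "\<exists>i\<in>I. v i \<noteq> 0"
  shows "\<exists>e a. onb I e \<and> a \<noteq> 0 \<and> e c = (\<lambda>i. a * v i)"
proof -
  define N where "N = sqrt (\<Sum>i\<in>I. (cmod (v i))\<^sup>2)"
  have pos: "(\<Sum>i\<in>I. (cmod (v i))\<^sup>2) > 0"
  proof -
    obtain i where i: "i \<in> I" "v i \<noteq> 0" using v by blast
    then show ?thesis using I by (intro sum_pos2[of I i]) auto
  qed
  \<comment> \<open>The modulus normalizes \<open>v\<close>; the phase makes the coordinate at
    \<open>c\<close> real and nonpositive, as the reflection requires.\<close>
  define a where "a = (if v c = 0 then 1 else - cnj (sgn (v c))) / of_real N"
  have N: "N > 0" "N * N = (\<Sum>i\<in>I. (cmod (v i))\<^sup>2)" using pos by (auto simp: N_def)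
  have ca: "cmod a = 1 / N" using N by (auto simp: a_def norm_divide norm_sgn)
  have a0: "a \<noteq> 0" using ca N by auto
  have "ip I (\<lambda>i. a * v i) (\<lambda>i. a * v i) = of_real ((\<Sum>i\<in>I. (cmod (a * v i))\<^sup>2))" by (rule ip_self)
  also have "(\<Sum>i\<in>I. (cmod (a * v i))\<^sup>2) = (\<Sum>i\<in>I. (cmod (v i))\<^sup>2) / (N * N)"
    by (simp add: norm_mult ca power_mult_distrib sum_divide_distrib power_divide power2_eq_square)
  also have "\<dots> = 1" using N pos by simp
  finally have 1: "ip I (\<lambda>i. a * v i) (\<lambda>i. a * v i) = 1" by simp
  have 2: "a * v c = of_real (- cmod (v c) / N)"
  proof (cases "v c = 0")
    case False
    have "cnj (sgn (v c)) * v c = of_real (cmod (v c))"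
      using False by (simp add: sgn_div_norm scaleR_conv_of_real field_simps complex_norm_square[symmetric] power2_eq_square)
    then show ?thesis using False N by (simp add: a_def field_simps)
  qed simp
  have "- cmod (v c) / N \<le> 0" using N by simp
  from householder_onb[OF I 1 2 this] show ?thesis using a0 by blast
qed

section \<open>Diagonalization of hermitian operators\<close>

definition app :: "'i set \<Rightarrow> 'i opr \<Rightarrow> ('i \<Rightarrow> complex) \<Rightarrow> 'i \<Rightarrow> complex" where
  "app I \<rho> v i = (\<Sum>j\<in>I. \<rho> i j * v j)"

lemma app_sum: "app I \<rho> (\<lambda>i. \<Sum>k\<in>K. c k * f k i) i = (\<Sum>k\<in>K. c k * app I \<rho> (f k) i)"
proof -
  have "app I \<rho> (\<lambda>i. \<Sum>k\<in>K. c k * f k i) i = (\<Sum>j\<in>I. \<Sum>k\<in>K. c k * (\<rho> i j * f k j))"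
    by (simp add: app_def sum_distrib_left algebra_simps)
  also have "\<dots> = (\<Sum>k\<in>K. \<Sum>j\<in>I. c k * (\<rho> i j * f k j))" by (rule sum.swap)
  finally show ?thesis by (simp add: app_def sum_distrib_left)
qed

lemma app_scale: "app I \<rho> (\<lambda>i. c * f i) i = c * app I \<rho> f i"
  by (simp add: app_def sum_distrib_left algebra_simps)

lemma ip_app_hermitian:
  assumes "hermitian_on I \<rho>"
  shows "ip I u (app I \<rho> w) = ip I (app I \<rho> u) w"
proof -
  have "ip I u (app I \<rho> w) = (\<Sum>i\<in>I. \<Sum>j\<in>I. cnj (u i) * \<rho> i j * w j)"
    by (simp add: ip_def app_def sum_distrib_left mult.assoc)
  also have "\<dots> = (\<Sum>j\<in>I. \<Sum>i\<in>I. cnj (u i) * \<rho> i j * w j)" by (rule sum.swap)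
  also have "\<dots> = (\<Sum>j\<in>I. \<Sum>i\<in>I. cnj (\<rho> j i * u i) * w j)"
    using assms by (intro sum.cong refl) (metis complex_cnj_cnj complex_cnj_mult hermitian_on_def mult.commute)
  also have "\<dots> = ip I (app I \<rho> u) w" by (simp add: ip_def app_def sum_distrib_right)
  finally show ?thesis .
qed

text \<open>Vectors of different blocks have disjoint supports. With \<open>p k\<close> being
  \<open>k = c\<close> this adjoins one vector to a basis of its complement; with \<open>p\<close>
  the eigenvalue it assembles bases of eigenspaces.\<close>

lemma onb_blocks:
  assumes I: "finite I" and e: "\<And>t. onb {k\<in>I. p k = t} (e t)"
  shows "onb I (\<lambda>k j. if p j = p k then e (p k) k j else 0)"
proof -
  let ?E = "\<lambda>k j. if p j = p k then e (p k) k j else 0"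
  let ?I = "\<lambda>t. {k\<in>I. p k = t}"
  have "ip I (?E k) (?E l) = (if k = l then 1 else 0)" if "k \<in> I" "l \<in> I" for k l
  proof (cases "p k = p l")
    case True
    have "ip I (?E k) (?E l) = ip (?I (p k)) (e (p k) k) (e (p k) l)"
      unfolding ip_def using I True by (intro sum.mono_neutral_cong_right) auto
    then show ?thesis using e[of "p k"] that True by (simp add: onb_def orthonormal_def)
  next
    case False
    then have "ip I (?E k) (?E l) = 0" unfolding ip_def by (intro sum.neutral) auto
    then show ?thesis using False by auto
  qed
  moreover have "(\<Sum>k\<in>I. ?E k i * cnj (?E k j)) = (if i = j then 1 else 0)" if "i \<in> I" "j \<in> I" for i j
  proof (cases "p i = p j")
    case True
    have "(\<Sum>k\<in>I. ?E k i * cnj (?E k j)) = (\<Sum>k\<in>?I (p i). e (p i) k i * cnj (e (p i) k j))"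
      using I True by (intro sum.mono_neutral_cong_right) auto
    then show ?thesis using e[of "p i"] that True by (simp add: onb_def)
  next
    case False
    then have "(\<Sum>k\<in>I. ?E k i * cnj (?E k j)) = 0" by (intro sum.neutral) auto
    then show ?thesis using False by auto
  qed
  ultimately show ?thesis by (simp add: onb_def orthonormal_def)
qed

text \<open>Reading \<open>E\<close> as coordinates with respect to \<open>f\<close>, a product of
  two unitary matrices is unitary. This lifts a diagonalization found in coordinates back to the
  original space.\<close>

lemma onb_compose:
  assumes I: "finite I" and E: "onb I E" and f: "onb I f"
  shows "onb I (\<lambda>k i. \<Sum>j\<in>I. E k j * f j i)"
proof -
  let ?g = "\<lambda>k i. \<Sum>j\<in>I. E k j * f j i"
  have fg: "ip I (f j) (?g k) = E k j" if "j \<in> I" for j k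
  proof -
    have "ip I (f j) (?g k) = (\<Sum>m\<in>I. E k m * (if j = m then 1 else 0))"
      unfolding ip_sum_right ip_scale_right using f that by (auto simp: onb_def orthonormal_def intro!: sum.cong)
    then show ?thesis using I that by (simp add: if_distrib cong: if_cong)
  qed
  have gf: "ip I (?g k) (f j) = cnj (E k j)" if "j \<in> I" for j k
    using fg[OF that] cnj_ip by metis
  have "ip I (?g k) (?g l) = (if k = l then 1 else 0)" if "k \<in> I" "l \<in> I" for k l
  proof -
    have "ip I (?g k) (?g l) = (\<Sum>j\<in>I. ip I (?g k) (f j) * ip I (f j) (?g l))"
      by (rule onb_parseval[OF I f])
    also have "\<dots> = ip I (E k) (E l)"
      unfolding ip_def[of I "E k"] by (intro sum.cong) (simp_all add: fg gf)
    finally show ?thesis using E that by (simp add: onb_def orthonormal_def)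
  qed
  moreover have "(\<Sum>k\<in>I. ?g k i * cnj (?g k j)) = (if i = j then 1 else 0)" if "i \<in> I" "j \<in> I" for i j
  proof -
    have "(\<Sum>k\<in>I. ?g k i * cnj (?g k j)) = (\<Sum>k\<in>I. \<Sum>m\<in>I. \<Sum>n\<in>I. f m i * cnj (f n j) * (E k m * cnj (E k n)))"
      by (simp add: sum_product algebra_simps)
    also have "\<dots> = (\<Sum>m\<in>I. \<Sum>n\<in>I. f m i * cnj (f n j) * (\<Sum>k\<in>I. E k m * cnj (E k n)))"
      unfolding sum_distrib_left by (subst sum.swap, rule sum.cong[OF refl], rule sum.swap)
    also have "\<dots> = (\<Sum>m\<in>I. \<Sum>n\<in>I. f m i * cnj (f n j) * (if m = n then 1 else 0))"
      using E by (intro sum.cong refl) (auto simp: onb_def)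
    also have "\<dots> = (\<Sum>m\<in>I. f m i * cnj (f m j))"
      using I by (simp add: if_distrib cong: if_cong)
    finally show ?thesis using f that by (simp add: onb_def)
  qed
  ultimately show ?thesis by (simp add: onb_def orthonormal_def)
qed

lemma onb_singleton: "onb {c} (\<lambda>k j. 1)"
  by (simp add: onb_def orthonormal_def ip_def)

lemma hermitian_compression:
  assumes "hermitian_on I \<rho>"
  shows "hermitian_on J (\<lambda>j k. ip I (b j) (app I \<rho> (b k)))"
  by (simp add: hermitian_on_def cnj_ip ip_app_hermitian[OF assms])

text \<open>Induction on the dimension: complete one eigenvector to a basis, diagonalize the
  compression to its orthogonal complement, and transport the result back.\<close>

lemma spectral_theorem:
  assumes "finite I" "hermitian_on I \<rho>"
  shows "\<exists>e d. onb I e \<and> (\<forall>k\<in>I. \<forall>i\<in>I. app I \<rho> (e k) i = of_real (d k) * e k i)"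
  using assms
proof (induction "card I" arbitrary: I \<rho>)
  case 0
  then show ?case by (auto simp: onb_def orthonormal_def)
next
  case (Suc n)
  note I = \<open>finite I\<close> and herm = \<open>hermitian_on I \<rho>\<close>
  have "I \<noteq> {}" using Suc.hyps(2) by auto
  then obtain c where c: "c \<in> I" by auto
  obtain v \<mu> where v: "\<exists>i\<in>I. v i \<noteq> 0" and ev: "\<And>i. i \<in> I \<Longrightarrow> app I \<rho> v i = \<mu> * v i"
    using eigenvector_exists[OF I \<open>I \<noteq> {}\<close>, of \<rho>] unfolding app_def by auto
  obtain b a where b: "onb I b" and bc: "b c = (\<lambda>i. a * v i)"
    using onb_through[OF I c v] by blast
  have evb: "app I \<rho> (b c) i = \<mu> * b c i" if "i \<in> I" for i
    using ev[OF that] by (simp add: bc app_scale algebra_simps)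
  have bb: "ip I (b k) (b l) = (if k = l then 1 else 0)" if "k \<in> I" "l \<in> I" for k l
    using b that by (simp add: onb_def orthonormal_def)
  have ipc: "ip I (app I \<rho> (b c)) w = cnj \<mu> * ip I (b c) w" for w
    using evb by (subst ip_scale_left[symmetric], intro ip_cong) auto
  have "ip I (b c) (app I \<rho> (b c)) = \<mu> * ip I (b c) (b c)"
    using evb by (subst ip_scale_right[symmetric], intro ip_cong) auto
  then have "cnj \<mu> = \<mu>" using ip_app_hermitian[OF herm, of "b c" "b c"] ipc bb[OF c c] by simp
  then obtain m where m: "\<mu> = of_real m" by (metis Reals_cases Reals_cnj_iff)
  let ?J = "I - {c}"
  \<comment> \<open>The matrix of \<open>\<rho>\<close> in the basis \<open>b\<close>; restricted to
    \<open>?J\<close> it is the compression to the complement of the eigenvector.\<close>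
  define N where "N j k = ip I (b j) (app I \<rho> (b k))" for j k
  have "n = card ?J" using Suc.hyps(2) c I by simp
  moreover have "hermitian_on ?J N" unfolding N_def by (rule hermitian_compression[OF herm])
  ultimately obtain e d where e: "onb ?J e"
    and ed: "\<And>k i. k \<in> ?J \<Longrightarrow> i \<in> ?J \<Longrightarrow> app ?J N (e k) i = of_real (d k) * e k i"
    using Suc.hyps(1)[of ?J N] I by blast
  define E where "E = (\<lambda>k j. if (j = c) = (k = c) then (if k = c then (\<lambda>_ _. 1) else e) k j else 0)"
  have "{k\<in>I. (k = c) = t} = (if t then {c} else ?J)" for t using c by auto
  then have "onb {k\<in>I. (k = c) = t} (if t then (\<lambda>_ _. 1) else e)" for t
    using e onb_singleton by auto
  from onb_blocks[OF I this] have E: "onb I E" unfolding E_def .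
  define g where "g k i = (\<Sum>j\<in>I. E k j * b j i)" for k i
  have g: "onb I g" unfolding g_def by (rule onb_compose[OF I E b])
  have gc: "g c i = b c i" for i
  proof -
    have "g c i = (\<Sum>j\<in>I. if j = c then b j i else 0)" unfolding g_def E_def by (rule sum.cong) auto
    then show ?thesis using I c by simp
  qed
  have gk: "g k i = (\<Sum>j\<in>?J. e k j * b j i)" if "k \<in> ?J" for k i
    unfolding g_def E_def using that I by (intro sum.mono_neutral_cong_right) auto
  have "app I \<rho> (g k) i = complex_of_real ((d(c := m)) k) * g k i" if "k \<in> I" "i \<in> I" for k i
  proof (cases "k = c")
    case True
    then show ?thesis using gc evb[OF that(2)] m by (simp add: app_def)
  next
    case False
    then have k: "k \<in> ?J" using that by auto
    have gk': "g k = (\<lambda>i. \<Sum>j\<in>?J. e k j * b j i)" using gk[OF k] by auto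
    have ag: "app I \<rho> (g k) = (\<lambda>i. \<Sum>j\<in>?J. e k j * app I \<rho> (b j) i)"
      unfolding gk' by (rule ext, rule app_sum)
    \<comment> \<open>A hermitian operator maps the complement of an eigenvector into itself, so the
      compression loses nothing.\<close>
    have c0: "ip I (b c) (app I \<rho> (g k)) = 0"
    proof -
      have "ip I (g c) (g k) = 0" using g k c that unfolding onb_def orthonormal_def by auto
      moreover have "g c = b c" using gc by auto
      ultimately show ?thesis unfolding ip_app_hermitian[OF herm] ipc by simp
    qed
    have j: "ip I (b j) (app I \<rho> (g k)) = of_real (d k) * e k j" if "j \<in> ?J" for j
    proof -
      have "ip I (b j) (app I \<rho> (g k)) = (\<Sum>l\<in>?J. e k l * N j l)"
        unfolding ag N_def ip_sum_right ip_scale_right ..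
      also have "\<dots> = app ?J N (e k) j" by (simp add: app_def mult.commute)
      finally show ?thesis using ed[OF k that] by simp
    qed
    have "app I \<rho> (g k) i = (\<Sum>j\<in>I. ip I (b j) (app I \<rho> (g k)) * b j i)"
      by (rule onb_expand[OF I b that(2)])
    also have "\<dots> = (\<Sum>j\<in>?J. ip I (b j) (app I \<rho> (g k)) * b j i)"
      using c0 I by (intro sum.mono_neutral_right) auto
    also have "\<dots> = of_real (d k) * g k i"
      using j gk[OF k] by (simp add: sum_distrib_left mult.assoc)
    finally show ?thesis using False by simp
  qed
  then show ?case using g by blast
qed

lemma eigenbasis_decomposition:
  assumes "finite I" "onb I e" "\<And>k i. k \<in> I \<Longrightarrow> i \<in> I \<Longrightarrow> app I \<rho> (e k) i = d k * e k i" "i \<in> I" "j \<in> I"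
  shows "\<rho> i j = (\<Sum>k\<in>I. d k * e k i * cnj (e k j))"
proof -
  have "(\<Sum>k\<in>I. d k * e k i * cnj (e k j)) = (\<Sum>k\<in>I. \<Sum>l\<in>I. \<rho> i l * (e k l * cnj (e k j)))"
  proof (rule sum.cong[OF refl])
    fix k assume "k \<in> I"
    from assms(3)[OF this assms(4), symmetric]
    show "d k * e k i * cnj (e k j) = (\<Sum>l\<in>I. \<rho> i l * (e k l * cnj (e k j)))"
      by (simp add: app_def sum_distrib_right mult.assoc)
  qed
  also have "\<dots> = (\<Sum>l\<in>I. \<rho> i l * (\<Sum>k\<in>I. e k l * cnj (e k j)))"
    unfolding sum_distrib_left by (rule sum.swap)
  also have "\<dots> = (\<Sum>l\<in>I. \<rho> i l * (if l = j then 1 else 0))"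
    using assms by (intro sum.cong refl) (auto simp: onb_def)
  also have "\<dots> = \<rho> i j" using assms by (simp add: if_distrib cong: if_cong)
  finally show ?thesis by simp
qed

text \<open>In an eigenbasis of \<open>\<rho>\<close> the matrix of a commuting
  \<open>\<sigma>\<close> does not mix different eigenvalues, so \<open>\<sigma>\<close> can be
  diagonalized inside each eigenspace, where \<open>\<rho>\<close> is scalar.\<close>

lemma common_eigenbasis:
  assumes I: "finite I" and h: "hermitian_on I \<rho>" "hermitian_on I \<sigma>"
    and comm: "\<And>v i. i \<in> I \<Longrightarrow> app I \<rho> (app I \<sigma> v) i = app I \<sigma> (app I \<rho> v) i"
  shows "\<exists>e a b. onb I e \<and> (\<forall>k\<in>I. \<forall>i\<in>I. app I \<rho> (e k) i = of_real (a k) * e k i)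
     \<and> (\<forall>k\<in>I. \<forall>i\<in>I. app I \<sigma> (e k) i = of_real (b k) * e k i)"
proof -
  obtain f a where f: "onb I f"
    and fa: "\<And>k i. k \<in> I \<Longrightarrow> i \<in> I \<Longrightarrow> app I \<rho> (f k) i = of_real (a k) * f k i"
    using spectral_theorem[OF I h(1)] by blast
  define N where "N j k = ip I (f j) (app I \<sigma> (f k))" for j k
  let ?I = "\<lambda>t. {k\<in>I. a k = t}"
  \<comment> \<open>Evaluating the matrix element of the product of both operators in two ways gives
    it the two factors \<open>a j\<close> and \<open>a k\<close>.\<close>
  have N0: "N j k = 0" if "j \<in> I" "k \<in> I" "a j \<noteq> a k" for j k
  proof -
    have "of_real (a j) * N j k = ip I (\<lambda>i. of_real (a j) * f j i) (app I \<sigma> (f k))"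
      by (simp add: N_def ip_scale_left)
    also have "\<dots> = ip I (app I \<rho> (f j)) (app I \<sigma> (f k))" using fa that by (intro ip_cong) auto
    also have "\<dots> = ip I (f j) (app I \<rho> (app I \<sigma> (f k)))" by (simp add: ip_app_hermitian[OF h(1)])
    also have "\<dots> = ip I (f j) (\<lambda>i. of_real (a k) * app I \<sigma> (f k) i)"
    proof (rule ip_cong[OF refl])
      fix i assume i: "i \<in> I"
      have "app I \<sigma> (app I \<rho> (f k)) i = app I \<sigma> (\<lambda>i. of_real (a k) * f k i) i"
        unfolding app_def[of I \<sigma>] using fa that by (intro sum.cong) auto
      then show "app I \<rho> (app I \<sigma> (f k)) i = of_real (a k) * app I \<sigma> (f k) i"
        using comm[OF i] by (simp add: app_scale)
    qed
    also have "\<dots> = of_real (a k) * N j k" by (simp add: N_def ip_scale_right)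
    finally show ?thesis using that(3) by simp
  qed
  \<comment> \<open>For \<open>t\<close> outside the spectrum the block is empty, which the spectral
    theorem admits.\<close>
  have "\<forall>t. \<exists>e d. onb (?I t) e \<and> (\<forall>k\<in>?I t. \<forall>i\<in>?I t. app (?I t) N (e k) i = of_real (d k) * e k i)"
    using I hermitian_compression[OF h(2)] unfolding N_def by (intro allI spectral_theorem) auto
  from choice[OF this] obtain e where
    "\<forall>t. \<exists>d. onb (?I t) (e t) \<and> (\<forall>k\<in>?I t. \<forall>i\<in>?I t. app (?I t) N (e t k) i = of_real (d k) * e t k i)"
    by blast
  from choice[OF this] obtain d where e: "\<And>t. onb (?I t) (e t)"
    and ed: "\<And>t k i. k \<in> ?I t \<Longrightarrow> i \<in> ?I t \<Longrightarrow> app (?I t) N (e t k) i = complex_of_real (d t k) * e t k i"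
    by blast
  define E where "E = (\<lambda>k j. if a j = a k then e (a k) k j else 0)"
  have E: "onb I E" unfolding E_def by (rule onb_blocks[OF I e])
  define g where "g = (\<lambda>k i. \<Sum>j\<in>I. E k j * f j i)"
  have g: "onb I g" unfolding g_def by (rule onb_compose[OF I E f])
  have r: "app I \<rho> (g k) i = of_real (a k) * g k i" if "k \<in> I" "i \<in> I" for k i
  proof -
    have "app I \<rho> (g k) i = (\<Sum>j\<in>I. E k j * app I \<rho> (f j) i)" unfolding g_def by (rule app_sum)
    also have "\<dots> = (\<Sum>j\<in>I. of_real (a k) * (E k j * f j i))"
      using fa that by (intro sum.cong refl) (auto simp: E_def)
    finally show ?thesis by (simp add: g_def sum_distrib_left)
  qed
  have s: "app I \<sigma> (g k) i = of_real (d (a k) k) * g k i" if "k \<in> I" "i \<in> I" for k i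
  proof -
    have j: "ip I (f j) (app I \<sigma> (g k)) = of_real (d (a k) k) * E k j" if "j \<in> I" for j
    proof -
      have "app I \<sigma> (g k) = (\<lambda>i. \<Sum>j\<in>I. E k j * app I \<sigma> (f j) i)"
        unfolding g_def by (rule ext, rule app_sum)
      then have "ip I (f j) (app I \<sigma> (g k)) = (\<Sum>l\<in>I. E k l * N j l)"
        by (simp add: N_def ip_sum_right ip_scale_right)
      also have "\<dots> = of_real (d (a k) k) * E k j"
      proof (cases "a j = a k")
        case True
        have "(\<Sum>l\<in>I. E k l * N j l) = app (?I (a k)) N (e (a k) k) j"
          unfolding app_def E_def using I by (intro sum.mono_neutral_cong_right) auto
        then show ?thesis using ed[of k "a k" j] True \<open>k \<in> I\<close> \<open>j \<in> I\<close> by (simp add: E_def)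
      next
        case False
        then have "(\<Sum>l\<in>I. E k l * N j l) = 0"
          using N0[OF \<open>j \<in> I\<close>] by (intro sum.neutral) (auto simp: E_def)
        then show ?thesis using False by (simp add: E_def)
      qed
      finally show ?thesis .
    qed
    have "app I \<sigma> (g k) i = (\<Sum>j\<in>I. ip I (f j) (app I \<sigma> (g k)) * f j i)"
      by (rule onb_expand[OF I f that(2)])
    then show ?thesis using j by (simp add: g_def sum_distrib_left mult.assoc)
  qed
  show ?thesis
    by (intro exI[of _ g] exI[of _ a] exI[of _ "\<lambda>k. d (a k) k"] conjI ballI g r s)
qed

text \<open>The difference of the two sides is the squared norm of \<open>v\<close> minus its
  projection \<open>p\<close> onto the span of the family.\<close>

lemma bessel_inequality:
  assumes K: "finite K" and e: "orthonormal I K e"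
  shows "(\<Sum>k\<in>K. (cmod (ip I (e k) v))\<^sup>2) \<le> (\<Sum>i\<in>I. (cmod (v i))\<^sup>2)"
proof -
  define p where "p i = (\<Sum>k\<in>K. ip I (e k) v * e k i)" for i
  have ep: "ip I (e k) p = ip I (e k) v" if "k \<in> K" for k
  proof -
    have "ip I (e k) p = (\<Sum>l\<in>K. ip I (e l) v * (if k = l then 1 else 0))"
      unfolding p_def ip_sum_right ip_scale_right using e that by (auto simp: orthonormal_def intro!: sum.cong)
    then show ?thesis using K that by (simp add: if_distrib cong: if_cong)
  qed
  have pw: "ip I p w = (\<Sum>k\<in>K. cnj (ip I (e k) v) * ip I (e k) w)" for w
    unfolding p_def ip_sum_left ip_scale_left ..
  have q: "ip I p v = of_real (\<Sum>k\<in>K. (cmod (ip I (e k) v))\<^sup>2)"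
    unfolding pw by (simp add: complex_norm_square mult.commute del: of_real_power)
  have pp: "ip I p p = ip I p v" unfolding pw using ep by simp
  have vp: "ip I v p = ip I p v" using q by (metis cnj_ip complex_cnj_complex_of_real)
  have "ip I (\<lambda>i. v i - p i) (\<lambda>i. v i - p i) = ip I v v - ip I p v"
    using pp vp by (simp add: ip_def algebra_simps sum_subtractf sum.distrib)
  then have "complex_of_real (\<Sum>i\<in>I. (cmod (v i - p i))\<^sup>2) =
      of_real ((\<Sum>i\<in>I. (cmod (v i))\<^sup>2) - (\<Sum>k\<in>K. (cmod (ip I (e k) v))\<^sup>2))"
    unfolding ip_self q by simp
  then have "(\<Sum>i\<in>I. (cmod (v i - p i))\<^sup>2) =
      (\<Sum>i\<in>I. (cmod (v i))\<^sup>2) - (\<Sum>k\<in>K. (cmod (ip I (e k) v))\<^sup>2)"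
    by (simp only: of_real_eq_iff)
  moreover have "(\<Sum>i\<in>I. (cmod (v i - p i))\<^sup>2) \<ge> 0" by (simp add: sum_nonneg)
  ultimately show ?thesis by simp
qed

section \<open>Von Neumann entropy\<close>

definition eta :: "real \<Rightarrow> real" where
  "eta t = - (t * log 2 t)"

lemma eta_0 [simp]: "eta 0 = 0" by (simp add: eta_def)

section \<open>Entropy computed from a diagonal form\<close>

text \<open>The order of the product at \<open>e\<close> counts the occurrences of \<open>e\<close>
  in the list. This turns the sum over distinct eigenvalues with multiplicities into a sum over a
  list of eigenvalues.\<close>

lemma sum_order_linear_factors:
  fixes f :: "complex \<Rightarrow> real"
  assumes "finite S" "set as \<subseteq> S"
  shows "(\<Sum>e\<in>S. real (Polynomial.order e (\<Prod>a\<leftarrow>as. [:- a, 1:])) * f e) = (\<Sum>a\<leftarrow>as. f a)"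
  using assms(2)
proof (induction as)
  case Nil
  then show ?case by simp
next
  case (Cons a as)
  have nz: "(\<Prod>a\<leftarrow>as. [:- a, 1:]) \<noteq> (0 :: complex poly)" by (auto simp: prod_list_zero_iff)
  have o: "Polynomial.order e [:- a, 1:] = (if e = a then 1 else 0)" for e
    using order_power_n_n[of a 1] by (auto simp: order_0I)
  have om: "Polynomial.order e (\<Prod>a\<leftarrow>a # as. [:- a, 1:])
      = (if e = a then 1 else 0) + Polynomial.order e (\<Prod>a\<leftarrow>as. [:- a, 1:])" for e
    unfolding list.map prod_list.Cons by (subst order_mult) (use nz o in \<open>auto simp del: mult_pCons_left\<close>)
  have "(\<Sum>e\<in>S. real (Polynomial.order e (\<Prod>a\<leftarrow>a # as. [:- a, 1:])) * f e)
      = (\<Sum>e\<in>S. (if e = a then f e else 0)) + (\<Sum>e\<in>S. real (Polynomial.order e (\<Prod>a\<leftarrow>as. [:- a, 1:])) * f e)"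
    unfolding sum.distrib[symmetric] om by (intro sum.cong refl) (auto simp: distrib_right)
  then show ?case using Cons assms(1) by simp
qed

text \<open>The basis gives mutually inverse matrices \<open>U\<close> and \<open>V\<close> that
  make the library matrix similar to a diagonal one, whose characteristic polynomial splits
  explicitly.\<close>

lemma vn_entropy_eigenbasis:
  assumes I: "finite I" and e: "onb I e"
    and \<rho>: "\<And>i j. i \<in> I \<Longrightarrow> j \<in> I \<Longrightarrow> \<rho> i j = (\<Sum>k\<in>I. of_real (d k) * e k i * cnj (e k j))"
  shows "vn_entropy I \<rho> = (\<Sum>k\<in>I. eta (d k))"
proof -
  define n where "n = card I"
  define g where "g = from_nat_into I"
  have g: "bij_betw g {..<n} I"
    unfolding g_def n_def by (rule bij_betw_from_nat_into_finite[OF I])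
  have gI: "g i \<in> I" if "i < n" for i using g that by (auto simp: bij_betw_def)
  have ginj: "g i = g j \<longleftrightarrow> i = j" if "i < n" "j < n" for i j
    using g that by (auto simp: bij_betw_def inj_on_def)
  have sumI: "(\<Sum>k\<in>I. f k) = (\<Sum>k<n. f (g k))" for f :: "_ \<Rightarrow> 'z::comm_monoid_add"
    by (rule sum.reindex_bij_betw[OF g, symmetric])
  define U where "U = mat n n (\<lambda>(i, k). e (g k) (g i))"
  define V where "V = mat n n (\<lambda>(k, i). cnj (e (g k) (g i)))"
  define D where "D = mat n n (\<lambda>(i, j). if i = j then complex_of_real (d (g i)) else 0)"
  let ?A = "matrix_on I \<rho>"
  have A: "?A \<in> carrier_mat n n" by (simp add: matrix_on_def n_def)
  have UV: "U * V = 1\<^sub>m n"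
  proof (rule eq_matI)
    fix i j assume ij: "i < dim_row (1\<^sub>m n)" "j < dim_col (1\<^sub>m n)"
    have "(U * V) $$ (i, j) = (\<Sum>k\<in>I. e k (g i) * cnj (e k (g j)))"
      using ij by (simp add: U_def V_def scalar_prod_def sumI atLeast0LessThan)
    then show "(U * V) $$ (i, j) = 1\<^sub>m n $$ (i, j)"
      using ij e gI ginj by (simp add: onb_def)
  qed (auto simp: U_def V_def)
  have VU: "V * U = 1\<^sub>m n"
  proof (rule eq_matI)
    fix i j assume ij: "i < dim_row (1\<^sub>m n)" "j < dim_col (1\<^sub>m n)"
    have "(V * U) $$ (i, j) = ip I (e (g i)) (e (g j))"
      using ij by (simp add: U_def V_def scalar_prod_def sumI atLeast0LessThan ip_def)
    then show "(V * U) $$ (i, j) = 1\<^sub>m n $$ (i, j)"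
      using ij e gI ginj by (simp add: onb_def orthonormal_def)
  qed (auto simp: U_def V_def)
  have "U * D = mat n n (\<lambda>(i, k). complex_of_real (d (g k)) * e (g k) (g i))"
    by (rule eq_matI) (auto simp: U_def D_def scalar_prod_def if_distrib cong: if_cong)
  then have "U * D * V = ?A"
    by (intro eq_matI)
      (auto simp: V_def scalar_prod_def matrix_on_def \<rho> gI sumI atLeast0LessThan n_def[symmetric] g_def[symmetric])
  then have "similar_mat ?A D"
    using UV VU A unfolding similar_mat_def similar_mat_wit_def Let_def
    by (intro exI[of _ U] exI[of _ V]) (auto simp: U_def V_def D_def)
  then have "char_poly ?A = char_poly D" by (rule char_poly_similar)
  also have "\<dots> = (\<Prod>a\<leftarrow>diag_mat D. [:- a, 1:])"
    by (rule char_poly_upper_triangular[of _ n]) (auto simp: D_def)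
  also have "diag_mat D = map (\<lambda>k. complex_of_real (d (g k))) [0..<n]"
    by (auto simp: diag_mat_def D_def)
  finally have cp: "char_poly ?A = (\<Prod>a\<leftarrow>map (\<lambda>k. complex_of_real (d (g k))) [0..<n]. [:- a, 1:])" .
  let ?as = "map (\<lambda>k. complex_of_real (d (g k))) [0..<n]"
  have "spectrum ?A = {e. poly (char_poly ?A) e = 0}" using spectrum_root_char_poly[OF A] by simp
  also have "\<dots> = set ?as" unfolding cp by (auto simp: poly_prod_list prod_list_zero_iff)
  finally have sp: "spectrum ?A = set ?as" .
  have "vn_entropy I \<rho> = - (\<Sum>a\<leftarrow>?as. Re a * log 2 (Re a))"
    unfolding vn_entropy_def cp sp by (subst sum_order_linear_factors) auto
  also have "\<dots> = (\<Sum>k<n. eta (d (g k)))"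
    by (simp add: eta_def sum_negf o_def interv_sum_list_conv_sum_set_nat atLeast0LessThan)
  finally show ?thesis by (simp add: sumI)
qed

lemma cmod_sq: "complex_of_real ((cmod z)\<^sup>2) = cnj z * z"
  by (simp add: complex_norm_square mult.commute del: of_real_power)

text \<open>The family may have its own index set and need not span. Instead of completing it, the
  proof compares it with an eigenbasis \<open>f\<close>: the squared overlap \<open>w i k\<close>
  vanishes unless \<open>b i = d k\<close>, so either entropy can be written as the same double
  sum.\<close>

lemma vn_entropy_orthonormal:
  assumes I: "finite I" and K: "finite K" and e: "orthonormal I K e"
    and \<rho>: "\<And>i j. i \<in> I \<Longrightarrow> j \<in> I \<Longrightarrow> \<rho> i j = (\<Sum>k\<in>K. of_real (d k) * e k i * cnj (e k j))"
  shows "vn_entropy I \<rho> = (\<Sum>k\<in>K. eta (d k))"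
proof -
  have h: "hermitian_on I \<rho>"
    by (auto simp: hermitian_on_def \<rho> intro!: sum.cong)
  obtain f b where f: "onb I f"
    and fb: "\<And>k i. k \<in> I \<Longrightarrow> i \<in> I \<Longrightarrow> app I \<rho> (f k) i = of_real (b k) * f k i"
    using spectral_theorem[OF I h] by blast
  have vf: "vn_entropy I \<rho> = (\<Sum>k\<in>I. eta (b k))"
    using eigenbasis_decomposition[OF I f fb] by (intro vn_entropy_eigenbasis[OF I f]) auto
  have ar: "app I \<rho> v i = (\<Sum>k\<in>K. of_real (d k) * ip I (e k) v * e k i)" if "i \<in> I" for v i
  proof -
    have "app I \<rho> v i = (\<Sum>j\<in>I. \<Sum>k\<in>K. of_real (d k) * (cnj (e k j) * v j) * e k i)"
      using that by (simp add: app_def \<rho> sum_distrib_right sum_distrib_left mult_ac)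
    also have "\<dots> = (\<Sum>k\<in>K. \<Sum>j\<in>I. of_real (d k) * (cnj (e k j) * v j) * e k i)" by (rule sum.swap)
    finally show ?thesis by (simp add: ip_def sum_distrib_left sum_distrib_right)
  qed
  define w where "w i k = (cmod (ip I (f i) (e k)))\<^sup>2" for i k
  have ek: "app I \<rho> (e k) i = of_real (d k) * e k i" if "k \<in> K" "i \<in> I" for k i
  proof -
    have "app I \<rho> (e k) i = (\<Sum>l\<in>K. if l = k then of_real (d k) * e k i else 0)"
      unfolding ar[OF that(2)] using e that(1) by (intro sum.cong) (auto simp: orthonormal_def)
    then show ?thesis using K that by simp
  qed
  have eqv: "b i = d k" if "w i k \<noteq> 0" "i \<in> I" "k \<in> K" for i k
  proof -
    have "of_real (d k) * ip I (f i) (e k) = ip I (f i) (app I \<rho> (e k))"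
      using ek that by (subst ip_scale_right[symmetric], intro ip_cong) auto
    also have "\<dots> = ip I (app I \<rho> (f i)) (e k)" by (rule ip_app_hermitian[OF h])
    also have "\<dots> = of_real (b i) * ip I (f i) (e k)"
      using fb that by (subst complex_cnj_complex_of_real[symmetric], subst ip_scale_left[symmetric], intro ip_cong) auto
    finally show ?thesis using that(1) by (auto simp: w_def)
  qed
  have col: "(\<Sum>i\<in>I. w i k) = 1" if "k \<in> K" for k
  proof -
    have "complex_of_real (\<Sum>i\<in>I. w i k) = (\<Sum>i\<in>I. ip I (e k) (f i) * ip I (f i) (e k))"
      unfolding w_def of_real_sum cmod_sq cnj_ip ..
    also have "\<dots> = ip I (e k) (e k)" by (rule onb_parseval[OF I f, symmetric])
    also have "\<dots> = 1" using e that by (simp add: orthonormal_def)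
    finally show ?thesis by (metis of_real_eq_1_iff)
  qed
  \<comment> \<open>The factor \<open>b i\<close> is essential: a row of \<open>w\<close> sums to
    less than 1 when \<open>f i\<close> is not in the span of the family, and then the eigenvalue is
    0.\<close>
  have row: "(\<Sum>k\<in>K. w i k * b i) = b i" if "i \<in> I" for i
  proof -
    have "complex_of_real (\<Sum>k\<in>K. w i k * d k) = (\<Sum>k\<in>K. of_real (d k) * ip I (e k) (f i) * ip I (f i) (e k))"
      unfolding w_def of_real_sum of_real_mult cmod_sq cnj_ip by (simp add: mult_ac)
    also have "\<dots> = ip I (f i) (\<lambda>j. \<Sum>k\<in>K. of_real (d k) * ip I (e k) (f i) * e k j)"
      unfolding ip_sum_right ip_scale_right ..
    also have "\<dots> = ip I (f i) (app I \<rho> (f i))" using ar by (intro ip_cong) auto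
    also have "\<dots> = of_real (b i) * ip I (f i) (f i)"
      using fb that by (subst ip_scale_right[symmetric], intro ip_cong) auto
    also have "\<dots> = of_real (b i)" using f that by (simp add: onb_def orthonormal_def)
    finally have "(\<Sum>k\<in>K. w i k * d k) = b i" by (simp only: of_real_eq_iff)
    moreover have "(\<Sum>k\<in>K. w i k * d k) = (\<Sum>k\<in>K. w i k * b i)"
    proof (intro sum.cong refl)
      fix k assume "k \<in> K"
      then show "w i k * d k = w i k * b i" using eqv[OF _ that, of k] by (cases "w i k = 0") auto
    qed
    ultimately show ?thesis by simp
  qed
  have "(\<Sum>i\<in>I. eta (b i)) = (\<Sum>i\<in>I. \<Sum>k\<in>K. w i k * eta (b i))"
  proof (rule sum.cong[OF refl])
    fix i assume i: "i \<in> I"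
    have "(\<Sum>k\<in>K. w i k * eta (b i)) = (\<Sum>k\<in>K. w i k * b i) * (- log 2 (b i))"
      by (simp add: eta_def sum_distrib_left sum_negf mult_ac)
    also have "\<dots> = eta (b i)" unfolding row[OF i] by (simp add: eta_def)
    finally show "eta (b i) = (\<Sum>k\<in>K. w i k * eta (b i))" by simp
  qed
  also have "\<dots> = (\<Sum>i\<in>I. \<Sum>k\<in>K. w i k * eta (d k))"
  proof (intro sum.cong refl)
    fix i k assume "i \<in> I" "k \<in> K"
    then show "w i k * eta (b i) = w i k * eta (d k)" using eqv[of i k] by (cases "w i k = 0") auto
  qed
  also have "\<dots> = (\<Sum>k\<in>K. \<Sum>i\<in>I. w i k * eta (d k))" by (rule sum.swap)
  also have "\<dots> = (\<Sum>k\<in>K. eta (d k))" using col by (simp add: sum_distrib_right[symmetric])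
  finally show ?thesis using vf by simp
qed

section \<open>Gram operators as unnormalized mixed states\<close>

text \<open>The sum of the rank-one operators of the vectors \<open>g s\<close>, so an unnormalized
  density operator; the matrix of inner products of the vectors is a different object.\<close>

definition gram :: "'s set \<Rightarrow> ('s \<Rightarrow> 'i \<Rightarrow> complex) \<Rightarrow> 'i opr" where
  "gram S g i j = (\<Sum>s\<in>S. g s i * cnj (g s j))"

lemma hermitian_gram: "hermitian_on I (gram S g)"
  by (auto simp: hermitian_on_def gram_def intro!: sum.cong)

lemma app_gram: "app I (gram S g) v i = (\<Sum>s\<in>S. ip I (g s) v * g s i)"
proof -
  have "app I (gram S g) v i = (\<Sum>j\<in>I. \<Sum>s\<in>S. (cnj (g s j) * v j) * g s i)"
    by (simp add: app_def gram_def sum_distrib_right sum_distrib_left mult_ac)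
  also have "\<dots> = (\<Sum>s\<in>S. \<Sum>j\<in>I. (cnj (g s j) * v j) * g s i)" by (rule sum.swap)
  finally show ?thesis by (simp add: ip_def sum_distrib_right)
qed

lemma ip_app_gram: "ip I v (app I (gram S g) v) = of_real (\<Sum>s\<in>S. (cmod (ip I (g s) v))\<^sup>2)"
proof -
  have "ip I v (app I (gram S g) v) = ip I v (\<lambda>i. \<Sum>s\<in>S. ip I (g s) v * g s i)"
    by (intro ip_cong) (auto simp: app_gram)
  also have "\<dots> = (\<Sum>s\<in>S. cnj (ip I (g s) v) * ip I (g s) v)"
    unfolding ip_sum_right ip_scale_right cnj_ip by (simp add: mult.commute)
  finally show ?thesis unfolding of_real_sum cmod_sq .
qed

text \<open>Each eigenvalue is the expectation of the operator in its eigenvector. Being a sum over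
  \<open>S\<close> of squares, it is nonnegative and can be split along a partition of
  \<open>S\<close>.\<close>

lemma gram_eigenbasis:
  assumes I: "finite I"
  shows "\<exists>e d. onb I e \<and> (\<forall>k\<in>I. 0 \<le> d k \<and> (\<Sum>s\<in>S. (cmod (ip I (g s) (e k)))\<^sup>2) = d k)
    \<and> (\<forall>k\<in>I. \<forall>i\<in>I. app I (gram S g) (e k) i = of_real (d k) * e k i)
    \<and> (\<forall>i\<in>I. \<forall>j\<in>I. gram S g i j = (\<Sum>k\<in>I. of_real (d k) * e k i * cnj (e k j)))
    \<and> vn_entropy I (gram S g) = (\<Sum>k\<in>I. eta (d k))"
proof -
  obtain e d where e: "onb I e"
    and ed: "\<And>k i. k \<in> I \<Longrightarrow> i \<in> I \<Longrightarrow> app I (gram S g) (e k) i = of_real (d k) * e k i"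
    using spectral_theorem[OF I hermitian_gram] by blast
  have d: "(\<Sum>s\<in>S. (cmod (ip I (g s) (e k)))\<^sup>2) = d k" if "k \<in> I" for k
  proof -
    have "complex_of_real (\<Sum>s\<in>S. (cmod (ip I (g s) (e k)))\<^sup>2) = ip I (e k) (app I (gram S g) (e k))"
      by (rule ip_app_gram[symmetric])
    also have "\<dots> = of_real (d k) * ip I (e k) (e k)"
      using ed that by (subst ip_scale_right[symmetric], intro ip_cong) auto
    also have "\<dots> = of_real (d k)" using e that by (simp add: onb_def orthonormal_def)
    finally show ?thesis by (simp only: of_real_eq_iff)
  qed
  have "0 \<le> d k" if "k \<in> I" for k unfolding d[OF that, symmetric] by (simp add: sum_nonneg)
  moreover note dec = eigenbasis_decomposition[OF I e ed]
  moreover have "vn_entropy I (gram S g) = (\<Sum>k\<in>I. eta (d k))"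
    using dec by (intro vn_entropy_eigenbasis[OF I e]) auto
  ultimately show ?thesis
    by (intro exI[of _ e] exI[of _ d] conjI ballI e d ed) simp_all
qed

section \<open>Klein's inequality and its equality case\<close>

text \<open>This is \<open>ln r \<le> r - 1\<close> at \<open>r = s / t\<close>, with equality only
  at 1. The last hypothesis keeps the default value of the logarithm at 0 from mattering.\<close>

lemma log_inequality:
  fixes s t :: real
  assumes "0 \<le> t" "0 \<le> s" "s = 0 \<Longrightarrow> t = 0"
  shows "t * log 2 t - t * log 2 s \<ge> (t - s) / ln 2"
    and "t * log 2 t - t * log 2 s = (t - s) / ln 2 \<Longrightarrow> t = s"
proof -
  have *: "t * log 2 t - t * log 2 s - (t - s) / ln 2 = (s - t - t * ln (s / t)) / ln 2" if "t > 0" "s > 0"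
    using that by (simp add: log_def ln_div field_simps)
  have key: "t * ln (s / t) \<le> s - t" if "t > 0" "s > 0"
  proof -
    have "t * ln (s / t) \<le> t * (s / t - 1)" using that by (intro mult_left_mono ln_le_minus_one) auto
    then show ?thesis using that by (simp add: algebra_simps)
  qed
  show "t * log 2 t - t * log 2 s \<ge> (t - s) / ln 2"
  proof (cases "t = 0")
    case True
    then show ?thesis using assms by (simp add: divide_nonpos_pos)
  next
    case False
    then have ts: "t > 0" "s > 0" using assms by (auto simp: less_le)
    have "0 \<le> (s - t - t * ln (s / t)) / ln 2" using key[OF ts] by simp
    then show ?thesis using *[OF ts] by simp
  qed
  assume eq: "t * log 2 t - t * log 2 s = (t - s) / ln 2"
  show "t = s"
  proof (cases "t = 0")
    case True
    then show ?thesis using eq by simp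
  next
    case False
    then have ts: "t > 0" "s > 0" using assms by (auto simp: less_le)
    have "t * ln (s / t) = s - t" using *[OF ts] eq by simp
    then have "ln (s / t) = s / t - 1" using ts by (simp add: field_simps)
    then have "s / t = 1" using ts by (intro ln_eq_minus_one) auto
    then show ?thesis using ts by simp
  qed
qed

lemma onb_parseval_norm:
  assumes "finite I" "onb I e"
  shows "(\<Sum>k\<in>I. (cmod (ip I v (e k)))\<^sup>2) = (\<Sum>i\<in>I. (cmod (v i))\<^sup>2)"
    and "(\<Sum>k\<in>I. (cmod (ip I (e k) v))\<^sup>2) = (\<Sum>i\<in>I. (cmod (v i))\<^sup>2)"
proof -
  have "complex_of_real (\<Sum>i\<in>I. (cmod (v i))\<^sup>2) = (\<Sum>k\<in>I. ip I v (e k) * ip I (e k) v)"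
    using onb_parseval[OF assms, of v v] by (simp only: ip_self)
  also have "\<dots> = complex_of_real (\<Sum>k\<in>I. (cmod (ip I (e k) v))\<^sup>2)"
    unfolding of_real_sum cmod_sq cnj_ip ..
  finally show 1: "(\<Sum>k\<in>I. (cmod (ip I (e k) v))\<^sup>2) = (\<Sum>i\<in>I. (cmod (v i))\<^sup>2)"
    by (simp only: of_real_eq_iff)
  have "cmod (ip I v (e k)) = cmod (ip I (e k) v)" for k
    by (metis cnj_ip complex_mod_cnj)
  then show "(\<Sum>k\<in>I. (cmod (ip I v (e k)))\<^sup>2) = (\<Sum>i\<in>I. (cmod (v i))\<^sup>2)"
    using 1 by simp
qed

text \<open>Nonnegativity of the relative entropy of the two Gram operators divided by their traces
  \<open>TA\<close> and \<open>TR\<close>, multiplied by \<open>TA\<close> so that nothing has to be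
  normalized. Both sides are \<open>TA\<close> times an entropy and a cross entropy of the
  normalized states; equality forces these states to coincide.\<close>

lemma klein_gram:
  fixes g :: "'s \<Rightarrow> 'i \<Rightarrow> complex"
  assumes I: "finite I" and S: "finite S'" "S \<subseteq> S'" and f: "onb I f"
    and fb: "\<And>j i. j \<in> I \<Longrightarrow> i \<in> I \<Longrightarrow> app I (gram S' g) (f j) i = of_real (b j) * f j i"
    and b: "\<And>j. j \<in> I \<Longrightarrow> b j = (\<Sum>s\<in>S'. (cmod (ip I (g s) (f j)))\<^sup>2)"
  defines "TA \<equiv> \<Sum>s\<in>S. \<Sum>i\<in>I. (cmod (g s i))\<^sup>2" and "TR \<equiv> \<Sum>s\<in>S'. \<Sum>i\<in>I. (cmod (g s i))\<^sup>2"
  defines "bx \<equiv> \<lambda>j. \<Sum>s\<in>S. (cmod (ip I (g s) (f j)))\<^sup>2"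
  shows "vn_entropy I (gram S g) - eta TA \<le> - (\<Sum>j\<in>I. bx j * log 2 (b j / TR))"
    and "vn_entropy I (gram S g) - eta TA = - (\<Sum>j\<in>I. bx j * log 2 (b j / TR)) \<Longrightarrow>
      i \<in> I \<Longrightarrow> j \<in> I \<Longrightarrow> of_real TR * gram S g i j = of_real TA * gram S' g i j"
proof -
  obtain e a where e: "onb I e"
    and a: "\<And>k. k \<in> I \<Longrightarrow> 0 \<le> a k" "\<And>k. k \<in> I \<Longrightarrow> (\<Sum>s\<in>S. (cmod (ip I (g s) (e k)))\<^sup>2) = a k"
    and ea: "\<And>k i. k \<in> I \<Longrightarrow> i \<in> I \<Longrightarrow> app I (gram S g) (e k) i = of_real (a k) * e k i"
    and vn: "vn_entropy I (gram S g) = (\<Sum>k\<in>I. eta (a k))"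
    using gram_eigenbasis[OF I, where S=S and g=g] by blast
  have finS: "finite S" using S finite_subset by blast
  have sa: "(\<Sum>k\<in>I. a k) = TA"
  proof -
    have "(\<Sum>k\<in>I. a k) = (\<Sum>k\<in>I. \<Sum>s\<in>S. (cmod (ip I (g s) (e k)))\<^sup>2)" using a by simp
    also have "\<dots> = (\<Sum>s\<in>S. \<Sum>k\<in>I. (cmod (ip I (g s) (e k)))\<^sup>2)" by (rule sum.swap)
    finally show ?thesis by (simp add: onb_parseval_norm[OF I e] TA_def)
  qed
  have sb: "(\<Sum>j\<in>I. b j) = TR"
  proof -
    have "(\<Sum>j\<in>I. b j) = (\<Sum>j\<in>I. \<Sum>s\<in>S'. (cmod (ip I (g s) (f j)))\<^sup>2)" using b by simp
    also have "\<dots> = (\<Sum>s\<in>S'. \<Sum>j\<in>I. (cmod (ip I (g s) (f j)))\<^sup>2)" by (rule sum.swap)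
    finally show ?thesis by (simp add: onb_parseval_norm[OF I f] TR_def)
  qed
  have TAR: "0 \<le> TA" "TA \<le> TR"
    unfolding TA_def TR_def using S by (auto intro!: sum_nonneg sum_mono2)
  \<comment> \<open>The squared overlaps of the two eigenbases form a doubly stochastic matrix,
    which reduces the operator inequality to the scalar one.\<close>
  define w where "w i j = (cmod (ip I (e i) (f j)))\<^sup>2" for i j
  have w0: "0 \<le> w i j" for i j by (simp add: w_def)
  have unit: "(\<Sum>i\<in>I. (cmod (v k i))\<^sup>2) = 1" if "onb I v" "k \<in> I" for v k
  proof -
    have "complex_of_real (\<Sum>i\<in>I. (cmod (v k i))\<^sup>2) = 1"
      using that unfolding ip_self[symmetric] by (simp add: onb_def orthonormal_def)
    then show ?thesis by (simp only: of_real_eq_1_iff)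
  qed
  have wrow: "(\<Sum>j\<in>I. w i j) = 1" if "i \<in> I" for i
    unfolding w_def by (simp add: onb_parseval_norm(1)[OF I f] unit[OF e that])
  have wcol: "(\<Sum>i\<in>I. w i j) = 1" if "j \<in> I" for j
    unfolding w_def by (simp add: onb_parseval_norm(2)[OF I e] unit[OF f that])
  have eA: "ip I (e i) (app I (gram S g) (f j)) = of_real (a i) * ip I (e i) (f j)" if "i \<in> I" for i j
  proof -
    have "ip I (e i) (app I (gram S g) (f j)) = ip I (app I (gram S g) (e i)) (f j)"
      by (rule ip_app_hermitian[OF hermitian_gram])
    also have "\<dots> = ip I (\<lambda>l. of_real (a i) * e i l) (f j)" using ea that by (intro ip_cong) auto
    finally show ?thesis by (simp add: ip_scale_left)
  qed
  have bxw: "bx j = (\<Sum>i\<in>I. w i j * a i)" for j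
  proof -
    have "complex_of_real (bx j) = ip I (f j) (app I (gram S g) (f j))"
      unfolding bx_def by (rule ip_app_gram[symmetric])
    also have "\<dots> = (\<Sum>i\<in>I. ip I (f j) (e i) * ip I (e i) (app I (gram S g) (f j)))"
      by (rule onb_parseval[OF I e])
    also have "\<dots> = (\<Sum>i\<in>I. ip I (f j) (e i) * (of_real (a i) * ip I (e i) (f j)))"
      by (intro sum.cong refl) (simp add: eA)
    also have "\<dots> = complex_of_real (\<Sum>i\<in>I. w i j * a i)"
      unfolding w_def of_real_sum of_real_mult cmod_sq cnj_ip by (simp add: mult_ac)
    finally show ?thesis by (simp only: of_real_eq_iff)
  qed
  have bxb: "bx j \<le> b j" if "j \<in> I" for j
    unfolding bx_def b[OF that] using S by (intro sum_mono2) auto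
  have "vn_entropy I (gram S g) - eta TA \<le> - (\<Sum>j\<in>I. bx j * log 2 (b j / TR)) \<and>
    (vn_entropy I (gram S g) - eta TA = - (\<Sum>j\<in>I. bx j * log 2 (b j / TR)) \<longrightarrow>
      (\<forall>i\<in>I. \<forall>j\<in>I. of_real TR * gram S g i j = of_real TA * gram S' g i j))"
  \<comment> \<open>With trace 0 there is no state to normalize, but then every vector
    \<open>g s\<close> with \<open>s\<close> in \<open>S\<close> vanishes on
    \<open>I\<close>.\<close>
  proof (cases "TA = 0")
    case True
    have a0: "a k = 0" if "k \<in> I" for k
      using sa True sum_nonneg_eq_0_iff[of I a] a(1) I that by auto
    have "bx j = 0" for j unfolding bxw by (simp add: a0)
    moreover have "gram S g i j = 0" if "i \<in> I" for i j
    proof -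
      have "(\<Sum>i\<in>I. (cmod (g s i))\<^sup>2) = 0" if "s \<in> S" for s
        using True that finS unfolding TA_def by (subst (asm) sum_nonneg_eq_0_iff) (auto simp: sum_nonneg)
      then have "g s i = 0" if "s \<in> S" for s
        using that \<open>i \<in> I\<close> I by (subst (asm) sum_nonneg_eq_0_iff) auto
      then show ?thesis by (simp add: gram_def)
    qed
    ultimately show ?thesis using vn a0 True by simp
  next
    case False
    then have TA: "TA > 0" and TR: "TR > 0" using TAR by auto
    define t where "t i = a i / TA" for i
    define s where "s j = b j / TR" for j
    \<comment> \<open>The defect of the scalar inequality at \<open>t i\<close> and
      \<open>s j\<close>, weighted by \<open>w i j\<close>. The linear parts cancel because both
      spectra sum to 1, so the total defect is the relative entropy.\<close>
    define D where "D i j = w i j * (t i * log 2 (t i) - t i * log 2 (s j)) - w i j * ((t i - s j) / ln 2)" for i j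
    have b0: "0 \<le> b j" if "j \<in> I" for j using b[OF that] by (simp add: sum_nonneg)
    \<comment> \<open>The support condition: \<open>S \<subseteq> S'\<close> bounds
      \<open>bx j\<close> by \<open>b j\<close>, so an eigenvalue \<open>b j = 0\<close> leaves no
      weight for any \<open>a i\<close> linked to it.\<close>
    have st: "t i = 0" if "s j = 0" "w i j \<noteq> 0" "i \<in> I" "j \<in> I" for i j
    proof -
      have "bx j \<le> 0" using bxb[OF that(4)] that(1) TR by (simp add: s_def)
      moreover have "w i j * a i \<le> bx j"
        unfolding bxw using I a(1) that by (intro member_le_sum) (auto simp: w0)
      ultimately have "w i j * a i \<le> 0" by simp
      then have "a i \<le> 0" using w0[of i j] that(2) by (auto simp: mult_le_0_iff)
      then show ?thesis using a(1)[OF that(3)] by (simp add: t_def)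
    qed
    have Dfac: "D i j = w i j * ((t i * log 2 (t i) - t i * log 2 (s j)) - (t i - s j) / ln 2)" for i j
      by (simp add: D_def algebra_simps)
    have t0: "0 \<le> t i" if "i \<in> I" for i using a(1)[OF that] TA by (simp add: t_def)
    have s0: "0 \<le> s j" if "j \<in> I" for j using b0[OF that] TR by (simp add: s_def)
    have D0: "0 \<le> D i j" if "i \<in> I" "j \<in> I" for i j
    proof (cases "w i j = 0")
      case False
      then show ?thesis
        unfolding Dfac using log_inequality(1)[OF t0[OF that(1)] s0[OF that(2)]] st[OF _ False that] w0
        by (intro mult_nonneg_nonneg) auto
    qed (simp add: Dfac)
    have Deq: "t i = s j" if "D i j = 0" "w i j \<noteq> 0" "i \<in> I" "j \<in> I" for i j
      using that log_inequality(2)[OF t0[OF that(3)] s0[OF that(4)]] st[OF _ that(2-4)] by (simp add: Dfac)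
    have s1: "(\<Sum>i\<in>I. \<Sum>j\<in>I. w i j * (t i * log 2 (t i))) = (\<Sum>i\<in>I. t i * log 2 (t i))"
      by (simp add: sum_distrib_right[symmetric] wrow)
    have s2: "(\<Sum>i\<in>I. \<Sum>j\<in>I. w i j * (t i * log 2 (s j))) = (\<Sum>j\<in>I. bx j / TA * log 2 (s j))"
      by (subst sum.swap) (simp add: bxw t_def sum_distrib_right sum_distrib_left sum_divide_distrib mult_ac)
    have s3: "(\<Sum>i\<in>I. \<Sum>j\<in>I. w i j * ((t i - s j) / ln 2)) = 0"
    proof -
      have "(\<Sum>i\<in>I. \<Sum>j\<in>I. w i j * t i) = 1"
        using TA by (simp add: sum_distrib_right[symmetric] wrow t_def sum_divide_distrib[symmetric] sa)
      moreover have "(\<Sum>i\<in>I. \<Sum>j\<in>I. w i j * s j) = 1"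
        using TR by (subst sum.swap) (simp add: sum_distrib_right[symmetric] wcol s_def sum_divide_distrib[symmetric] sb)
      moreover have "(\<Sum>i\<in>I. \<Sum>j\<in>I. w i j * ((t i - s j) / ln 2)) =
        ((\<Sum>i\<in>I. \<Sum>j\<in>I. w i j * t i) - (\<Sum>i\<in>I. \<Sum>j\<in>I. w i j * s j)) / ln 2"
        by (simp add: sum_subtractf[symmetric] sum_divide_distrib algebra_simps diff_divide_distrib)
      ultimately show ?thesis by simp
    qed
    have DD: "(\<Sum>i\<in>I. \<Sum>j\<in>I. D i j) = (\<Sum>i\<in>I. t i * log 2 (t i)) - (\<Sum>j\<in>I. bx j / TA * log 2 (s j))"
      unfolding D_def right_diff_distrib sum_subtractf s1 s2 using s3
      by (simp add: right_diff_distrib sum_subtractf)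
    have ent: "TA * (\<Sum>i\<in>I. t i * log 2 (t i)) = - (vn_entropy I (gram S g) - eta TA)"
    proof -
      have "TA * (\<Sum>i\<in>I. t i * log 2 (t i)) = (\<Sum>i\<in>I. a i * log 2 (a i) - a i * log 2 TA)"
        unfolding sum_distrib_left
      proof (rule sum.cong[OF refl])
        fix i assume "i \<in> I"
        show "TA * (t i * log 2 (t i)) = a i * log 2 (a i) - a i * log 2 TA"
          using a(1)[OF \<open>i \<in> I\<close>] TA by (cases "a i = 0") (auto simp: t_def log_divide algebra_simps)
      qed
      also have "\<dots> = (\<Sum>i\<in>I. a i * log 2 (a i)) - TA * log 2 TA"
        by (simp add: sum_subtractf sum_distrib_right[symmetric] sa)
      finally show ?thesis by (simp add: vn eta_def sum_negf)
    qed
    have key: "TA * (\<Sum>i\<in>I. \<Sum>j\<in>I. D i j) = - (vn_entropy I (gram S g) - eta TA) - (\<Sum>j\<in>I. bx j * log 2 (b j / TR))"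
      unfolding DD right_diff_distrib ent using TA by (simp add: sum_distrib_left s_def)
    have "0 \<le> (\<Sum>i\<in>I. \<Sum>j\<in>I. D i j)" using D0 by (intro sum_nonneg) auto
    then have "0 \<le> TA * (\<Sum>i\<in>I. \<Sum>j\<in>I. D i j)" using TA by simp
    moreover have "of_real TR * gram S g i j = of_real TA * gram S' g i j"
      if eq: "vn_entropy I (gram S g) - eta TA = - (\<Sum>j\<in>I. bx j * log 2 (b j / TR))" and ij: "i \<in> I" "j \<in> I" for i j
    proof -
      have "(\<Sum>i\<in>I. \<Sum>j\<in>I. D i j) = 0" using key eq TA by simp
      then have D00: "D i j = 0" if "i \<in> I" "j \<in> I" for i j
        using D0 I that by (subst (asm) sum_nonneg_eq_0_iff) (auto simp: sum_nonneg sum_nonneg_eq_0_iff)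
      \<comment> \<open>Zero defect means that \<open>f j\<close> overlaps only with eigenvectors of
        one eigenvalue, hence it is an eigenvector of the smaller operator as well.\<close>
      have Af: "app I (gram S g) (f j) i = of_real (TA * s j) * f j i" if "i \<in> I" "j \<in> I" for i j
      proof -
        have "app I (gram S g) (f j) i = (\<Sum>k\<in>I. ip I (e k) (app I (gram S g) (f j)) * e k i)"
          by (rule onb_expand[OF I e that(1)])
        also have "\<dots> = (\<Sum>k\<in>I. of_real (TA * s j) * (ip I (e k) (f j) * e k i))"
        proof (rule sum.cong[OF refl])
          fix k assume k: "k \<in> I"
          have "ip I (e k) (f j) = 0 \<or> a k = TA * s j"
            using Deq[OF D00[OF k that(2)] _ k that(2)] TA by (auto simp: w_def t_def field_simps)
          then show "ip I (e k) (app I (gram S g) (f j)) * e k i = of_real (TA * s j) * (ip I (e k) (f j) * e k i)"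
            using eA[OF k, of j] by auto
        qed
        also have "\<dots> = of_real (TA * s j) * f j i"
          unfolding sum_distrib_left[symmetric] by (simp add: onb_expand[OF I e that(1), of "f j"])
        finally show ?thesis .
      qed
      have "gram S g i j = (\<Sum>k\<in>I. of_real (TA * s k) * f k i * cnj (f k j))"
        using eigenbasis_decomposition[OF I f Af ij] by simp
      moreover have "gram S' g i j = (\<Sum>k\<in>I. of_real (b k) * f k i * cnj (f k j))"
        using eigenbasis_decomposition[OF I f fb ij] by simp
      ultimately show ?thesis using TR by (simp add: sum_distrib_left s_def mult.assoc)
    qed
    ultimately show ?thesis using key by auto
  qed
  then show "vn_entropy I (gram S g) - eta TA \<le> - (\<Sum>j\<in>I. bx j * log 2 (b j / TR))"
    and "vn_entropy I (gram S g) - eta TA = - (\<Sum>j\<in>I. bx j * log 2 (b j / TR)) \<Longrightarrow>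
      i \<in> I \<Longrightarrow> j \<in> I \<Longrightarrow> of_real TR * gram S g i j = of_real TA * gram S' g i j"
    by blast+
qed

text \<open>\<open>G\<close> is the entropy of a normalized state times its weight, so the sum over
  \<open>x\<close> is a conditional entropy and \<open>G\<close> of the union the unconditional one.
  Klein's inequality bounds each summand by a cross entropy \<open>B x\<close> with the average
  state; these add up to the right-hand side because the \<open>bx\<close> add up to
  \<open>b\<close>. Equality of the sums forces it for every \<open>x\<close>.\<close>

lemma conditional_entropy_concave:
  fixes g :: "'s \<Rightarrow> 'i \<Rightarrow> complex" and S :: "'x \<Rightarrow> 's set"
  assumes fin: "finite I" "finite X" "\<And>x. x \<in> X \<Longrightarrow> finite (S x)"
    and disj: "\<And>x x'. x \<in> X \<Longrightarrow> x' \<in> X \<Longrightarrow> x \<noteq> x' \<Longrightarrow> S x \<inter> S x' = {}"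
  defines "T \<equiv> \<lambda>S. \<Sum>s\<in>S. \<Sum>i\<in>I. (cmod (g s i))\<^sup>2"
  defines "G \<equiv> \<lambda>S. vn_entropy I (gram S g) - eta (T S)"
  shows "(\<Sum>x\<in>X. G (S x)) \<le> G (\<Union>x\<in>X. S x)"
    and "(\<Sum>x\<in>X. G (S x)) = G (\<Union>x\<in>X. S x) \<Longrightarrow> x \<in> X \<Longrightarrow> i \<in> I \<Longrightarrow> j \<in> I \<Longrightarrow>
      of_real (T (\<Union>x\<in>X. S x)) * gram (S x) g i j = of_real (T (S x)) * gram (\<Union>x\<in>X. S x) g i j"
proof -
  let ?U = "\<Union>x\<in>X. S x"
  have finU: "finite ?U" using fin by auto
  obtain f b where f: "onb I f"
    and b: "\<And>k. k \<in> I \<Longrightarrow> 0 \<le> b k" "\<And>k. k \<in> I \<Longrightarrow> (\<Sum>s\<in>?U. (cmod (ip I (g s) (f k)))\<^sup>2) = b k"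
    and fb: "\<And>k i. k \<in> I \<Longrightarrow> i \<in> I \<Longrightarrow> app I (gram ?U g) (f k) i = of_real (b k) * f k i"
    and vn: "vn_entropy I (gram ?U g) = (\<Sum>k\<in>I. eta (b k))"
    using gram_eigenbasis[OF fin(1), where S="?U" and g=g] by blast
  define bx where "bx x j = (\<Sum>s\<in>S x. (cmod (ip I (g s) (f j)))\<^sup>2)" for x j
  define B where "B x = - (\<Sum>j\<in>I. bx x j * log 2 (b j / T ?U))" for x
  have sub: "S x \<subseteq> ?U" if "x \<in> X" for x using that by auto
  have le: "G (S x) \<le> B x" if "x \<in> X" for x
    unfolding G_def B_def bx_def T_def
    by (rule klein_gram(1)[OF fin(1) finU sub[OF that] f fb b(2)[symmetric]])
  have eq: "of_real (T ?U) * gram (S x) g i j = of_real (T (S x)) * gram ?U g i j"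
    if "G (S x) = B x" "x \<in> X" "i \<in> I" "j \<in> I" for x i j
    using klein_gram(2)[OF fin(1) finU sub[OF that(2)] f fb b(2)[symmetric] _ that(3,4)] that(1)
    unfolding G_def B_def bx_def T_def by blast
  have bsum: "(\<Sum>x\<in>X. bx x j) = b j" if "j \<in> I" for j
    unfolding bx_def b(2)[OF that, symmetric] using fin disj by (intro sum.UNION_disjoint[symmetric]) auto
  have TU: "(\<Sum>j\<in>I. b j) = T ?U"
  proof -
    have "(\<Sum>j\<in>I. b j) = (\<Sum>j\<in>I. \<Sum>s\<in>?U. (cmod (ip I (g s) (f j)))\<^sup>2)" using b by simp
    also have "\<dots> = (\<Sum>s\<in>?U. \<Sum>j\<in>I. (cmod (ip I (g s) (f j)))\<^sup>2)" by (rule sum.swap)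
    finally show ?thesis by (simp add: onb_parseval_norm[OF fin(1) f] T_def)
  qed
  have "(\<Sum>x\<in>X. B x) = - (\<Sum>j\<in>I. \<Sum>x\<in>X. bx x j * log 2 (b j / T ?U))"
    unfolding B_def sum_negf by (subst sum.swap) simp
  also have "\<dots> = - (\<Sum>j\<in>I. b j * log 2 (b j / T ?U))"
    by (simp add: sum_distrib_right[symmetric] bsum)
  also have "\<dots> = - (\<Sum>j\<in>I. b j * log 2 (b j) - b j * log 2 (T ?U))"
  proof (intro arg_cong[where f=uminus] sum.cong refl)
    fix j assume j: "j \<in> I"
    show "b j * log 2 (b j / T ?U) = b j * log 2 (b j) - b j * log 2 (T ?U)"
    proof (cases "b j = 0")
      case False
      then have "b j > 0" using b(1)[OF j] by simp
      moreover have "b j \<le> T ?U" unfolding TU[symmetric] using b fin j by (intro member_le_sum) auto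
      ultimately show ?thesis by (simp add: log_divide algebra_simps)
    qed simp
  qed
  also have "\<dots> = G ?U"
    by (simp add: G_def vn eta_def sum_subtractf sum_negf sum_distrib_right[symmetric] TU)
  finally have B: "(\<Sum>x\<in>X. B x) = G ?U" .
  show "(\<Sum>x\<in>X. G (S x)) \<le> G ?U" unfolding B[symmetric] by (intro sum_mono le)
  assume E: "(\<Sum>x\<in>X. G (S x)) = G ?U" and x: "x \<in> X" "i \<in> I" "j \<in> I"
  have "(\<Sum>x\<in>X. B x - G (S x)) = 0" using E B by (simp add: sum_subtractf)
  then have "B x - G (S x) = 0" using fin le x by (subst (asm) sum_nonneg_eq_0_iff) auto
  then show "of_real (T ?U) * gram (S x) g i j = of_real (T (S x)) * gram ?U g i j"
    using eq x by simp
qed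

section \<open>Entropy of classical and classical-quantum states\<close>

lemma vn_entropy_diagonal:
  fixes p :: "'i::finite \<Rightarrow> real"
  assumes "\<And>i j. \<rho> i j = (if i = j then complex_of_real (p i) else 0)"
  shows "vn_entropy UNIV \<rho> = (\<Sum>i\<in>UNIV. eta (p i))"
proof (rule vn_entropy_orthonormal[where e = "\<lambda>k i. if i = k then 1 else 0"])
  show "orthonormal UNIV UNIV (\<lambda>k i :: 'i. if i = k then 1 else 0)"
    by (auto simp: orthonormal_def ip_def if_distrib cong: if_cong)
  fix i j
  show "\<rho> i j = (\<Sum>k\<in>UNIV. complex_of_real (p k) * (if i = k then 1 else 0) * cnj (if j = k then 1 else 0))"
  proof -
    have "(\<Sum>k\<in>UNIV. complex_of_real (p k) * (if i = k then 1 else 0) * cnj (if j = k then 1 else 0))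
        = (\<Sum>k\<in>UNIV. if k = i then \<rho> i j else 0)"
      by (intro sum.cong refl) (auto simp: assms)
    then show ?thesis by simp
  qed
qed auto

text \<open>Here \<open>c\<close> reads off the classical and \<open>h\<close> the quantum part of a
  label. Eigenvectors of the blocks, extended by zero, form an orthonormal family indexed by
  \<open>C \<times> H\<close> that diagonalizes the whole operator.\<close>

lemma vn_entropy_blocks:
  fixes g :: "'c \<Rightarrow> 's \<Rightarrow> 'h \<Rightarrow> complex"
  assumes fin: "finite J" "finite C" "finite H" and bij: "bij_betw (\<lambda>i. (c i, h i)) J (C \<times> H)"
    and \<rho>: "\<And>i j. i \<in> J \<Longrightarrow> j \<in> J \<Longrightarrow> \<rho> i j = (if c i = c j then gram (S (c i)) (g (c i)) (h i) (h j) else 0)"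
  shows "vn_entropy J \<rho> = (\<Sum>\<gamma>\<in>C. vn_entropy H (gram (S \<gamma>) (g \<gamma>)))"
proof -
  define Q where "Q \<gamma> e d \<longleftrightarrow> onb H e
      \<and> (\<forall>i\<in>H. \<forall>j\<in>H. gram (S \<gamma>) (g \<gamma>) i j = (\<Sum>k\<in>H. of_real (d k) * e k i * cnj (e k j)))
      \<and> vn_entropy H (gram (S \<gamma>) (g \<gamma>)) = (\<Sum>k\<in>H. eta (d k))" for \<gamma> e d
  have "\<forall>\<gamma>. \<exists>e d. Q \<gamma> e d"
  proof
    fix \<gamma> show "\<exists>e d. Q \<gamma> e d"
      using gram_eigenbasis[OF fin(3), where S="S \<gamma>" and g="g \<gamma>"] unfolding Q_def by blast
  qed
  from choice[OF this] obtain e where "\<forall>\<gamma>. \<exists>d. Q \<gamma> (e \<gamma>) d" by blast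
  from choice[OF this] obtain d where Q: "\<And>\<gamma>. Q \<gamma> (e \<gamma>) (d \<gamma>)" by blast
  have cH: "c i \<in> C" "h i \<in> H" if "i \<in> J" for i using bij that by (auto simp: bij_betw_def)
  have sumJ: "(\<Sum>i\<in>J. F (c i) (h i)) = (\<Sum>\<gamma>\<in>C. \<Sum>m\<in>H. F \<gamma> m)" for F :: "_ \<Rightarrow> _ \<Rightarrow> complex"
    using sum.reindex_bij_betw[OF bij, of "\<lambda>(\<gamma>, m). F \<gamma> m"] fin
    by (simp add: sum.cartesian_product)
  define E where "E = (\<lambda>(\<gamma>, k) i. if c i = \<gamma> then e \<gamma> k (h i) else 0)"
  have "vn_entropy J \<rho> = (\<Sum>p\<in>C \<times> H. eta ((\<lambda>(\<gamma>, k). d \<gamma> k) p))"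
  proof (rule vn_entropy_orthonormal[where e=E])
    show "orthonormal J (C \<times> H) E"
      unfolding orthonormal_def
    proof (intro ballI, safe)
      fix \<gamma> k \<delta> l assume A: "\<gamma> \<in> C" "k \<in> H" "\<delta> \<in> C" "l \<in> H"
      have "ip J (E (\<gamma>, k)) (E (\<delta>, l)) =
          (\<Sum>\<epsilon>\<in>C. \<Sum>m\<in>H. cnj (if \<epsilon> = \<gamma> then e \<gamma> k m else 0) * (if \<epsilon> = \<delta> then e \<delta> l m else 0))"
        unfolding ip_def E_def split by (rule sumJ)
      also have "\<dots> = (\<Sum>\<epsilon>\<in>C. if \<epsilon> = \<gamma> then (if \<gamma> = \<delta> then ip H (e \<gamma> k) (e \<delta> l) else 0) else 0)"
        by (intro sum.cong refl) (auto simp: ip_def)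
      also have "\<dots> = (if \<gamma> = \<delta> then ip H (e \<gamma> k) (e \<delta> l) else 0)" using A fin by simp
      finally show "ip J (E (\<gamma>, k)) (E (\<delta>, l)) = (if (\<gamma>, k) = (\<delta>, l) then 1 else 0)"
        using Q A by (auto simp: Q_def onb_def orthonormal_def)
    qed
    fix i j assume ij: "i \<in> J" "j \<in> J"
    have "(\<Sum>p\<in>C \<times> H. complex_of_real ((\<lambda>(\<gamma>, k). d \<gamma> k) p) * E p i * cnj (E p j)) =
      (\<Sum>\<gamma>\<in>C. \<Sum>k\<in>H. of_real (d \<gamma> k) * E (\<gamma>, k) i * cnj (E (\<gamma>, k) j))"
      by (simp add: sum.cartesian_product case_prod_beta)
    also have "\<dots> = (\<Sum>\<gamma>\<in>C. if \<gamma> = c i then (if c i = c j then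
        (\<Sum>k\<in>H. complex_of_real (d (c i) k) * e (c i) k (h i) * cnj (e (c i) k (h j))) else 0) else 0)"
      by (intro sum.cong refl) (auto simp: E_def)
    also have "\<dots> = \<rho> i j" using ij cH Q fin by (auto simp: \<rho> Q_def)
    finally show "\<rho> i j = (\<Sum>p\<in>C \<times> H. complex_of_real ((\<lambda>(\<gamma>, k). d \<gamma> k) p) * E p i * cnj (E p j))" by simp
  qed (use fin in auto)
  also have "\<dots> = (\<Sum>\<gamma>\<in>C. vn_entropy H (gram (S \<gamma>) (g \<gamma>)))"
    using Q by (simp add: sum.cartesian_product case_prod_beta Q_def)
  finally show ?thesis .
qed

section \<open>Structure of embeddings\<close>

lemma classical_mutual_info_eq:
  fixes P :: "('x::finite \<times> 'y::finite) pmf"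
  shows "classical_mutual_info P =
    (\<Sum>x\<in>UNIV. eta (\<Sum>y\<in>UNIV. pmf P (x, y))) + (\<Sum>y\<in>UNIV. eta (\<Sum>x\<in>UNIV. pmf P (x, y)))
    - (\<Sum>x\<in>UNIV. \<Sum>y\<in>UNIV. eta (pmf P (x, y)))"
proof -
  interpret information_space "measure_pmf P" 2
    by unfold_locales simp
  define Px where "Px x = (\<Sum>y\<in>UNIV. pmf P (x, y))" for x
  define Py where "Py y = (\<Sum>x\<in>UNIV. pmf P (x, y))" for y
  have mx: "measure (measure_pmf P) (fst -` {x}) = Px x" for x
  proof -
    have "fst -` {x} = Pair x ` (UNIV :: 'y set)" by force
    then show ?thesis by (simp add: measure_measure_pmf_finite Px_def sum.reindex inj_on_def)
  qed
  have my: "measure (measure_pmf P) (snd -` {y}) = Py y" for y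
  proof -
    have "snd -` {y} = (\<lambda>x. (x, y)) ` (UNIV :: 'x set)" by force
    then show ?thesis by (simp add: measure_measure_pmf_finite Py_def sum.reindex inj_on_def)
  qed
  have sf: "simple_function (measure_pmf P) f" for f :: "'x \<times> 'y \<Rightarrow> 'z::finite"
    by (auto simp: simple_function_def)
  have 1: "simple_distributed (measure_pmf P) fst Px"
    by (rule measure_pmf.simple_distributedI) (auto simp: simple_function_def mx Px_def sum_nonneg)
  have 2: "simple_distributed (measure_pmf P) snd Py"
    by (rule measure_pmf.simple_distributedI) (auto simp: simple_function_def my Py_def sum_nonneg)
  have "(\<lambda>x. (fst x, snd x)) -` {z} = {z}" for z :: "'x \<times> 'y" by auto
  then have 3: "simple_distributed (measure_pmf P) (\<lambda>x. (fst x, snd x)) (pmf P)"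
    by (intro measure_pmf.simple_distributedI) (auto simp: simple_function_def measure_pmf_single)
  have "classical_mutual_info P = (\<Sum>(x, y)\<in>(\<lambda>x. (fst x, snd x)) ` space (measure_pmf P).
      pmf P (x, y) * log 2 (pmf P (x, y) / (Px x * Py y)))"
    using mutual_information_simple_distributed[OF 1 2 3] unfolding classical_mutual_info_def by simp
  also have "\<dots> = (\<Sum>x\<in>UNIV. \<Sum>y\<in>UNIV. pmf P (x, y) * log 2 (pmf P (x, y) / (Px x * Py y)))"
    by (simp add: sum.cartesian_product)
  also have "\<dots> = (\<Sum>x\<in>UNIV. \<Sum>y\<in>UNIV. - eta (pmf P (x, y)) - pmf P (x, y) * log 2 (Px x) - pmf P (x, y) * log 2 (Py y))"
  proof (intro sum.cong refl)
    fix x y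
    show "pmf P (x, y) * log 2 (pmf P (x, y) / (Px x * Py y)) =
      - eta (pmf P (x, y)) - pmf P (x, y) * log 2 (Px x) - pmf P (x, y) * log 2 (Py y)"
    proof (cases "pmf P (x, y) = 0")
      case False
      then have p: "pmf P (x, y) > 0" by (simp add: pmf_pos)
      have "pmf P (x, y) \<le> Px x" unfolding Px_def by (intro member_le_sum) auto
      moreover have "pmf P (x, y) \<le> Py y" unfolding Py_def by (rule member_le_sum[of x UNIV "\<lambda>x. pmf P (x, y)"]) auto
      ultimately show ?thesis using p by (simp add: eta_def log_divide log_mult algebra_simps)
    qed simp
  qed
  also have "\<dots> = - (\<Sum>x\<in>UNIV. \<Sum>y\<in>UNIV. eta (pmf P (x, y))) - (\<Sum>x\<in>UNIV. \<Sum>y\<in>UNIV. pmf P (x, y) * log 2 (Px x))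
      - (\<Sum>x\<in>UNIV. \<Sum>y\<in>UNIV. pmf P (x, y) * log 2 (Py y))"
    by (simp add: sum_subtractf sum_negf)
  also have "(\<Sum>x\<in>UNIV. \<Sum>y\<in>UNIV. pmf P (x, y) * log 2 (Px x)) = - (\<Sum>x\<in>UNIV. eta (Px x))"
    by (simp add: eta_def sum_negf sum_distrib_right[symmetric] Px_def)
  also have "(\<Sum>x\<in>UNIV. \<Sum>y\<in>UNIV. pmf P (x, y) * log 2 (Py y)) = - (\<Sum>y\<in>UNIV. eta (Py y))"
    by (subst sum.swap) (simp add: eta_def sum_negf sum_distrib_right[symmetric] Py_def)
  finally show ?thesis by (simp add: Px_def Py_def)
qed

lemma sum_UNIV_prod: "(\<Sum>z\<in>UNIV. f z) = (\<Sum>x\<in>UNIV. \<Sum>y\<in>UNIV. f (x, y))"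
  for f :: "'p::finite \<times> 'q::finite \<Rightarrow> 'z::comm_monoid_add"
  by (simp add: sum.cartesian_product)

text \<open>In all uses \<open>keep\<close> and \<open>env\<close> together are injective, so that the inner sum of \<open>reduced_state\<close> has at
  most one term.\<close>

lemma reduced_state_eq:
  assumes "inj_on N S" "\<And>m. keep m = i \<longleftrightarrow> m \<in> N ` S"
    and "\<And>s m. s \<in> S \<Longrightarrow> keep m = j \<and> env m = env (N s) \<longleftrightarrow> m = N' s"
  shows "reduced_state \<phi> keep env i j = (\<Sum>s\<in>S. \<phi> (N s) * cnj (\<phi> (N' s)))"
proof -
  have bij: "bij_betw N S {m. keep m = i}"
    using assms(1,2) unfolding bij_betw_def by auto
  show ?thesis
    unfolding reduced_state_def using assms(3)
    by (subst sum.reindex_bij_betw[OF bij, symmetric]) simp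
qed

text \<open>Decoherence: labels that differ in a register of which the environment holds a copy
  never meet in the partial trace.\<close>

lemma reduced_state_eq_0:
  assumes "\<And>n n'. keep n = i \<Longrightarrow> keep n' = j \<Longrightarrow> env n \<noteq> env n'"
  shows "reduced_state \<phi> keep env i j = 0"
  unfolding reduced_state_def
proof (rule sum.neutral, rule ballI)
  fix n assume "n \<in> {n. keep n = i}"
  then have "{n'. keep n' = j \<and> env n' = env n} = {}" using assms by fastforce
  then show "(\<Sum>n' | keep n' = j \<and> env n' = env n. \<phi> n * cnj (\<phi> n')) = 0" by (simp only: sum.empty)
qed

text \<open>For \<open>h y (x, a) b = \<psi> ((x, a), (y, b))\<close> the hypothesis \<open>eq\<close> is \<open>S(B'|Y) = S(B'|XY)\<close>.\<close>

lemma conditional_states_eq: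
  fixes h :: "'y::finite \<Rightarrow> 'x::finite \<times> 'a::finite \<Rightarrow> 'b::finite \<Rightarrow> complex" and p :: "'x \<Rightarrow> 'y \<Rightarrow> real"
  assumes p: "\<And>x y. p x y = (\<Sum>a\<in>UNIV. \<Sum>b\<in>UNIV. (cmod (h y (x, a) b))\<^sup>2)"
    and eq: "(\<Sum>y\<in>UNIV. vn_entropy UNIV (gram UNIV (h y))) - (\<Sum>y\<in>UNIV. \<Sum>x\<in>UNIV. vn_entropy UNIV (gram ({x} \<times> UNIV) (h y)))
      = (\<Sum>y\<in>UNIV. eta (\<Sum>x\<in>UNIV. p x y)) - (\<Sum>y\<in>UNIV. \<Sum>x\<in>UNIV. eta (p x y))"
  shows "of_real (\<Sum>x\<in>UNIV. p x y) * gram ({x} \<times> UNIV) (h y) b b' = of_real (p x y) * gram UNIV (h y) b b'"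
proof -
  define T where "T y S = (\<Sum>s\<in>S. \<Sum>i\<in>UNIV. (cmod (h y s i))\<^sup>2)" for y S
  define G where "G y S = vn_entropy UNIV (gram S (h y)) - eta (T y S)" for y S
  have U: "(\<Union>x\<in>UNIV. {x} \<times> UNIV) = (UNIV :: ('x \<times> 'a) set)" by auto
  have Tx: "T y ({x} \<times> UNIV) = p x y" for x y
  proof -
    have "T y ({x} \<times> UNIV) = (\<Sum>s\<in>Pair x ` UNIV. \<Sum>i\<in>UNIV. (cmod (h y s i))\<^sup>2)"
      unfolding T_def by (intro sum.cong) auto
    then show ?thesis by (simp add: p sum.reindex inj_on_def)
  qed
  have TU: "T y UNIV = (\<Sum>x\<in>UNIV. p x y)" for y
    by (simp add: T_def p sum_UNIV_prod)
  have disj: "x \<noteq> x' \<Longrightarrow> ({x} \<times> UNIV) \<inter> ({x'} \<times> UNIV) = ({} :: ('x \<times> 'a) set)" for x x' by auto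
  have le: "(\<Sum>x\<in>UNIV. G y ({x} \<times> UNIV)) \<le> G y UNIV" for y
    using conditional_entropy_concave(1)[of UNIV UNIV "\<lambda>x. {x} \<times> UNIV" "h y", OF _ _ _ disj]
    unfolding U G_def T_def by simp
  \<comment> \<open>Correctness only speaks of the sum over \<open>y\<close>. Each summand is
    nonnegative by concavity, so each of them vanishes.\<close>
  have "(\<Sum>y\<in>UNIV. G y UNIV - (\<Sum>x\<in>UNIV. G y ({x} \<times> UNIV))) = 0"
    using eq by (simp add: G_def Tx TU sum_subtractf)
  then have e: "(\<Sum>x\<in>UNIV. G y ({x} \<times> UNIV)) = G y UNIV"
    using le by (subst (asm) sum_nonneg_eq_0_iff) auto
  show ?thesis
    using conditional_entropy_concave(2)[of UNIV UNIV "\<lambda>x. {x} \<times> UNIV" "h y" x b b', OF _ _ _ disj] e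
    unfolding U G_def T_def[symmetric] Tx TU by simp
qed

section \<open>The entropies in the correctness condition\<close>

lemma qentropy_classical:
  fixes \<psi> :: "('x::finite, 'a::finite, 'y::finite, 'b::finite) state"
  shows "qentropy \<psi> (\<lambda>((x, a), (y, b)). x) (\<lambda>n. ((\<lambda>((x, a), (y, b)). (y, b)) n, (\<lambda>((x, a), (y, b)). (x, y, a)) n))
      = (\<Sum>x\<in>UNIV. eta (\<Sum>s\<in>UNIV. (cmod (\<psi> ((x, fst s), snd s)))\<^sup>2))"
    (is "qentropy _ ?k ?e = _")
    and "qentropy \<psi> (\<lambda>((x, a), (y, b)). y) (\<lambda>n. ((\<lambda>((x, a), (y, b)). (x, a)) n, (\<lambda>((x, a), (y, b)). (x, y, b)) n))
      = (\<Sum>y\<in>UNIV. eta (\<Sum>s\<in>UNIV. (cmod (\<psi> (fst s, (y, snd s))))\<^sup>2))"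
    (is "qentropy _ ?k' ?e' = _")
proof -
  have "range ?k = UNIV" by (auto simp: image_def)
  moreover have "reduced_state \<psi> ?k ?e i j = (if i = j then complex_of_real
      (\<Sum>s\<in>UNIV. (cmod (\<psi> ((i, fst s), snd s)))\<^sup>2) else 0)" for i j
  proof (cases "i = j")
    case True
    have "reduced_state \<psi> ?k ?e i i = (\<Sum>s\<in>UNIV. \<psi> ((i, fst s), snd s) * cnj (\<psi> ((i, fst s), snd s)))"
      by (rule reduced_state_eq) (auto simp: inj_on_def image_iff prod_eq_iff split: prod.splits)
    then show ?thesis using True by (simp add: complex_norm_square del: of_real_power)
  qed (auto intro!: reduced_state_eq_0)
  ultimately show "qentropy \<psi> ?k ?e = (\<Sum>x\<in>UNIV. eta (\<Sum>s\<in>UNIV. (cmod (\<psi> ((x, fst s), snd s)))\<^sup>2))"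
    unfolding qentropy_def by (simp only: vn_entropy_diagonal)
  have "range ?k' = UNIV" by (auto simp: image_def)
  moreover have "reduced_state \<psi> ?k' ?e' i j = (if i = j then complex_of_real
      (\<Sum>s\<in>UNIV. (cmod (\<psi> (fst s, (i, snd s))))\<^sup>2) else 0)" for i j
  proof (cases "i = j")
    case True
    have "reduced_state \<psi> ?k' ?e' i i = (\<Sum>s\<in>UNIV. \<psi> (fst s, (i, snd s)) * cnj (\<psi> (fst s, (i, snd s))))"
      by (rule reduced_state_eq) (auto simp: inj_on_def image_iff prod_eq_iff split: prod.splits)
    then show ?thesis using True by (simp add: complex_norm_square del: of_real_power)
  qed (auto intro!: reduced_state_eq_0)
  ultimately show "qentropy \<psi> ?k' ?e' = (\<Sum>y\<in>UNIV. eta (\<Sum>s\<in>UNIV. (cmod (\<psi> (fst s, (y, snd s))))\<^sup>2))"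
    unfolding qentropy_def by (simp only: vn_entropy_diagonal)
qed

lemma qentropy_blocks:
  fixes \<phi> :: "'n::finite \<Rightarrow> complex" and g :: "'c \<Rightarrow> 's \<Rightarrow> 'h \<Rightarrow> complex"
  assumes "finite C" "finite H" "bij_betw (\<lambda>i. (c i, h i)) (range keep) (C \<times> H)"
    and "\<And>i j. i \<in> range keep \<Longrightarrow> j \<in> range keep \<Longrightarrow> c i = c j \<Longrightarrow>
      reduced_state \<phi> keep env i j = gram (S (c i)) (g (c i)) (h i) (h j)"
    and "\<And>n n'. c (keep n) \<noteq> c (keep n') \<Longrightarrow> env n \<noteq> env n'"
  shows "qentropy \<phi> keep env = (\<Sum>\<gamma>\<in>C. vn_entropy H (gram (S \<gamma>) (g \<gamma>)))"
  unfolding qentropy_def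
proof (rule vn_entropy_blocks[OF _ assms(1-3)])
  fix i j assume ij: "i \<in> range keep" "j \<in> range keep"
  show "reduced_state \<phi> keep env i j = (if c i = c j then gram (S (c i)) (g (c i)) (h i) (h j) else 0)"
    using assms(4)[OF ij] assms(5) by (auto intro!: reduced_state_eq_0)
qed simp

lemma bij_betw_UNIV_witness:
  assumes "\<And>i. f' (f i) = i" "\<And>k. f (f' k) = k"
  shows "bij_betw f UNIV UNIV"
  using assms by (intro bij_betwI[of _ _ _ f']) auto

lemma gram_singleton_times: "gram ({x} \<times> UNIV) g i j = (\<Sum>a\<in>UNIV. g (x, a) i * cnj (g (x, a) j))"
proof -
  have "gram ({x} \<times> UNIV) g i j = (\<Sum>s\<in>Pair x ` UNIV. g s i * cnj (g s j))"
    unfolding gram_def by (intro sum.cong) auto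
  then show ?thesis by (simp add: sum.reindex inj_on_def)
qed

text \<open>For \<open>YB'\<close> and \<open>XA'\<close> only the own output is a classical label;
  the whole other share runs through the index of the Gram operator.\<close>

lemma qentropy_one_sided:
  fixes \<psi> :: "('x::finite, 'a::finite, 'y::finite, 'b::finite) state"
  shows "qentropy \<psi> (\<lambda>((x, a), (y, b)). (y, b)) (\<lambda>n. ((\<lambda>((x, a), (y, b)). x) n, (\<lambda>((x, a), (y, b)). (x, y, a)) n))
      = (\<Sum>y\<in>UNIV. vn_entropy UNIV (gram UNIV (\<lambda>s b. \<psi> (s, (y, b)))))"
    and "qentropy \<psi> (\<lambda>((x, a), (y, b)). (x, a)) (\<lambda>n. ((\<lambda>((x, a), (y, b)). y) n, (\<lambda>((x, a), (y, b)). (x, y, b)) n))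
      = (\<Sum>x\<in>UNIV. vn_entropy UNIV (gram UNIV (\<lambda>s a. \<psi> ((x, a), s))))"
proof -
  show "qentropy \<psi> (\<lambda>((x, a), (y, b)). (y, b)) (\<lambda>n. ((\<lambda>((x, a), (y, b)). x) n, (\<lambda>((x, a), (y, b)). (x, y, a)) n))
      = (\<Sum>y\<in>UNIV. vn_entropy UNIV (gram UNIV (\<lambda>s b. \<psi> (s, (y, b)))))"
    (is "qentropy _ ?k ?e = _")
  proof (rule qentropy_blocks[where c=fst and h=snd])
    have "range ?k = UNIV" by (auto simp: image_def)
    then show "bij_betw (\<lambda>i. (fst i, snd i)) (range ?k) (UNIV \<times> UNIV)" by (simp add: bij_betw_def)
    fix i j :: "'y \<times> 'b" assume "fst i = fst j"
    then show "reduced_state \<psi> ?k ?e i j = gram UNIV (\<lambda>s b. \<psi> (s, (fst i, b))) (snd i) (snd j)"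
      unfolding gram_def by (intro reduced_state_eq) (auto simp: inj_on_def image_iff prod_eq_iff split: prod.splits)
  qed (auto split: prod.splits)
  show "qentropy \<psi> (\<lambda>((x, a), (y, b)). (x, a)) (\<lambda>n. ((\<lambda>((x, a), (y, b)). y) n, (\<lambda>((x, a), (y, b)). (x, y, b)) n))
      = (\<Sum>x\<in>UNIV. vn_entropy UNIV (gram UNIV (\<lambda>s a. \<psi> ((x, a), s))))"
    (is "qentropy _ ?k ?e = _")
  proof (rule qentropy_blocks[where c=fst and h=snd])
    have "range ?k = UNIV" by (auto simp: image_def)
    then show "bij_betw (\<lambda>i. (fst i, snd i)) (range ?k) (UNIV \<times> UNIV)" by (simp add: bij_betw_def)
    fix i j :: "'x \<times> 'a" assume "fst i = fst j"
    then show "reduced_state \<psi> ?k ?e i j = gram UNIV (\<lambda>s a. \<psi> ((fst i, a), s)) (snd i) (snd j)"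
      unfolding gram_def by (intro reduced_state_eq) (auto simp: inj_on_def image_iff prod_eq_iff split: prod.splits)
  qed (auto split: prod.splits)
qed

text \<open>For \<open>XYB'\<close> and \<open>XA'Y\<close> both outputs are classical labels, and
  only the other party's working register is summed over.\<close>

lemma qentropy_two_sided:
  fixes \<psi> :: "('x::finite, 'a::finite, 'y::finite, 'b::finite) state"
  shows "qentropy \<psi> (\<lambda>n. ((\<lambda>((x, a), (y, b)). x) n, (\<lambda>((x, a), (y, b)). (y, b)) n)) (\<lambda>((x, a), (y, b)). (x, y, a))
      = (\<Sum>\<gamma>\<in>UNIV. vn_entropy UNIV (gram ({fst \<gamma>} \<times> UNIV) (\<lambda>s b. \<psi> (s, (snd \<gamma>, b)))))"
    and "qentropy \<psi> (\<lambda>n. ((\<lambda>((x, a), (y, b)). (x, a)) n, (\<lambda>((x, a), (y, b)). y) n)) (\<lambda>((x, a), (y, b)). (x, y, b))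
      = (\<Sum>\<gamma>\<in>UNIV. vn_entropy UNIV (gram ({snd \<gamma>} \<times> UNIV) (\<lambda>s a. \<psi> ((fst \<gamma>, a), s))))"
proof -
  show "qentropy \<psi> (\<lambda>n. ((\<lambda>((x, a), (y, b)). x) n, (\<lambda>((x, a), (y, b)). (y, b)) n)) (\<lambda>((x, a), (y, b)). (x, y, a))
      = (\<Sum>\<gamma>\<in>UNIV. vn_entropy UNIV (gram ({fst \<gamma>} \<times> UNIV) (\<lambda>s b. \<psi> (s, (snd \<gamma>, b)))))"
    (is "qentropy _ ?k ?e = _")
  proof (rule qentropy_blocks[where c="\<lambda>i. (fst i, fst (snd i))" and h="\<lambda>i. snd (snd i)"])
    have "range ?k = UNIV" by (auto simp: image_def)
    moreover have "bij (\<lambda>i::'x \<times> 'y \<times> 'b. ((fst i, fst (snd i)), snd (snd i)))"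
      by (rule bij_betw_UNIV_witness[of "\<lambda>z. (fst (fst z), (snd (fst z), snd z))"]) auto
    ultimately show "bij_betw (\<lambda>i. ((fst i, fst (snd i)), snd (snd i))) (range ?k) (UNIV \<times> UNIV)"
      by (simp only: UNIV_Times_UNIV)
    fix i j :: "'x \<times> 'y \<times> 'b" assume "(fst i, fst (snd i)) = (fst j, fst (snd j))"
    then have "reduced_state \<psi> ?k ?e i j =
        (\<Sum>a\<in>UNIV. \<psi> ((fst i, a), (fst (snd i), snd (snd i))) * cnj (\<psi> ((fst i, a), (fst (snd i), snd (snd j)))))"
      by (intro reduced_state_eq) (auto simp: inj_on_def image_iff prod_eq_iff split: prod.splits)
    then show "reduced_state \<psi> ?k ?e i j = gram ({fst (fst i, fst (snd i))} \<times> UNIV)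
        (\<lambda>s b. \<psi> (s, (snd (fst i, fst (snd i)), b))) (snd (snd i)) (snd (snd j))"
      by (simp add: gram_singleton_times)
  qed (auto split: prod.splits)
  show "qentropy \<psi> (\<lambda>n. ((\<lambda>((x, a), (y, b)). (x, a)) n, (\<lambda>((x, a), (y, b)). y) n)) (\<lambda>((x, a), (y, b)). (x, y, b))
      = (\<Sum>\<gamma>\<in>UNIV. vn_entropy UNIV (gram ({snd \<gamma>} \<times> UNIV) (\<lambda>s a. \<psi> ((fst \<gamma>, a), s))))"
    (is "qentropy _ ?k ?e = _")
  proof (rule qentropy_blocks[where c="\<lambda>i. (fst (fst i), snd i)" and h="\<lambda>i. snd (fst i)"])
    have "range ?k = UNIV" by (auto simp: image_def)
    moreover have "bij (\<lambda>i::('x \<times> 'a) \<times> 'y. ((fst (fst i), snd i), snd (fst i)))"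
      by (rule bij_betw_UNIV_witness[of "\<lambda>z. ((fst (fst z), snd z), snd (fst z))"]) auto
    ultimately show "bij_betw (\<lambda>i. ((fst (fst i), snd i), snd (fst i))) (range ?k) (UNIV \<times> UNIV)"
      by (simp only: UNIV_Times_UNIV)
    fix i j :: "('x \<times> 'a) \<times> 'y" assume "(fst (fst i), snd i) = (fst (fst j), snd j)"
    then have "reduced_state \<psi> ?k ?e i j =
        (\<Sum>b\<in>UNIV. \<psi> ((fst (fst i), snd (fst i)), (snd i, b)) * cnj (\<psi> ((fst (fst i), snd (fst j)), (snd i, b))))"
      by (intro reduced_state_eq) (auto simp: inj_on_def image_iff prod_eq_iff split: prod.splits)
    then show "reduced_state \<psi> ?k ?e i j = gram ({snd (fst (fst i), snd i)} \<times> UNIV)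
        (\<lambda>s a. \<psi> ((fst (fst (fst i), snd i), a), s)) (snd (fst i)) (snd (fst j))"
      by (simp add: gram_singleton_times)
  qed (auto split: prod.splits)
qed

text \<open>The entropy of the other party's output cancels from both sides of the correctness
  condition, leaving \<open>S(B'|Y) = S(B'|XY)\<close> and its mirror image. The conclusions
  multiply by marginals rather than divide, so outputs of probability 0 need no exception.\<close>

lemma embedding_structure:
  fixes P :: "('x::finite \<times> 'y::finite) pmf" and \<psi> :: "('x, 'a::finite, 'y, 'b::finite) state"
  assumes "embedding P \<psi>"
  shows "of_real (\<Sum>x\<in>UNIV. pmf P (x, y)) * gram ({x} \<times> UNIV) (\<lambda>s b. \<psi> (s, (y, b))) b b'
      = of_real (pmf P (x, y)) * gram UNIV (\<lambda>s b. \<psi> (s, (y, b))) b b'" (is ?B)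
    and "of_real (\<Sum>y\<in>UNIV. pmf P (x, y)) * gram ({y} \<times> UNIV) (\<lambda>s a. \<psi> ((x, a), s)) a a'
      = of_real (pmf P (x, y)) * gram UNIV (\<lambda>s a. \<psi> ((x, a), s)) a a'" (is ?A)
proof -
  have p: "pmf P (x, y) = (\<Sum>a\<in>UNIV. \<Sum>b\<in>UNIV. (cmod (\<psi> ((x, a), (y, b))))\<^sup>2)" for x y
    using assms by (auto simp: embedding_def honest_outputs_def)
  have px: "(\<Sum>s\<in>UNIV. (cmod (\<psi> ((x, fst s), snd s)))\<^sup>2) = (\<Sum>y\<in>UNIV. pmf P (x, y))" for x
    unfolding p sum_UNIV_prod fst_conv snd_conv by (rule sum.swap)
  have py: "(\<Sum>s\<in>UNIV. (cmod (\<psi> (fst s, (y, snd s))))\<^sup>2) = (\<Sum>x\<in>UNIV. pmf P (x, y))" for y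
    unfolding p sum_UNIV_prod fst_conv snd_conv ..
  note mi = embedding_def mutual_qinfo_def classical_mutual_info_eq
    qentropy_classical qentropy_one_sided qentropy_two_sided px py
  have 1: "(\<Sum>y\<in>UNIV. vn_entropy UNIV (gram UNIV (\<lambda>s b. \<psi> (s, (y, b)))))
      - (\<Sum>y\<in>UNIV. \<Sum>x\<in>UNIV. vn_entropy UNIV (gram ({x} \<times> UNIV) (\<lambda>s b. \<psi> (s, (y, b)))))
      = (\<Sum>y\<in>UNIV. eta (\<Sum>x\<in>UNIV. pmf P (x, y))) - (\<Sum>y\<in>UNIV. \<Sum>x\<in>UNIV. eta (pmf P (x, y)))"
    using assms unfolding mi sum_UNIV_prod fst_conv snd_conv by (subst (1 2) sum.swap) simp
  have 2: "(\<Sum>x\<in>UNIV. vn_entropy UNIV (gram UNIV (\<lambda>s a. \<psi> ((x, a), s))))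
      - (\<Sum>x\<in>UNIV. \<Sum>y\<in>UNIV. vn_entropy UNIV (gram ({y} \<times> UNIV) (\<lambda>s a. \<psi> ((x, a), s))))
      = (\<Sum>x\<in>UNIV. eta (\<Sum>y\<in>UNIV. pmf P (x, y))) - (\<Sum>x\<in>UNIV. \<Sum>y\<in>UNIV. eta (pmf P (x, y)))"
    using assms unfolding mi sum_UNIV_prod fst_conv snd_conv by simp
  show ?B
    by (rule conditional_states_eq[where p="\<lambda>x y. pmf P (x, y)", OF p 1])
  have p': "pmf P (x, y) = (\<Sum>b\<in>UNIV. \<Sum>a\<in>UNIV. (cmod (\<psi> ((x, a), (y, b))))\<^sup>2)" for x y
    unfolding p by (rule sum.swap)
  show ?A
    by (rule conditional_states_eq[where p="\<lambda>y x. pmf P (x, y)", OF p' 2])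
qed

section \<open>When the entropy of the dependent part vanishes\<close>

text \<open>An eigenvector with nonzero eigenvalue lies in the span of its family, so such
  eigenvectors of different families are orthogonal and together diagonalize the sum.\<close>

lemma vn_entropy_orthogonal_sum:
  fixes g :: "'s \<Rightarrow> 'i \<Rightarrow> complex"
  assumes fin: "finite I" "finite C" "\<And>\<gamma>. \<gamma> \<in> C \<Longrightarrow> finite (S \<gamma>)"
    and disj: "\<And>\<gamma> \<delta>. \<gamma> \<in> C \<Longrightarrow> \<delta> \<in> C \<Longrightarrow> \<gamma> \<noteq> \<delta> \<Longrightarrow> S \<gamma> \<inter> S \<delta> = {}"
    and orth: "\<And>\<gamma> \<delta> s s'. \<gamma> \<in> C \<Longrightarrow> \<delta> \<in> C \<Longrightarrow> \<gamma> \<noteq> \<delta> \<Longrightarrow> s \<in> S \<gamma> \<Longrightarrow> s' \<in> S \<delta> \<Longrightarrow> ip I (g s) (g s') = 0"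
  shows "vn_entropy I (gram (\<Union>\<gamma>\<in>C. S \<gamma>) g) = (\<Sum>\<gamma>\<in>C. vn_entropy I (gram (S \<gamma>) g))"
proof -
  define Q where "Q \<gamma> e d \<longleftrightarrow> onb I e
      \<and> (\<forall>k\<in>I. \<forall>i\<in>I. app I (gram (S \<gamma>) g) (e k) i = of_real (d k) * e k i)
      \<and> (\<forall>i\<in>I. \<forall>j\<in>I. gram (S \<gamma>) g i j = (\<Sum>k\<in>I. of_real (d k) * e k i * cnj (e k j)))
      \<and> vn_entropy I (gram (S \<gamma>) g) = (\<Sum>k\<in>I. eta (d k))" for \<gamma> e d
  have "\<forall>\<gamma>. \<exists>e d. Q \<gamma> e d"
  proof
    fix \<gamma> show "\<exists>e d. Q \<gamma> e d"
      using gram_eigenbasis[OF fin(1), where S="S \<gamma>" and g=g] unfolding Q_def by blast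
  qed
  from choice[OF this] obtain e where "\<forall>\<gamma>. \<exists>d. Q \<gamma> (e \<gamma>) d" by blast
  from choice[OF this] obtain d where Q: "\<And>\<gamma>. Q \<gamma> (e \<gamma>) (d \<gamma>)" by blast
  \<comment> \<open>Eigenvectors with eigenvalue 0 may overlap with other families; they are dropped
    at no cost since \<open>eta 0 = 0\<close>.\<close>
  define K where "K = {p \<in> C \<times> I. d (fst p) (snd p) \<noteq> 0}"
  have K: "finite K" "K \<subseteq> C \<times> I" using fin by (auto simp: K_def)
  have expand: "e \<gamma> k i = (\<Sum>s\<in>S \<gamma>. (ip I (g s) (e \<gamma> k) / of_real (d \<gamma> k)) * g s i)"
    if "(\<gamma>, k) \<in> K" "i \<in> I" for \<gamma> k i
  proof -
    have "of_real (d \<gamma> k) * e \<gamma> k i = (\<Sum>s\<in>S \<gamma>. ip I (g s) (e \<gamma> k) * g s i)"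
      using Q[of \<gamma>] that unfolding Q_def K_def app_gram by auto
    moreover have "d \<gamma> k \<noteq> 0" using that by (simp add: K_def)
    ultimately show ?thesis by (simp add: sum_divide_distrib[symmetric] eq_divide_eq mult.commute)
  qed
  have "vn_entropy I (gram (\<Union>\<gamma>\<in>C. S \<gamma>) g) = (\<Sum>p\<in>K. eta (d (fst p) (snd p)))"
  proof (rule vn_entropy_orthonormal[OF fin(1) K(1), where e="\<lambda>p. e (fst p) (snd p)"])
    show "orthonormal I K (\<lambda>p. e (fst p) (snd p))"
      unfolding orthonormal_def
    proof (intro ballI, safe)
      fix \<gamma> k \<delta> l assume A: "(\<gamma>, k) \<in> K" "(\<delta>, l) \<in> K"
      show "ip I (e (fst (\<gamma>, k)) (snd (\<gamma>, k))) (e (fst (\<delta>, l)) (snd (\<delta>, l))) = (if (\<gamma>, k) = (\<delta>, l) then 1 else 0)"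
      proof (cases "\<gamma> = \<delta>")
        case True
        have "k \<in> I" "l \<in> I" using A K by auto
        then show ?thesis using Q[of \<gamma>] True by (auto simp: Q_def onb_def orthonormal_def)
      next
        case False
        have "ip I (e \<gamma> k) (e \<delta> l) = ip I (\<lambda>i. \<Sum>s\<in>S \<gamma>. (ip I (g s) (e \<gamma> k) / of_real (d \<gamma> k)) * g s i)
            (\<lambda>i. \<Sum>s\<in>S \<delta>. (ip I (g s) (e \<delta> l) / of_real (d \<delta> l)) * g s i)"
          using expand A by (intro ip_cong) auto
        also have "\<dots> = 0"
          unfolding ip_sum_left ip_sum_right ip_scale_left ip_scale_right
          using orth[of \<gamma> \<delta>] False A K by (intro sum.neutral ballI) auto
        finally show ?thesis using False by simp
      qed
    qed
    fix i j assume ij: "i \<in> I" "j \<in> I"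
    have "gram (\<Union>\<gamma>\<in>C. S \<gamma>) g i j = (\<Sum>\<gamma>\<in>C. gram (S \<gamma>) g i j)"
      unfolding gram_def using fin disj by (intro sum.UNION_disjoint) auto
    also have "\<dots> = (\<Sum>\<gamma>\<in>C. \<Sum>k\<in>I. of_real (d \<gamma> k) * e \<gamma> k i * cnj (e \<gamma> k j))"
      using Q ij by (intro sum.cong refl) (auto simp: Q_def)
    also have "\<dots> = (\<Sum>p\<in>C \<times> I. of_real (d (fst p) (snd p)) * e (fst p) (snd p) i * cnj (e (fst p) (snd p) j))"
      by (simp add: sum.cartesian_product case_prod_beta)
    also have "\<dots> = (\<Sum>p\<in>K. of_real (d (fst p) (snd p)) * e (fst p) (snd p) i * cnj (e (fst p) (snd p) j))"
      using fin by (intro sum.mono_neutral_right) (auto simp: K_def)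
    finally show "gram (\<Union>\<gamma>\<in>C. S \<gamma>) g i j
      = (\<Sum>p\<in>K. of_real (d (fst p) (snd p)) * e (fst p) (snd p) i * cnj (e (fst p) (snd p) j))" .
  qed
  also have "\<dots> = (\<Sum>p\<in>C \<times> I. eta (d (fst p) (snd p)))"
    using fin by (intro sum.mono_neutral_left) (auto simp: K_def)
  also have "\<dots> = (\<Sum>\<gamma>\<in>C. vn_entropy I (gram (S \<gamma>) g))"
    using Q by (simp add: sum.cartesian_product case_prod_beta Q_def)
  finally show ?thesis .
qed

text \<open>With the dependent part kept, the entropy is a sum over its values; without it, it is
  the entropy of the sum of the corresponding operators. Orthogonality makes the two equal.\<close>

lemma dependent_part_entropy_eq_0:
  fixes P :: "('x::finite \<times> 'y::finite) pmf" and \<psi> :: "('x, 'a::finite, 'y, 'b::finite) state"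
  assumes orth: "\<And>s s'. dependent_part P (fst s) \<noteq> dependent_part P (fst s') \<Longrightarrow>
    ip UNIV (\<lambda>q. \<psi> (s, q)) (\<lambda>q. \<psi> (s', q)) = 0"
  shows "dependent_part_entropy P \<psi> = 0"
proof -
  let ?D = "dependent_part P"
  let ?C = "range ?D"
  let ?S = "\<lambda>\<gamma>. {s :: 'x \<times> 'a. ?D (fst s) = \<gamma>}"
  have "qentropy \<psi> (\<lambda>n. ((\<lambda>((x, a), yb). ?D x) n, (\<lambda>((x, a), yb). yb) n)) (\<lambda>((x, a), yb). (x, a))
      = (\<Sum>\<gamma>\<in>?C. vn_entropy UNIV (gram (?S \<gamma>) (\<lambda>s q. \<psi> (s, q))))"
    (is "qentropy _ ?k ?e = _")
  proof (rule qentropy_blocks[where c=fst and h=snd])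
    have "range ?k = ?C \<times> UNIV" by (auto simp: image_iff)
    then show "bij_betw (\<lambda>i. (fst i, snd i)) (range ?k) (?C \<times> UNIV)" by (simp add: bij_betw_def)
    fix i j :: "'y pmf \<times> 'y \<times> 'b" assume "fst i = fst j"
    then show "reduced_state \<psi> ?k ?e i j = gram (?S (fst i)) (\<lambda>s q. \<psi> (s, q)) (snd i) (snd j)"
      unfolding gram_def by (intro reduced_state_eq) (auto simp: inj_on_def image_iff prod_eq_iff split: prod.splits)
  qed (auto split: prod.splits)
  moreover have "qentropy \<psi> (\<lambda>((x, a), yb). yb) (\<lambda>n. ((\<lambda>((x, a), yb). ?D x) n, (\<lambda>((x, a), yb). (x, a)) n))
      = (\<Sum>\<gamma>\<in>{()}. vn_entropy UNIV (gram UNIV (\<lambda>s q. \<psi> (s, q))))"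
    (is "qentropy _ ?k' ?e' = _")
  \<comment> \<open>Nothing on Bob's side is measured, so there is a single block.\<close>
  proof (rule qentropy_blocks[where c="\<lambda>_. ()" and h="\<lambda>i. i"])
    have "range ?k' = UNIV" by (auto simp: image_iff)
    then show "bij_betw (\<lambda>i. ((), i)) (range ?k') ({()} \<times> UNIV)" by (auto simp: bij_betw_def inj_on_def)
    fix i j
    show "reduced_state \<psi> ?k' ?e' i j = gram UNIV (\<lambda>s q. \<psi> (s, q)) i j"
      unfolding gram_def by (intro reduced_state_eq) (auto simp: inj_on_def image_iff prod_eq_iff split: prod.splits)
  qed auto
  moreover have "(\<Union>\<gamma>\<in>?C. ?S \<gamma>) = UNIV" by auto
  then have "vn_entropy UNIV (gram UNIV (\<lambda>s q. \<psi> (s, q))) = (\<Sum>\<gamma>\<in>?C. vn_entropy UNIV (gram (?S \<gamma>) (\<lambda>s q. \<psi> (s, q))))"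
    using vn_entropy_orthogonal_sum[of UNIV ?C ?S "\<lambda>s q. \<psi> (s, q)"] orth by auto
  ultimately show ?thesis by (simp add: dependent_part_entropy_def cond_qentropy_def)
qed

section \<open>A fidelity bound for simulated attacks\<close>

definition output_prob :: "('x::finite, 'a::finite, 'y::finite, 'b::finite) state \<Rightarrow> 'x \<Rightarrow> real" where
  "output_prob \<phi> x = (\<Sum>a\<in>UNIV. \<Sum>q\<in>UNIV. (cmod (\<phi> ((x, a), q)))\<^sup>2)"

lemma output_prob_nonneg: "0 \<le> output_prob \<phi> x"
  by (simp add: output_prob_def sum_nonneg)

lemma norm_sq_honest_measurement:
  fixes \<phi> :: "('x::finite, 'a::finite, 'y::finite, 'b::finite) state"
  shows "norm_sq (apply_fst (honest_measurement (to_nat x)) \<phi>) = output_prob \<phi> x"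
proof -
  have a: "apply_fst (honest_measurement (to_nat x)) \<phi> ((x', a), q) = (if x' = x then \<phi> ((x', a), q) else 0)" for x' a q
  proof -
    have "apply_fst (honest_measurement (to_nat x)) \<phi> ((x', a), q)
      = (\<Sum>p'\<in>UNIV. if p' = (x', a) then (if x' = x then \<phi> ((x', a), q) else 0) else 0)"
      unfolding apply_fst_def honest_measurement_def split by (rule sum.cong) auto
    then show ?thesis by simp
  qed
  have "norm_sq (apply_fst (honest_measurement (to_nat x)) \<phi>)
      = (\<Sum>x'\<in>UNIV. \<Sum>a\<in>UNIV. \<Sum>q\<in>UNIV. (cmod (if x' = x then \<phi> ((x', a), q) else 0))\<^sup>2)"
    unfolding norm_sq_def sum_UNIV_prod[where 'p="'x \<times> 'a"] sum_UNIV_prod[where 'p='x and 'q='a] a ..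
  also have "\<dots> = (\<Sum>x'\<in>UNIV. if x' = x then output_prob \<phi> x else 0)"
    by (intro sum.cong refl) (auto simp: output_prob_def)
  finally show ?thesis by simp
qed

lemma sum_swap3: "(\<Sum>k\<in>A. \<Sum>i\<in>B. \<Sum>j\<in>C. F k i j) = (\<Sum>i\<in>B. \<Sum>j\<in>C. \<Sum>k\<in>A. F k i j)"
proof -
  have "(\<Sum>k\<in>A. \<Sum>i\<in>B. \<Sum>j\<in>C. F k i j) = (\<Sum>i\<in>B. \<Sum>k\<in>A. \<Sum>j\<in>C. F k i j)" by (rule sum.swap)
  also have "\<dots> = (\<Sum>i\<in>B. \<Sum>j\<in>C. \<Sum>k\<in>A. F k i j)" by (intro sum.cong refl sum.swap)
  finally show ?thesis .
qed

text \<open>The completeness relation of the measurement operators. At \<open>p = p'\<close> it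
  conserves output probabilities, at different labels it conserves the overlaps between Bob's states
  for different outputs of Alice.\<close>

lemma measurement_preserves_ip:
  fixes K :: "('q::finite) measurement"
  assumes "is_measurement K"
  shows "(\<Sum>r\<in>outcomes K. ip UNIV (\<lambda>q. apply_snd (K r) \<phi> (p, q)) (\<lambda>q. apply_snd (K r) \<phi> (p', q)))
    = ip UNIV (\<lambda>q. \<phi> (p, q)) (\<lambda>q. \<phi> (p', q))"
proof -
  have "(\<Sum>r\<in>outcomes K. ip UNIV (\<lambda>q. apply_snd (K r) \<phi> (p, q)) (\<lambda>q. apply_snd (K r) \<phi> (p', q)))
      = (\<Sum>r\<in>outcomes K. \<Sum>k\<in>UNIV. \<Sum>i\<in>UNIV. \<Sum>j\<in>UNIV. (cnj (\<phi> (p, i)) * \<phi> (p', j)) * (cnj (K r k i) * K r k j))"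
    by (simp only: ip_def apply_snd_def split cnj_sum complex_cnj_mult sum_product) (simp add: mult_ac)
  also have "\<dots> = (\<Sum>r\<in>outcomes K. \<Sum>i\<in>UNIV. \<Sum>j\<in>UNIV. (cnj (\<phi> (p, i)) * \<phi> (p', j)) * (\<Sum>k\<in>UNIV. cnj (K r k i) * K r k j))"
    unfolding sum_distrib_left by (intro sum.cong refl sum_swap3)
  also have "\<dots> = (\<Sum>i\<in>UNIV. \<Sum>j\<in>UNIV. (cnj (\<phi> (p, i)) * \<phi> (p', j)) * (\<Sum>r\<in>outcomes K. \<Sum>k\<in>UNIV. cnj (K r k i) * K r k j))"
    unfolding sum_distrib_left[of _ _ "outcomes K"] by (rule sum_swap3)
  also have "\<dots> = (\<Sum>i\<in>UNIV. \<Sum>j\<in>UNIV. if j = i then cnj (\<phi> (p, i)) * \<phi> (p', i) else 0)"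
    using assms by (intro sum.cong refl) (auto simp: is_measurement_def)
  also have "\<dots> = ip UNIV (\<lambda>q. \<phi> (p, q)) (\<lambda>q. \<phi> (p', q))" by (simp add: ip_def)
  finally show ?thesis .
qed

lemma measurement_preserves_output_prob:
  fixes \<phi> :: "('x::finite, 'a::finite, 'y::finite, 'b::finite) state"
  assumes "is_measurement K"
  shows "(\<Sum>r\<in>outcomes K. output_prob (apply_snd (K r) \<phi>) x) = output_prob \<phi> x"
proof -
  have o: "complex_of_real (output_prob \<phi> x) = (\<Sum>a\<in>UNIV. ip UNIV (\<lambda>q. \<phi> ((x, a), q)) (\<lambda>q. \<phi> ((x, a), q)))"
    for \<phi> :: "('x, 'a, 'y, 'b) state" unfolding ip_self output_prob_def by simp
  have "complex_of_real (\<Sum>r\<in>outcomes K. output_prob (apply_snd (K r) \<phi>) x) = of_real (output_prob \<phi> x)"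
    unfolding of_real_sum o by (subst sum.swap) (simp add: measurement_preserves_ip[OF assms])
  then show ?thesis by (simp only: of_real_eq_iff)
qed

lemma amgm_weighted:
  fixes L p q c :: real
  assumes "0 < L" "0 \<le> p" "0 \<le> q" "0 \<le> c" "c\<^sup>2 \<le> p * q"
  shows "2 * c \<le> L * p + q / L"
proof -
  have "(2 * c)\<^sup>2 \<le> 4 * ((L * p) * (q / L))" using assms by (simp add: power2_eq_square)
  also have "\<dots> \<le> (L * p + q / L)\<^sup>2"
    using zero_le_power2[of "L * p - q / L"] by (simp add: power2_eq_square algebra_simps)
  finally show ?thesis using assms by (intro power2_le_imp_le[of "2 * c"]) auto
qed

text \<open>The minimizer is \<open>L = sqrt (q / p)\<close>. If \<open>p\<close> or
  \<open>q\<close> is 0, the infimum may only be approached, hence the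
  \<open>\<epsilon>\<close>.\<close>

lemma amgm_attained:
  fixes p q \<epsilon> :: real
  assumes "0 \<le> p" "0 \<le> q" "0 < \<epsilon>"
  shows "\<exists>L>0. L * p + q / L \<le> 2 * sqrt (p * q) + \<epsilon>"
proof -
  consider "p = 0" | "q = 0" | "p > 0" "q > 0" using assms by linarith
  then show ?thesis
  proof cases
    case 1
    have "q / ((q + 1) / \<epsilon>) = \<epsilon> * (q / (q + 1))" by simp
    also have "\<dots> \<le> \<epsilon> * 1" using assms by (intro mult_left_mono) auto
    finally show ?thesis using 1 assms by (intro exI[of _ "(q + 1) / \<epsilon>"]) auto
  next
    case 2
    have "\<epsilon> / (p + 1) * p = \<epsilon> * (p / (p + 1))" by simp
    also have "\<dots> \<le> \<epsilon> * 1" using assms by (intro mult_left_mono) auto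
    finally show ?thesis using 2 assms by (intro exI[of _ "\<epsilon> / (p + 1)"]) auto
  next
    case 3
    have "sqrt (q / p) * p = sqrt (p * q)" "q / sqrt (q / p) = sqrt (p * q)"
      using 3 by (simp_all add: real_sqrt_divide real_sqrt_mult field_simps)
    then show ?thesis using 3 assms by (intro exI[of _ "sqrt (q / p)"]) auto
  qed
qed

definition joint_prob :: "nat \<Rightarrow> (nat \<Rightarrow> ('x::finite, 'a::finite, 'y::finite, 'b::finite) state) \<Rightarrow> 'x list \<Rightarrow> real" where
  "joint_prob m \<phi> xs = (\<Prod>k<m. output_prob (\<phi> k) (xs ! k))"

text \<open>A linear form in the inner products between Bob's states for \<open>x0\<close> and for
  \<open>x1\<close>. Keeping \<open>W\<close> fixed is what makes it additive over measurement
  outcomes; for the optimal contraction \<open>W\<close> its modulus is the fidelity, by Uhlmann's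
  theorem.\<close>

definition overlap :: "('a \<Rightarrow> 'a \<Rightarrow> complex) \<Rightarrow> 'x \<Rightarrow> 'x \<Rightarrow> ('x::finite, 'a::finite, 'y::finite, 'b::finite) state \<Rightarrow> complex" where
  "overlap W x0 x1 \<phi> = (\<Sum>a\<in>UNIV. \<Sum>a'\<in>UNIV. W a a' * ip UNIV (\<lambda>q. \<phi> ((x0, a), q)) (\<lambda>q. \<phi> ((x1, a'), q)))"

text \<open>Which list carries \<open>x0\<close> may change from copy to copy; the mixed pair
  \<open>[x0, x1]\<close>, \<open>[x1, x0]\<close> is the one that separate queries cannot
  exploit.\<close>

definition complementary :: "'x \<Rightarrow> 'x \<Rightarrow> nat \<Rightarrow> 'x list \<Rightarrow> 'x list \<Rightarrow> bool" where
  "complementary x0 x1 m u v \<longleftrightarrow> (\<forall>k<m. {u ! k, v ! k} = {x0, x1})"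

context
  fixes M :: "real \<Rightarrow> ('x::finite \<times> 'a::finite) measurement"
    and N :: "real \<Rightarrow> ('y::finite \<times> 'b::finite) measurement" and m :: nat
  assumes M0: "M 0 = honest_measurement" and N: "\<And>s. s \<in> {0..1} \<Longrightarrow> is_measurement (N s)"
begin

abbreviation "sim \<equiv> simulation_prob M N m"

lemma joint_prob_nonneg: "0 \<le> joint_prob m \<phi> xs"
  unfolding joint_prob_def by (intro prod_nonneg) (simp add: output_prob_nonneg)

lemma prod_upd: "k < m \<Longrightarrow> (\<Prod>j<m. f j ((\<phi>(k := v)) j)) = f k v * (\<Prod>j\<in>{..<m} - {k}. f j (\<phi> j))"
  for f :: "nat \<Rightarrow> 's \<Rightarrow> 'r::comm_semiring_1"
  by (subst prod.remove[of _ k]) (auto intro!: prod.cong)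

lemma joint_prob_query:
  assumes "k < m" "s \<in> {0..1}"
  shows "(\<Sum>r\<in>outcomes (N s). joint_prob m (\<phi>(k := apply_snd (N s r) (\<phi> k))) xs) = joint_prob m \<phi> xs"
proof -
  have "(\<Sum>r\<in>outcomes (N s). joint_prob m (\<phi>(k := apply_snd (N s r) (\<phi> k))) xs)
      = (\<Sum>r\<in>outcomes (N s). output_prob (apply_snd (N s r) (\<phi> k)) (xs ! k)) * (\<Prod>j\<in>{..<m} - {k}. output_prob (\<phi> j) (xs ! j))"
    unfolding joint_prob_def sum_distrib_right
    by (intro sum.cong refl prod_upd[OF assms(1), where f="\<lambda>j \<phi>. output_prob \<phi> (xs ! j)"])
  also have "\<dots> = output_prob (\<phi> k) (xs ! k) * (\<Prod>j\<in>{..<m} - {k}. output_prob (\<phi> j) (xs ! j))"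
    by (simp add: measurement_preserves_output_prob[OF N[OF assms(2)]])
  also have "\<dots> = joint_prob m \<phi> xs"
    unfolding joint_prob_def using assms(1) by (subst (2) prod.remove[of _ k]) auto
  finally show ?thesis .
qed

lemma sim_Output: "sim (Output w) \<phi> xs z = (if w = z then joint_prob m \<phi> xs else 0)"
  by (simp add: M0 norm_sq_honest_measurement joint_prob_def)

lemma sim_nonneg: "0 \<le> sim \<sigma> \<phi> xs z"
proof (induction \<sigma> arbitrary: \<phi>)
  case (Output w)
  show ?case unfolding sim_Output by (simp add: joint_prob_nonneg)
next
  case (Query k s f)
  then show ?case by (auto intro!: sum_nonneg)
next
  case (Randomize p f)
  then show ?case by (auto intro!: integral_nonneg)
qed

text \<open>Outputs from \<open>n\<close> on are missing from the sum, hence only an inequality. The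
  bound also supplies the integrability needed for private randomness.\<close>

lemma sim_sum_le:
  "valid_strategy m \<sigma> \<Longrightarrow> (\<Sum>z<n. sim \<sigma> \<phi> xs z) \<le> joint_prob m \<phi> xs"
proof (induction \<sigma> arbitrary: \<phi> n)
  case (Output w)
  show ?case unfolding sim_Output by (simp add: joint_prob_nonneg)
next
  case (Query k s f)
  have "(\<Sum>z<n. sim (Query k s f) \<phi> xs z)
      = (\<Sum>r\<in>outcomes (N s). \<Sum>z<n. sim (f r) (\<phi>(k := apply_snd (N s r) (\<phi> k))) xs z)"
    unfolding simulation_prob.simps by (rule sum.swap)
  also have "\<dots> \<le> (\<Sum>r\<in>outcomes (N s). joint_prob m (\<phi>(k := apply_snd (N s r) (\<phi> k))) xs)"
    using Query by (intro sum_mono) auto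
  also have "\<dots> = joint_prob m \<phi> xs" using Query.prems by (intro joint_prob_query) auto
  finally show ?case .
next
  case (Randomize p f)
  have IH: "(\<Sum>z<n. sim (f r) \<phi> xs z) \<le> joint_prob m \<phi> xs" for n r using Randomize by simp
  \<comment> \<open>The induction hypothesis holds for every number of outputs; summing up to
    \<open>z\<close> bounds the single value \<open>z\<close>.\<close>
  have one: "sim (f r) \<phi> xs z \<le> joint_prob m \<phi> xs" for r z
  proof -
    have "sim (f r) \<phi> xs z \<le> (\<Sum>z<Suc z. sim (f r) \<phi> xs z)"
      by (rule member_le_sum) (auto simp: sim_nonneg)
    then show ?thesis using IH order_trans by blast
  qed
  have int: "integrable (measure_pmf p) (\<lambda>r. sim (f r) \<phi> xs z)" for z
    by (rule measure_pmf.integrable_const_bound[where B="joint_prob m \<phi> xs"]) (auto simp: one sim_nonneg)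
  have "(\<Sum>z<n. sim (Randomize p f) \<phi> xs z) = measure_pmf.expectation p (\<lambda>r. \<Sum>z<n. sim (f r) \<phi> xs z)"
    unfolding simulation_prob.simps using int by (intro Bochner_Integration.integral_sum[symmetric]) auto
  also have "\<dots> \<le> joint_prob m \<phi> xs"
    using int IH by (intro measure_pmf.integral_le_const) auto
  finally show ?case .
qed

lemma sim_le:
  assumes "valid_strategy m \<sigma>" shows "sim \<sigma> \<phi> xs z \<le> joint_prob m \<phi> xs"
proof -
  have "sim \<sigma> \<phi> xs z \<le> (\<Sum>z<Suc z. sim \<sigma> \<phi> xs z)"
    by (rule member_le_sum) (auto simp: sim_nonneg)
  then show ?thesis using sim_sum_le[OF assms] order_trans by blast
qed

context
  fixes W :: "'a \<Rightarrow> 'a \<Rightarrow> complex" and x0 x1 :: 'x and n :: nat and xs ys :: "nat \<Rightarrow> 'x list" and xa ya :: "'x list"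
  assumes contr: "\<And>\<phi> :: ('x, 'a, 'y, 'b) state.
    (cmod (overlap W x0 x1 \<phi>))\<^sup>2 \<le> output_prob \<phi> x0 * output_prob \<phi> x1"
begin

text \<open>AM-GM with a free weight \<open>L z\<close> replaces the fidelity of the output probabilities by an expression that
  is linear in them, hence is preserved by averaging over private randomness.  The last two
  summands account for outputs \<open>\<ge> n\<close>.\<close>

definition cost :: "(nat \<Rightarrow> real) \<Rightarrow> ('x list \<Rightarrow> nat \<Rightarrow> real) \<Rightarrow> ('x list \<Rightarrow> real) \<Rightarrow> real" where
  "cost L s \<tau> = (\<Sum>z<n. L z * s (xs z) z + s (ys z) z / L z) + (\<tau> xa - (\<Sum>z<n. s xa z)) + (\<tau> ya - (\<Sum>z<n. s ya z))"

lemma overlap_query: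
  assumes "is_measurement K"
  shows "(\<Sum>r\<in>outcomes K. overlap W x0 x1 (apply_snd (K r) \<phi>)) = overlap W x0 x1 \<phi>"
proof -
  have "(\<Sum>r\<in>outcomes K. overlap W x0 x1 (apply_snd (K r) \<phi>)) = (\<Sum>a\<in>UNIV. \<Sum>a'\<in>UNIV. \<Sum>r\<in>outcomes K.
      W a a' * ip UNIV (\<lambda>q. apply_snd (K r) \<phi> ((x0, a), q)) (\<lambda>q. apply_snd (K r) \<phi> ((x1, a'), q)))"
    unfolding overlap_def by (rule sum_swap3)
  also have "\<dots> = overlap W x0 x1 \<phi>"
    unfolding overlap_def sum_distrib_left[symmetric] measurement_preserves_ip[OF assms] ..
  finally show ?thesis .
qed

lemma cost_sum: "cost L (\<lambda>u z. \<Sum>r\<in>R. s r u z) (\<lambda>u. \<Sum>r\<in>R. \<tau> r u) = (\<Sum>r\<in>R. cost L (s r) (\<tau> r))"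
proof -
  have sw: "(\<Sum>r\<in>R. \<Sum>z<n. F r z) = (\<Sum>z<n. \<Sum>r\<in>R. F r z)" for F :: "_ \<Rightarrow> nat \<Rightarrow> real" by (rule sum.swap)
  show ?thesis
    unfolding cost_def sum.distrib sum_subtractf sw
    by (simp add: sum.distrib sum_distrib_left sum_divide_distrib)
qed

text \<open>The bound for one copy is symmetric in \<open>x0\<close> and \<open>x1\<close>, so it
  can be used on each copy regardless of which list holds which value.\<close>

lemma prod_overlap_le:
  fixes \<phi> :: "nat \<Rightarrow> ('x, 'a, 'y, 'b) state"
  assumes "complementary x0 x1 m u v"
  shows "(\<Prod>k<m. cmod (overlap W x0 x1 (\<phi> k)))\<^sup>2 \<le> joint_prob m \<phi> u * joint_prob m \<phi> v"
  unfolding prod_power_distrib joint_prob_def prod.distrib[symmetric]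
proof (rule prod_mono)
  fix k assume "k \<in> {..<m}"
  then have "{u ! k, v ! k} = {x0, x1}" using assms by (simp add: complementary_def)
  then have "output_prob (\<phi> k) (u ! k) * output_prob (\<phi> k) (v ! k) = output_prob (\<phi> k) x0 * output_prob (\<phi> k) x1"
    by (auto simp: doubleton_eq_iff)
  then show "0 \<le> (cmod (overlap W x0 x1 (\<phi> k)))\<^sup>2 \<and>
      (cmod (overlap W x0 x1 (\<phi> k)))\<^sup>2 \<le> output_prob (\<phi> k) (u ! k) * output_prob (\<phi> k) (v ! k)"
    using contr by simp
qed

text \<open>Induction on the strategy: \<open>cost\<close> is additive over query outcomes and
  linear under averaging, while the product of moduli can only grow when summed over outcomes. At an
  output a single weighted pair remains, and AM-GM applies.\<close>

lemma fidelity_bound: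
  assumes L: "\<And>z. z < n \<Longrightarrow> 0 < L z" and pair: "\<And>z. z < n \<Longrightarrow> complementary x0 x1 m (xs z) (ys z)" and pa: "complementary x0 x1 m xa ya"
  shows "valid_strategy m \<sigma> \<Longrightarrow> 2 * (\<Prod>k<m. cmod (overlap W x0 x1 (\<phi> k))) \<le> cost L (sim \<sigma> \<phi>) (joint_prob m \<phi>)"
proof (induction \<sigma> arbitrary: \<phi>)
  case (Output w)
  have c: "0 \<le> (\<Prod>k<m. cmod (overlap W x0 x1 (\<phi> k)))" by (simp add: prod_nonneg)
  show ?case
  proof (cases "w < n")
    case True
    have "cost L (sim (Output w) \<phi>) (joint_prob m \<phi>) = (\<Sum>z<n. if w = z then L w * joint_prob m \<phi> (xs w) + joint_prob m \<phi> (ys w) / L w else 0)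
        + (joint_prob m \<phi> xa - (\<Sum>z<n. if w = z then joint_prob m \<phi> xa else 0)) + (joint_prob m \<phi> ya - (\<Sum>z<n. if w = z then joint_prob m \<phi> ya else 0))"
      unfolding cost_def sim_Output by (intro arg_cong2[where f="(+)"] sum.cong refl) auto
    also have "\<dots> = L w * joint_prob m \<phi> (xs w) + joint_prob m \<phi> (ys w) / L w" using True by simp
    finally show ?thesis
      using amgm_weighted[OF L[OF True] joint_prob_nonneg joint_prob_nonneg c prod_overlap_le[OF pair[OF True]]] by linarith
  next
    \<comment> \<open>An output outside the range is charged through the last two summands of
      \<open>cost\<close>, that is, on the pair \<open>xa\<close>, \<open>ya\<close> with weight
      1.\<close>
    case False
    have "cost L (sim (Output w) \<phi>) (joint_prob m \<phi>) = 1 * joint_prob m \<phi> xa + joint_prob m \<phi> ya / 1"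
      unfolding cost_def sim_Output using False by (simp add: sum.neutral)
    then show ?thesis
      using amgm_weighted[of 1, OF _ joint_prob_nonneg joint_prob_nonneg c prod_overlap_le[OF pa]] by linarith
  qed
next
  case (Query k s f)
  then have k: "k < m" and s: "s \<in> {0..1}" by auto
  let ?\<phi> = "\<lambda>r. \<phi>(k := apply_snd (N s r) (\<phi> k))"
  have "(\<Prod>j<m. cmod (overlap W x0 x1 (\<phi> j))) = cmod (overlap W x0 x1 (\<phi> k)) * (\<Prod>j\<in>{..<m} - {k}. cmod (overlap W x0 x1 (\<phi> j)))"
    using k by (subst prod.remove[of _ k]) auto
  \<comment> \<open>Triangle inequality for the conserved sum of overlaps. It acts on one factor
    only, since a query touches one copy; a joint measurement would not preserve the product of the
    moduli in this way.\<close>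
  also have "\<dots> \<le> (\<Sum>r\<in>outcomes (N s). cmod (overlap W x0 x1 (apply_snd (N s r) (\<phi> k)))) * (\<Prod>j\<in>{..<m} - {k}. cmod (overlap W x0 x1 (\<phi> j)))"
    unfolding overlap_query[OF N[OF s], of "\<phi> k", symmetric] by (intro mult_right_mono norm_sum prod_nonneg) auto
  also have "\<dots> = (\<Sum>r\<in>outcomes (N s). \<Prod>j<m. cmod (overlap W x0 x1 (?\<phi> r j)))"
    unfolding sum_distrib_right
    by (intro sum.cong refl prod_upd[OF k, where f="\<lambda>j \<phi>. cmod (overlap W x0 x1 \<phi>)", symmetric])
  finally have "2 * (\<Prod>j<m. cmod (overlap W x0 x1 (\<phi> j))) \<le> (\<Sum>r\<in>outcomes (N s). 2 * (\<Prod>j<m. cmod (overlap W x0 x1 (?\<phi> r j))))"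
    by (simp add: sum_distrib_left[symmetric])
  also have "\<dots> \<le> (\<Sum>r\<in>outcomes (N s). cost L (sim (f r) (?\<phi> r)) (joint_prob m (?\<phi> r)))"
    using Query.prems by (intro sum_mono Query.IH) auto
  also have "\<dots> = cost L (\<lambda>u z. \<Sum>r\<in>outcomes (N s). sim (f r) (?\<phi> r) u z) (\<lambda>u. \<Sum>r\<in>outcomes (N s). joint_prob m (?\<phi> r) u)"
    by (rule cost_sum[symmetric])
  also have "(\<lambda>u z. \<Sum>r\<in>outcomes (N s). sim (f r) (?\<phi> r) u z) = sim (Query k s f) \<phi>"
    by (intro ext) simp
  also have "(\<lambda>u. \<Sum>r\<in>outcomes (N s). joint_prob m (?\<phi> r) u) = joint_prob m \<phi>"
    by (intro ext joint_prob_query[OF k s])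
  finally show ?case .
next
  case (Randomize p f)
  have int: "integrable (measure_pmf p) (\<lambda>r. sim (f r) \<phi> u z)" for u z
    using Randomize.prems by (intro measure_pmf.integrable_const_bound[where B="joint_prob m \<phi> u"]) (auto simp: sim_le sim_nonneg)
  have int': "integrable (measure_pmf p) (\<lambda>r. cost L (sim (f r) \<phi>) (joint_prob m \<phi>))"
    unfolding cost_def using int by (intro Bochner_Integration.integrable_add Bochner_Integration.integrable_diff
      Bochner_Integration.integrable_sum integrable_mult_right integrable_divide integrable_const) auto
  have "2 * (\<Prod>k<m. cmod (overlap W x0 x1 (\<phi> k))) \<le> measure_pmf.expectation p (\<lambda>r. cost L (sim (f r) \<phi>) (joint_prob m \<phi>))"
    using int' Randomize by (intro measure_pmf.integral_ge_const) auto
  also have "\<dots> = cost L (sim (Randomize p f) \<phi>) (joint_prob m \<phi>)"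
    unfolding cost_def using int by simp
  finally show ?case .
qed

text \<open>The hypotheses \<open>full\<close> remove the charge for outputs outside the range; then
  every weight is chosen nearly optimally for its own outcome.\<close>

lemma simulation_fidelity_bound:
  assumes pair: "\<And>z. z < n \<Longrightarrow> complementary x0 x1 m (xs z) (ys z)" and pa: "complementary x0 x1 m xa ya" and \<sigma>: "valid_strategy m \<sigma>"
    and full: "(\<Sum>z<n. sim \<sigma> \<phi> xa z) = joint_prob m \<phi> xa" "(\<Sum>z<n. sim \<sigma> \<phi> ya z) = joint_prob m \<phi> ya"
  shows "(\<Prod>k<m. cmod (overlap W x0 x1 (\<phi> k))) \<le> (\<Sum>z<n. sqrt (sim \<sigma> \<phi> (xs z) z * sim \<sigma> \<phi> (ys z) z))"
proof (rule field_le_epsilon)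
  fix \<epsilon> :: real assume e: "0 < \<epsilon>"
  let ?p = "\<lambda>z. sim \<sigma> \<phi> (xs z) z" and ?q = "\<lambda>z. sim \<sigma> \<phi> (ys z) z"
  \<comment> \<open>The total error of the \<open>n\<close> outcomes stays below
    \<open>\<epsilon>\<close>; \<open>n + 1\<close> also covers \<open>n = 0\<close>.\<close>
  have "\<forall>z. \<exists>l>0. l * ?p z + ?q z / l \<le> 2 * sqrt (?p z * ?q z) + \<epsilon> / (n + 1)"
    using e by (intro allI amgm_attained sim_nonneg) simp
  from choice[OF this] obtain l where l: "\<And>z. l z > 0" "\<And>z. l z * ?p z + ?q z / l z \<le> 2 * sqrt (?p z * ?q z) + \<epsilon> / (n + 1)"
    by blast
  have "2 * (\<Prod>k<m. cmod (overlap W x0 x1 (\<phi> k))) \<le> cost l (sim \<sigma> \<phi>) (joint_prob m \<phi>)"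
    using l(1) pair pa \<sigma> by (intro fidelity_bound) auto
  also have "\<dots> = (\<Sum>z<n. l z * ?p z + ?q z / l z)" by (simp add: cost_def full)
  also have "\<dots> \<le> (\<Sum>z<n. 2 * sqrt (?p z * ?q z) + \<epsilon> / (n + 1))" by (intro sum_mono l(2))
  also have "\<dots> = 2 * (\<Sum>z<n. sqrt (?p z * ?q z)) + n * (\<epsilon> / (n + 1))"
    by (simp add: sum.distrib sum_distrib_left)
  also have "n * (\<epsilon> / (n + 1)) \<le> \<epsilon>" using e by (simp add: field_simps)
  finally show "(\<Prod>k<m. cmod (overlap W x0 x1 (\<phi> k))) \<le> (\<Sum>z<n. sqrt (?p z * ?q z)) + \<epsilon>" using e by linarith
qed

end

end

section \<open>Principal vectors\<close>

lemma ip_app_gram_polar: "ip I v (app I (gram S g) w) = (\<Sum>s\<in>S. cnj (ip I (g s) v) * ip I (g s) w)"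
proof -
  have "ip I v (app I (gram S g) w) = ip I v (\<lambda>i. \<Sum>s\<in>S. ip I (g s) w * g s i)"
    by (intro ip_cong) (auto simp: app_gram)
  then show ?thesis
    unfolding ip_sum_right ip_scale_right cnj_ip by (simp add: mult.commute)
qed

definition mmult :: "('i::finite) opr \<Rightarrow> 'i opr \<Rightarrow> 'i opr" where
  "mmult A B i j = (\<Sum>l\<in>UNIV. A i l * B l j)"

lemma app_app: "app UNIV A (app UNIV B w) i = app UNIV (mmult A B) w i"
proof -
  have "app UNIV A (app UNIV B w) i = (\<Sum>l\<in>UNIV. \<Sum>j\<in>UNIV. A i l * B l j * w j)"
    by (simp add: app_def sum_distrib_left mult.assoc)
  also have "\<dots> = (\<Sum>j\<in>UNIV. \<Sum>l\<in>UNIV. A i l * B l j * w j)" by (rule sum.swap)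
  finally show ?thesis by (simp add: app_def mmult_def sum_distrib_right)
qed

lemma app_app_cong:
  assumes "\<And>j. c * mmult A B i j = c' * mmult A' B' i j"
  shows "c * app UNIV A (app UNIV B w) i = c' * app UNIV A' (app UNIV B' w) i"
  unfolding app_app by (simp add: app_def sum_distrib_left assms flip: mult.assoc)

text \<open>A singular value decomposition of \<open>T\<close> with left vectors \<open>u\<close>,
  right vectors \<open>v\<close> and singular values \<open>D\<close>, where \<open>u\<close>
  diagonalizes \<open>\<Gamma>0\<close> too. Thus the combinations of the \<open>g0 a\<close> given
  by \<open>u\<close> are mutually orthogonal, with squared norms \<open>lam\<close>. The final
  conclusion is strict Cauchy-Schwarz for the pair at \<open>k0\<close>.\<close>

lemma principal_vectors:
  fixes g0 g1 :: "'a::finite \<Rightarrow> 'y::finite \<times> 'b::finite \<Rightarrow> complex" and p0 p1 :: real and P0 P1 :: "'y \<Rightarrow> real"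
  defines "\<Gamma>0 \<equiv> \<lambda>a a'. ip UNIV (g0 a) (g0 a')" and "\<Gamma>1 \<equiv> \<lambda>a a'. ip UNIV (g1 a) (g1 a')"
    and "T \<equiv> \<lambda>a a'. ip UNIV (g0 a) (g1 a')"
  assumes p: "0 < p0" "0 < p1"
    and comm: "\<And>a a'. of_real p1 * mmult \<Gamma>0 T a a' = of_real p0 * mmult T \<Gamma>1 a a'"
    and Y0: "\<And>a a' y. of_real p0 * (\<Sum>b\<in>UNIV. cnj (g0 a (y, b)) * g0 a' (y, b)) = of_real (P0 y) * \<Gamma>0 a a'"
    and Y1: "\<And>a a' y. of_real p1 * (\<Sum>b\<in>UNIV. cnj (g1 a (y, b)) * g1 a' (y, b)) = of_real (P1 y) * \<Gamma>1 a a'"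
    and ne: "P0 y0 * p1 \<noteq> P1 y0 * p0" and nz: "ip UNIV (g1 c0) (g0 a0) \<noteq> 0"
  obtains u v :: "'a \<Rightarrow> 'a \<Rightarrow> complex" and lam D :: "'a \<Rightarrow> real" and k0 :: 'a and \<kappa> :: real
  where "onb UNIV u"
    and "\<And>k l. ip UNIV (\<lambda>q. \<Sum>a\<in>UNIV. u k a * g0 a q) (\<lambda>q. \<Sum>a\<in>UNIV. u l a * g0 a q) = (if k = l then of_real (lam k) else 0)"
    and "\<And>k. 0 \<le> D k" "\<And>k. D k \<noteq> 0 \<Longrightarrow> lam k > 0" "D k0 > 0" "\<And>k. lam k \<ge> 0"
    and "orthonormal UNIV {k. D k \<noteq> 0} v"
    and "\<And>a k. ip UNIV (g1 a) (\<lambda>q. \<Sum>a\<in>UNIV. u k a * g0 a q) = of_real (D k) * v k a"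
    and "\<And>a. ip UNIV (g1 a) (\<lambda>q. \<Sum>a\<in>UNIV. v k0 a * g1 a q) = of_real \<kappa> * v k0 a"
    and "(D k0)\<^sup>2 < lam k0 * \<kappa>"
proof -
  define S where "S = gram UNIV (\<lambda>c a. T a c)"
  define Td where "Td = (\<lambda>c a. ip UNIV (g1 c) (g0 a))"
  have TT: "cnj (T a c) = Td c a" "cnj (Td c a) = T a c" for a c by (simp_all add: T_def Td_def cnj_ip)
  have S: "S = mmult T Td" by (auto simp: S_def gram_def mmult_def TT fun_eq_iff)
  have h0: "hermitian_on UNIV \<Gamma>0" by (simp add: hermitian_on_def \<Gamma>0_def cnj_ip)
  have h1: "cnj (\<Gamma>1 a a') = \<Gamma>1 a' a" "cnj (\<Gamma>0 a a') = \<Gamma>0 a' a" for a a'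
    by (simp_all add: \<Gamma>1_def \<Gamma>0_def cnj_ip)
  have hS: "hermitian_on UNIV S" unfolding S_def by (rule hermitian_gram)
  \<comment> \<open>The adjoint of the relation \<open>comm\<close>, with \<open>Td\<close> the
    adjoint of \<open>T\<close>.\<close>
  have comm': "of_real p1 * mmult Td \<Gamma>0 a' a = of_real p0 * mmult \<Gamma>1 Td a' a" for a a'
  proof -
    have "cnj (of_real p1 * mmult \<Gamma>0 T a a') = of_real p1 * mmult Td \<Gamma>0 a' a"
      by (simp add: mmult_def TT h1 mult.commute)
    moreover have "cnj (of_real p0 * mmult T \<Gamma>1 a a') = of_real p0 * mmult \<Gamma>1 Td a' a"
      by (simp add: mmult_def TT h1 mult.commute)
    ultimately show ?thesis using comm[of a a'] by simp
  qed
  have app_mult: "of_real p1 * app UNIV \<Gamma>0 (app UNIV T w) a = of_real p0 * app UNIV T (app UNIV \<Gamma>1 w) a" for w a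
    by (rule app_app_cong[OF comm])
  have app_mult': "of_real p1 * app UNIV Td (app UNIV \<Gamma>0 w) a = of_real p0 * app UNIV \<Gamma>1 (app UNIV Td w) a" for w a
    by (rule app_app_cong[OF comm'])
  \<comment> \<open>Moving \<open>\<Gamma>0\<close> through \<open>T\<close> turns it into a
    multiple of \<open>\<Gamma>1\<close>, and moving that through \<open>Td\<close> turns it back;
    the two scalar factors cancel.\<close>
  have cS: "app UNIV \<Gamma>0 (app UNIV S w) a = app UNIV S (app UNIV \<Gamma>0 w) a" for w a
  proof -
    have aS: "app UNIV S w = app UNIV T (app UNIV Td w)" for w unfolding S by (rule ext) (simp add: app_app)
    have "of_real p1 * app UNIV \<Gamma>0 (app UNIV S w) a = of_real p0 * app UNIV T (app UNIV \<Gamma>1 (app UNIV Td w)) a"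
      unfolding aS by (rule app_mult)
    also have "\<dots> = app UNIV T (\<lambda>a. of_real p0 * app UNIV \<Gamma>1 (app UNIV Td w) a) a" by (simp add: app_scale)
    also have "\<dots> = app UNIV T (\<lambda>a. of_real p1 * app UNIV Td (app UNIV \<Gamma>0 w) a) a" unfolding app_mult' ..
    also have "\<dots> = of_real p1 * app UNIV S (app UNIV \<Gamma>0 w) a" unfolding aS by (simp add: app_scale)
    finally show ?thesis using p by simp
  qed
  obtain u lam \<mu> where u: "onb UNIV u"
    and ul: "\<And>k i. app UNIV \<Gamma>0 (u k) i = complex_of_real (lam k) * u k i"
    and um: "\<And>k i. app UNIV S (u k) i = complex_of_real (\<mu> k) * u k i"
    using common_eigenbasis[OF finite_class.finite_UNIV h0 hS cS] by auto
  have uu: "ip UNIV (u k) (u l) = (if k = l then 1 else 0)" for k l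
    using u by (simp add: onb_def orthonormal_def)
  define U where "U k q = (\<Sum>a\<in>UNIV. u k a * g0 a q)" for k q
  define t where "t k c = ip UNIV (g1 c) (U k)" for k c
  have U_alt: "U k = (\<lambda>q. \<Sum>a\<in>UNIV. u k a * g0 a q)" for k by (rule ext) (rule U_def)
  have t_alt: "t k c = ip UNIV (\<lambda>a. T a c) (u k)" for k c
    unfolding t_def U_alt ip_sum_right ip_scale_right ip_def[of UNIV "\<lambda>a. T a c"] TT Td_def by (simp add: mult.commute)
  have t_Td: "t k c = app UNIV Td (u k) c" for k c
    unfolding t_alt ip_def app_def TT ..
  have UU: "ip UNIV (U k) (U l) = (if k = l then of_real (lam k) else 0)" for k l
  proof -
    have "ip UNIV (U k) (U l) = (\<Sum>a\<in>UNIV. cnj (u k a) * app UNIV \<Gamma>0 (u l) a)"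
      unfolding U_alt ip_sum_left ip_sum_right ip_scale_left ip_scale_right app_def \<Gamma>0_def
      by (simp add: sum_distrib_left mult_ac)
    also have "\<dots> = of_real (lam l) * ip UNIV (u k) (u l)"
      unfolding ul ip_def sum_distrib_left by (simp add: mult_ac)
    finally show ?thesis using uu by auto
  qed
  have tt: "ip UNIV (t k) (t l) = (if k = l then of_real (\<mu> k) else 0)" for k l
  proof -
    have "ip UNIV (t k) (t l) = ip UNIV (u k) (app UNIV S (u l))"
      unfolding S_def ip_app_gram_polar ip_def[of UNIV "t k"] t_alt ..
    also have "\<dots> = ip UNIV (u k) (\<lambda>i. of_real (\<mu> l) * u l i)" by (intro ip_cong) (simp_all add: um)
    also have "\<dots> = of_real (\<mu> l) * ip UNIV (u k) (u l)" by (rule ip_scale_right)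
    finally show ?thesis using uu by auto
  qed
  have real_nonneg: "0 \<le> r \<and> (r = 0 \<longrightarrow> (\<forall>i. w i = 0))" if "ip UNIV w w = of_real r" for w :: "'i::finite \<Rightarrow> complex" and r
  proof -
    have r: "r = (\<Sum>i\<in>UNIV. (cmod (w i))\<^sup>2)" using that unfolding ip_self by (simp only: of_real_eq_iff)
    have "r \<ge> 0" unfolding r by (simp add: sum_nonneg)
    moreover have "w i = 0" if "r = 0" for i
      using that unfolding r by (subst (asm) sum_nonneg_eq_0_iff) auto
    ultimately show ?thesis by simp
  qed
  have mu0: "0 \<le> \<mu> k" and mu1: "\<mu> k = 0 \<Longrightarrow> t k c = 0" for k c
    using real_nonneg[of "t k" "\<mu> k"] tt[of k k] by auto
  have lam0: "0 \<le> lam k" and lam1: "lam k = 0 \<Longrightarrow> U k q = 0" for k q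
    using real_nonneg[of "U k" "lam k"] UU[of k k] by (simp_all del: split_paired_All)
  define D where "D k = sqrt (\<mu> k)" for k
  have D2: "D k * D k = \<mu> k" for k using mu0 by (simp add: D_def)
  \<comment> \<open>For \<open>D k = 0\<close> the quotient is 0, consistent with \<open>t k\<close>
    vanishing there; only the other labels form an orthonormal family.\<close>
  define v where "v k c = t k c / of_real (D k)" for k c
  have tv: "t k c = of_real (D k) * v k c" for k c
    using mu1[of k c] D2[of k] by (cases "D k = 0") (auto simp: v_def)
  have Dlam: "lam k > 0" if "D k \<noteq> 0" for k
  proof (rule ccontr)
    assume "\<not> 0 < lam k"
    then have "lam k = 0" using lam0[of k] by simp
    then have "U k q = 0" for q by (rule lam1)
    then have "t k c = 0" for c by (simp add: t_def ip_def)
    then have "ip UNIV (t k) (t k) = 0" by (simp add: ip_def)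
    then show False using tt[of k k] D2[of k] that by auto
  qed
  have vv: "orthonormal UNIV {k. D k \<noteq> 0} v"
    unfolding orthonormal_def
  proof (intro ballI)
    fix k l assume kl: "k \<in> {k. D k \<noteq> 0}" "l \<in> {k. D k \<noteq> 0}"
    have "ip UNIV (v k) (v l) = ip UNIV (\<lambda>c. (1 / of_real (D k)) * t k c) (\<lambda>c. (1 / of_real (D l)) * t l c)"
      by (intro ip_cong) (simp_all add: v_def)
    also have "\<dots> = (1 / of_real (D k)) * (1 / of_real (D l)) * ip UNIV (t k) (t l)"
      unfolding ip_scale_left ip_scale_right by simp
    finally show "ip UNIV (v k) (v l) = (if k = l then 1 else 0)"
      using kl unfolding tt D2[symmetric] by auto
  qed
  \<comment> \<open>Otherwise all \<open>U k\<close> would be orthogonal to every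
    \<open>g1 c\<close>, and so would \<open>g0 a0\<close>, which is a combination of them because
    \<open>u\<close> is unitary.\<close>
  have "\<exists>k0. D k0 > 0"
  proof (rule ccontr)
    assume none: "\<not> (\<exists>k0. D k0 > 0)"
    have "0 \<le> D k" for k by (simp add: D_def mu0)
    then have "D k = 0" for k using none by (metis less_eq_real_def)
    then have t0: "t k c = 0" for k c by (simp add: tv)
    have "g0 a0 q = (\<Sum>k\<in>UNIV. cnj (u k a0) * U k q)" for q
    proof -
      have "(\<Sum>k\<in>UNIV. cnj (u k a0) * U k q) = (\<Sum>k\<in>UNIV. \<Sum>a\<in>UNIV. g0 a q * (u k a * cnj (u k a0)))"
        by (simp add: U_def sum_distrib_left mult_ac)
      also have "\<dots> = (\<Sum>a\<in>UNIV. g0 a q * (\<Sum>k\<in>UNIV. u k a * cnj (u k a0)))"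
        unfolding sum_distrib_left by (rule sum.swap)
      also have "\<dots> = (\<Sum>a\<in>UNIV. if a = a0 then g0 a0 q else 0)"
        using u by (intro sum.cong refl) (auto simp: onb_def)
      finally show ?thesis by simp
    qed
    then have "ip UNIV (g1 c0) (g0 a0) = ip UNIV (g1 c0) (\<lambda>q. \<Sum>k\<in>UNIV. cnj (u k a0) * U k q)"
      by (intro ip_cong) auto
    also have "\<dots> = (\<Sum>k\<in>UNIV. cnj (u k a0) * t k c0)" unfolding ip_sum_right ip_scale_right t_def ..
    finally show False using nz t0 by simp
  qed
  then obtain k0 where k0: "D k0 > 0" by blast
  \<comment> \<open>By \<open>app_mult'\<close> the vector \<open>t k0\<close> is an eigenvector of
    \<open>\<Gamma>1\<close> with this eigenvalue.\<close>
  define \<kappa> where "\<kappa> = p1 * lam k0 / p0"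
  have lam_pos: "lam k0 > 0" using Dlam[of k0] k0 by simp
  have kap: "\<kappa> > 0" using p lam_pos by (simp add: \<kappa>_def)
  define V where "V q = (\<Sum>a\<in>UNIV. v k0 a * g1 a q)" for q
  have V_alt: "V = (\<lambda>q. \<Sum>a\<in>UNIV. v k0 a * g1 a q)" by (rule ext) (rule V_def)
  have G1v: "app UNIV \<Gamma>1 (v k0) a = of_real \<kappa> * v k0 a" for a
  proof -
    have "of_real p0 * app UNIV \<Gamma>1 (t k0) a = of_real p1 * app UNIV Td (app UNIV \<Gamma>0 (u k0)) a"
      unfolding app_mult' t_Td[abs_def] ..
    also have "app UNIV \<Gamma>0 (u k0) = (\<lambda>i. of_real (lam k0) * u k0 i)" by (rule ext) (rule ul)
    also have "of_real p1 * app UNIV Td (\<lambda>i. of_real (lam k0) * u k0 i) a = of_real p1 * of_real (lam k0) * t k0 a"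
      by (simp add: app_scale t_Td)
    finally have "app UNIV \<Gamma>1 (t k0) a = of_real \<kappa> * t k0 a"
      using p by (simp add: \<kappa>_def field_simps)
    moreover have "app UNIV \<Gamma>1 (t k0) a = of_real (D k0) * app UNIV \<Gamma>1 (v k0) a"
      unfolding tv[abs_def] by (rule app_scale)
    ultimately show ?thesis using k0 by (simp add: tv)
  qed
  have g1V: "ip UNIV (g1 a) V = of_real \<kappa> * v k0 a" for a
    unfolding G1v[symmetric] V_alt ip_sum_right ip_scale_right app_def \<Gamma>1_def by (simp add: mult.commute)
  have v1: "ip UNIV (v k0) (v k0) = 1" using vv k0 by (simp add: orthonormal_def)
  have VV: "ip UNIV V V = of_real \<kappa>"
  proof -
    have "ip UNIV V V = (\<Sum>a\<in>UNIV. cnj (v k0 a) * ip UNIV (g1 a) V)"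
      by (subst (1) V_alt) (simp only: ip_sum_left ip_scale_left)
    also have "\<dots> = of_real \<kappa> * ip UNIV (v k0) (v k0)" by (simp only: g1V) (simp add: ip_def sum_distrib_left mult_ac)
    finally show ?thesis using v1 by simp
  qed
  have VU: "ip UNIV V (U k0) = of_real (D k0)"
  proof -
    have "ip UNIV V (U k0) = (\<Sum>a\<in>UNIV. cnj (v k0 a) * t k0 a)"
      by (subst (1) V_alt) (simp only: ip_sum_left ip_scale_left t_def)
    also have "\<dots> = of_real (D k0) * ip UNIV (v k0) (v k0)" by (simp only: tv) (simp add: ip_def sum_distrib_left mult_ac)
    finally show ?thesis using v1 by simp
  qed
  have UV: "ip UNIV (U k0) V = of_real (D k0)" using VU by (metis cnj_ip complex_cnj_complex_of_real)
  have strict: "(D k0)\<^sup>2 < lam k0 * \<kappa>"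
  proof (rule ccontr)
    assume neg: "\<not> (D k0)\<^sup>2 < lam k0 * \<kappa>"
    \<comment> \<open>The part of \<open>U k0\<close> orthogonal to \<open>V\<close>. Without
      strictness its squared norm is not positive, so \<open>U k0\<close> is a multiple of
      \<open>V\<close>.\<close>
    let ?R = "\<lambda>q. U k0 q - of_real (D k0 / \<kappa>) * V q"
    have "ip UNIV ?R ?R = ip UNIV (U k0) (U k0) - of_real (D k0 / \<kappa>) * ip UNIV (U k0) V
        - of_real (D k0 / \<kappa>) * ip UNIV V (U k0) + of_real (D k0 / \<kappa>) * of_real (D k0 / \<kappa>) * ip UNIV V V"
      unfolding ip_def sum_distrib_left sum_subtractf[symmetric] sum.distrib[symmetric]
      by (intro sum.cong refl) (simp add: algebra_simps)
    also have "\<dots> = of_real (lam k0 - (D k0)\<^sup>2 / \<kappa>)"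
      unfolding UU VV VU UV using kap by (simp add: power2_eq_square)
    finally have R: "ip UNIV ?R ?R = of_real (lam k0 - (D k0)\<^sup>2 / \<kappa>)" .
    have "lam k0 - (D k0)\<^sup>2 / \<kappa> \<le> 0" using neg kap by (simp add: field_simps)
    then have eq: "lam k0 = (D k0)\<^sup>2 / \<kappa>" and "U k0 q = of_real (D k0 / \<kappa>) * V q" for q
      using real_nonneg[OF R] by (simp_all del: split_paired_All)
    then have UVq: "U k0 = (\<lambda>q. of_real (D k0 / \<kappa>) * V q)" by auto
    \<comment> \<open>Since the state of Alice's working register given \<open>x\<close> and
      \<open>y\<close> does not depend on \<open>y\<close>, every combination of the vectors for
      \<open>x\<close> has the same \<open>Y\<close>-distribution as \<open>x\<close>. Parallel
      vectors would therefore contradict \<open>ne\<close>.\<close>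
    have dist: "of_real p * (\<Sum>b\<in>UNIV. cnj (F (y, b)) * F (y, b)) = of_real (Py y) * ip UNIV F F"
      if F: "F = (\<lambda>q. \<Sum>a\<in>UNIV. w a * g a q)"
        and Y: "\<And>a a'. of_real p * (\<Sum>b\<in>UNIV. cnj (g a (y, b)) * g a' (y, b)) = of_real (Py y) * ip UNIV (g a) (g a')"
      for F w g p Py y
    proof -
      have FF: "cnj (F q) * F q = (\<Sum>a\<in>UNIV. \<Sum>a'\<in>UNIV. cnj (w a) * w a' * (cnj (g a q) * g a' q))" for q
        unfolding F cnj_sum complex_cnj_mult sum_product by (simp add: mult_ac)
      have "of_real p * (\<Sum>b\<in>UNIV. cnj (F (y, b)) * F (y, b))
          = (\<Sum>b\<in>UNIV. \<Sum>a\<in>UNIV. \<Sum>a'\<in>UNIV. cnj (w a) * w a' * (of_real p * (cnj (g a (y, b)) * g a' (y, b))))"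
        by (simp only: FF sum_distrib_left) (simp add: mult_ac)
      also have "\<dots> = (\<Sum>a\<in>UNIV. \<Sum>a'\<in>UNIV. cnj (w a) * w a' * (of_real p * (\<Sum>b\<in>UNIV. cnj (g a (y, b)) * g a' (y, b))))"
        unfolding sum_distrib_left by (rule sum_swap3)
      also have "\<dots> = of_real (Py y) * ip UNIV F F"
        unfolding Y F ip_sum_left ip_sum_right ip_scale_left ip_scale_right
        by (simp add: sum_distrib_left mult_ac)
      finally show ?thesis .
    qed
    have 1: "of_real p0 * (\<Sum>b\<in>UNIV. cnj (U k0 (y0, b)) * U k0 (y0, b)) = of_real (P0 y0) * of_real (lam k0)"
    proof -
      have "of_real p0 * (\<Sum>b\<in>UNIV. cnj (U k0 (y0, b)) * U k0 (y0, b)) = of_real (P0 y0) * ip UNIV (U k0) (U k0)"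
        by (rule dist, rule U_alt, rule Y0[unfolded \<Gamma>0_def])
      then show ?thesis using UU by simp
    qed
    have 2: "of_real p1 * (\<Sum>b\<in>UNIV. cnj (V (y0, b)) * V (y0, b)) = of_real (P1 y0) * of_real \<kappa>"
    proof -
      have "of_real p1 * (\<Sum>b\<in>UNIV. cnj (V (y0, b)) * V (y0, b)) = of_real (P1 y0) * ip UNIV V V"
        by (rule dist, rule V_alt, rule Y1[unfolded \<Gamma>1_def])
      then show ?thesis using VV by simp
    qed
    have "(\<Sum>b\<in>UNIV. cnj (U k0 (y0, b)) * U k0 (y0, b)) = of_real (D k0 / \<kappa>) * of_real (D k0 / \<kappa>) * (\<Sum>b\<in>UNIV. cnj (V (y0, b)) * V (y0, b))"
      unfolding UVq sum_distrib_left by (simp add: mult_ac)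
    then have "of_real p1 * (of_real (P0 y0) * of_real (lam k0)) =
        of_real p0 * (of_real (D k0 / \<kappa>) * of_real (D k0 / \<kappa>)) * (of_real p1 * (\<Sum>b\<in>UNIV. cnj (V (y0, b)) * V (y0, b)))"
      unfolding 1[symmetric] by (simp add: mult_ac)
    then have "complex_of_real (p1 * (P0 y0 * lam k0)) = of_real (p0 * (D k0 / \<kappa> * (D k0 / \<kappa>)) * (P1 y0 * \<kappa>))"
      unfolding 2 by simp
    then have "p1 * (P0 y0 * lam k0) = p0 * (D k0 / \<kappa> * (D k0 / \<kappa>)) * (P1 y0 * \<kappa>)" by (simp only: of_real_eq_iff)
    also have "\<dots> = p0 * P1 y0 * lam k0" unfolding eq using kap by (simp add: power2_eq_square)
    finally show False using lam_pos ne by (simp add: mult_ac)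
  qed
  show ?thesis
    by (rule that[of u lam D k0 v \<kappa>])
      (use u UU D_def mu0 Dlam k0 lam0 vv tv g1V strict in \<open>auto simp: U_alt[symmetric] V_alt[symmetric] t_def[symmetric]\<close>)
qed

section \<open>The entangled attack\<close>

lemma sum_copies_2: "(\<Sum>l\<in>copies 2. F l) = (\<Sum>x\<in>UNIV. \<Sum>y\<in>UNIV. F [x, y])"
  for F :: "'q::finite list \<Rightarrow> 'z::comm_monoid_add"
proof -
  have "bij_betw (\<lambda>p :: 'q \<times> 'q. [fst p, snd p]) UNIV (copies 2)"
  proof (rule bij_betwI[of _ _ _ "\<lambda>l. (l ! 0, l ! 1)"])
    show "(\<lambda>p. [fst p, snd p]) \<in> UNIV \<rightarrow> copies 2" by (auto simp: copies_def)
    fix l :: "'q list" assume "l \<in> copies 2"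
    then obtain a b where "l = [a, b]" by (auto simp: copies_def length_Suc_conv numeral_2_eq_2)
    then show "[fst (l ! 0, l ! 1), snd (l ! 0, l ! 1)] = l" by simp
  qed auto
  from sum.reindex_bij_betw[OF this, of F] show ?thesis
    by (simp add: sum_UNIV_prod)
qed

lemma finite_copies_2: "finite (copies 2 :: 'q::finite list set)"
  using finite_lists_length_eq[of "UNIV :: 'q set" 2] by (simp add: copies_def)

definition tensor2 :: "('q \<Rightarrow> complex) \<Rightarrow> ('q \<Rightarrow> complex) \<Rightarrow> 'q list \<Rightarrow> complex" where
  "tensor2 f g l = f (l ! 0) * g (l ! 1)"

lemma ip_tensor2: "ip (copies 2) (tensor2 f g) (tensor2 f' g') = ip UNIV f f' * ip UNIV g g'"
  for f :: "'q::finite \<Rightarrow> complex"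
  by (simp add: ip_def sum_copies_2 tensor2_def sum_product mult_ac)

text \<open>Alice's working registers are traced out, so expectation values in the product vectors
  are added up over \<open>a\<close> and \<open>a'\<close>.\<close>

lemma attack_prob_2:
  fixes \<psi> :: "('x::finite, 'a::finite, 'y::finite, 'b::finite) state"
  shows "attack_prob \<psi> 2 E [x, x'] z = (\<Sum>a\<in>UNIV. \<Sum>a'\<in>UNIV.
    Re (ip (copies 2) (tensor2 (\<lambda>q. \<psi> ((x, a), q)) (\<lambda>q. \<psi> ((x', a'), q)))
      (app (copies 2) (E z) (tensor2 (\<lambda>q. \<psi> ((x, a), q)) (\<lambda>q. \<psi> ((x', a'), q))))))"
proof -
  let ?F = "\<lambda>ps. \<Sum>qs\<in>copies 2. \<Sum>qs'\<in>copies 2. cnj (tensor_power 2 \<psi> ps qs) * E z qs qs' * tensor_power 2 \<psi> ps qs'"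
  let ?T = "\<lambda>a a'. tensor2 (\<lambda>q. \<psi> ((x, a), q)) (\<lambda>q. \<psi> ((x', a'), q))"
  have bij: "bij_betw (\<lambda>p :: 'a \<times> 'a. [(x, fst p), (x', snd p)]) UNIV {ps. ps \<in> copies 2 \<and> map fst ps = [x, x']}"
    by (rule bij_betwI[of _ _ _ "\<lambda>l. (snd (l ! 0), snd (l ! 1))"]) (auto simp: copies_def)
  have "attack_prob \<psi> 2 E [x, x'] z = Re (\<Sum>p\<in>UNIV. ?F [(x, fst p), (x', snd p)])"
    unfolding attack_prob_def using sum.reindex_bij_betw[OF bij, of ?F] by simp
  also have "\<dots> = (\<Sum>a\<in>UNIV. \<Sum>a'\<in>UNIV. Re (?F [(x, a), (x', a')]))"
    by (simp add: sum_UNIV_prod)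
  finally have F: "attack_prob \<psi> 2 E [x, x'] z = (\<Sum>a\<in>UNIV. \<Sum>a'\<in>UNIV. Re (?F [(x, a), (x', a')]))" .
  have T: "tensor_power 2 \<psi> [(x, a), (x', a')] = ?T a a'" for a a'
    by (simp add: fun_eq_iff tensor_power_def tensor2_def numeral_2_eq_2)
  have Q: "(\<Sum>qs\<in>copies 2. \<Sum>qs'\<in>copies 2. cnj (?T a a' qs) * E z qs qs' * ?T a a' qs')
      = ip (copies 2) (?T a a') (app (copies 2) (E z) (?T a a'))" for a a'
    by (simp add: ip_def app_def sum_distrib_left mult.assoc)
  show ?thesis unfolding F T Q ..
qed

lemma sum_norm_tensor2:
  fixes \<psi> :: "('x::finite, 'a::finite, 'y::finite, 'b::finite) state"
  shows "(\<Sum>a\<in>UNIV. \<Sum>a'\<in>UNIV. Re (ip (copies 2) (tensor2 (\<lambda>q. \<psi> ((x, a), q)) (\<lambda>q. \<psi> ((x', a'), q)))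
      (tensor2 (\<lambda>q. \<psi> ((x, a), q)) (\<lambda>q. \<psi> ((x', a'), q))))) = joint_prob 2 (\<lambda>_. \<psi>) [x, x']"
proof -
  have "joint_prob 2 (\<lambda>_. \<psi>) [x, x'] = output_prob \<psi> x * output_prob \<psi> x'"
    by (simp add: joint_prob_def numeral_2_eq_2)
  also have "\<dots> = (\<Sum>a\<in>UNIV. \<Sum>a'\<in>UNIV. (\<Sum>q\<in>UNIV. (cmod (\<psi> ((x, a), q)))\<^sup>2) * (\<Sum>q\<in>UNIV. (cmod (\<psi> ((x', a'), q)))\<^sup>2))"
    unfolding output_prob_def by (rule sum_product)
  finally show ?thesis by (simp only: ip_tensor2) (simp add: ip_self)
qed

text \<open>The attack measures the projectors on the vectors \<open>e j\<close> and, as a last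
  outcome, the rest of the space. By \<open>full\<close> the rest never occurs for
  \<open>xa\<close>, so judged on \<open>xa\<close>, \<open>ya\<close> it contributes
  nothing.\<close>

lemma orthonormal_attack_bound:
  fixes \<psi> :: "('x::finite, 'a::finite, 'y::finite, 'b::finite) state"
    and M :: "real \<Rightarrow> ('x \<times> 'a) measurement" and N :: "real \<Rightarrow> ('y \<times> 'b) measurement"
    and e :: "'j \<Rightarrow> ('y \<times> 'b) list \<Rightarrow> complex"
  assumes ID: "ideal_functionality M N" and sim: "attacks_simulated M N \<psi> 2"
    and J: "finite J" and e: "orthonormal (copies 2) J e"
  defines "p \<equiv> \<lambda>u j. \<Sum>a\<in>UNIV. \<Sum>a'\<in>UNIV.
      (cmod (ip (copies 2) (e j) (tensor2 (\<lambda>q. \<psi> ((u ! 0, a), q)) (\<lambda>q. \<psi> ((u ! 1, a'), q)))))\<^sup>2"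
  assumes contr: "\<And>\<phi> :: ('x, 'a, 'y, 'b) state.
      (cmod (overlap W x0 x1 \<phi>))\<^sup>2 \<le> output_prob \<phi> x0 * output_prob \<phi> x1"
    and pair: "\<And>j. j \<in> J \<Longrightarrow> complementary x0 x1 2 (xs j) (ys j)" "complementary x0 x1 2 xa ya"
    and len: "\<And>j. j \<in> J \<Longrightarrow> xs j \<in> copies 2" "\<And>j. j \<in> J \<Longrightarrow> ys j \<in> copies 2" "xa \<in> copies 2" "ya \<in> copies 2"
    and full: "(\<Sum>j\<in>J. p xa j) = joint_prob 2 (\<lambda>_. \<psi>) xa"
  shows "(cmod (overlap W x0 x1 \<psi>))\<^sup>2 \<le> (\<Sum>j\<in>J. sqrt (p (xs j) j * p (ys j) j))"
proof -
  let ?C = "copies 2 :: ('y \<times> 'b) list set"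
  define c where "c = card J"
  obtain h where h: "bij_betw h {..<c} J"
    using ex_bij_betw_nat_finite[OF J] unfolding c_def atLeast0LessThan by blast
  have hJ: "h z \<in> J" if "z < c" for z using h that by (auto simp: bij_betw_def)
  \<comment> \<open>The index \<open>c\<close> stands for the complementary projector; its
    positivity is Bessel's inequality.\<close>
  define E where "E z i j = (if z < c then gram {h z} e i j else (if i = j then 1 else 0) - gram J e i j)" for z i j
  have finC: "finite ?C" by (rule finite_copies_2)
  have appE: "app ?C (E z) v i = (if z < c then app ?C (gram {h z} e) v i else v i - app ?C (gram J e) v i)"
    if "i \<in> ?C" for z v i
  proof (cases "z < c")
    case False
    have "app ?C (E z) v i = (\<Sum>j\<in>?C. (if j = i then v i else 0) - gram J e i j * v j)"
      unfolding app_def E_def using False by (intro sum.cong refl) (auto simp: left_diff_distrib)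
    then show ?thesis using False that finC by (simp add: app_def sum_subtractf)
  qed (simp add: app_def E_def)
  have quad: "ip ?C v (app ?C (E z) v) = of_real (if z < c then (cmod (ip ?C (e (h z)) v))\<^sup>2
      else (\<Sum>i\<in>?C. (cmod (v i))\<^sup>2) - (\<Sum>j\<in>J. (cmod (ip ?C (e j) v))\<^sup>2))" for z v
  proof (cases "z < c")
    case True
    have "ip ?C v (app ?C (E z) v) = ip ?C v (app ?C (gram {h z} e) v)"
      using True by (intro ip_cong) (auto simp: appE)
    then show ?thesis using True by (simp add: ip_app_gram)
  next
    case False
    have "ip ?C v (app ?C (E z) v) = ip ?C v (\<lambda>i. v i - app ?C (gram J e) v i)"
      using False by (intro ip_cong) (auto simp: appE)
    then show ?thesis using False by (simp add: ip_diff_right ip_app_gram ip_self)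
  qed
  have povm: "is_povm ?C (Suc c) E"
    unfolding is_povm_def
  proof (intro conjI allI impI ballI)
    fix z assume "z < Suc c"
    show "positive_on ?C (E z)"
      unfolding positive_on_def
    proof
      fix v :: "('y \<times> 'b) list \<Rightarrow> complex"
      have "(\<Sum>i\<in>?C. \<Sum>j\<in>?C. cnj (v i) * E z i j * v j) = ip ?C v (app ?C (E z) v)"
        by (simp add: ip_def app_def sum_distrib_left mult.assoc)
      then show "(\<Sum>i\<in>?C. \<Sum>j\<in>?C. cnj (v i) * E z i j * v j) \<in> \<real>\<^sub>\<ge>\<^sub>0"
        unfolding quad using bessel_inequality[OF J e, of v] by simp
    qed
  next
    fix i j
    have "(\<Sum>z<c. gram {h z} e i j) = gram J e i j"
      unfolding gram_def using sum.reindex_bij_betw[OF h, of "\<lambda>s. e s i * cnj (e s j)"] by simp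
    moreover have "(\<Sum>z<c. E z i j) = (\<Sum>z<c. gram {h z} e i j)" by (simp add: E_def)
    ultimately show "(\<Sum>z<Suc c. E z i j) = (if i = j then 1 else 0)" by (simp add: E_def)
  qed
  obtain \<sigma> where \<sigma>: "valid_strategy 2 \<sigma>"
    and s: "\<And>u z. u \<in> copies 2 \<Longrightarrow> z < Suc c \<Longrightarrow> simulation_prob M N 2 \<sigma> (\<lambda>k. \<psi>) u z = attack_prob \<psi> 2 E u z"
    using sim povm unfolding attacks_simulated_def by blast
  have M0: "M 0 = honest_measurement" and N: "\<And>s. s \<in> {0..1} \<Longrightarrow> is_measurement (N s)"
    using ID by (auto simp: ideal_functionality_def)
  have cop: "\<exists>x x'. u = [x, x']" if "u \<in> copies 2" for u :: "'x list"
    using that by (auto simp: copies_def length_Suc_conv numeral_2_eq_2)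
  have cmod_sym: "cmod (ip ?C v w) = cmod (ip ?C w v)" for v w by (metis cnj_ip complex_mod_cnj)
  have ap: "attack_prob \<psi> 2 E u z = (if z < c then p u (h z) else joint_prob 2 (\<lambda>_. \<psi>) u - (\<Sum>j\<in>J. p u j))"
    if u: "u \<in> copies 2" for u z
  proof -
    obtain x x' where u: "u = [x, x']" using cop[OF u] by blast
    show ?thesis
    proof (cases "z < c")
      case True
      then show ?thesis unfolding u attack_prob_2 quad p_def by simp
    next
      case False
      have "(\<Sum>j\<in>J. p u j) = (\<Sum>a\<in>UNIV. \<Sum>a'\<in>UNIV. \<Sum>j\<in>J.
          (cmod (ip ?C (e j) (tensor2 (\<lambda>q. \<psi> ((x, a), q)) (\<lambda>q. \<psi> ((x', a'), q)))))\<^sup>2)"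
        unfolding p_def u by (subst sum_swap3) simp
      moreover have "attack_prob \<psi> 2 E u z = (\<Sum>a\<in>UNIV. \<Sum>a'\<in>UNIV. Re (ip ?C (tensor2 (\<lambda>q. \<psi> ((x, a), q)) (\<lambda>q. \<psi> ((x', a'), q)))
          (tensor2 (\<lambda>q. \<psi> ((x, a), q)) (\<lambda>q. \<psi> ((x', a'), q))))
          - (\<Sum>j\<in>J. (cmod (ip ?C (e j) (tensor2 (\<lambda>q. \<psi> ((x, a), q)) (\<lambda>q. \<psi> ((x', a'), q)))))\<^sup>2))"
        unfolding u attack_prob_2 quad using False by (simp add: ip_self)
      ultimately show ?thesis using False unfolding sum_subtractf u sum_norm_tensor2 by simp
    qed
  qed
  have p0: "0 \<le> p u j" for u j by (simp add: p_def sum_nonneg)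
  have tot: "(\<Sum>z<Suc c. attack_prob \<psi> 2 E u z) = joint_prob 2 (\<lambda>_. \<psi>) u" if "u \<in> copies 2" for u
    using sum.reindex_bij_betw[OF h, of "p u"] ap[OF that] by simp
  define xs' where "xs' z = (if z < c then xs (h z) else xa)" for z
  define ys' where "ys' z = (if z < c then ys (h z) else ya)" for z
  have cop': "xs' z \<in> copies 2" "ys' z \<in> copies 2" for z using len hJ by (auto simp: xs'_def ys'_def)
  have "(cmod (overlap W x0 x1 \<psi>))\<^sup>2 = (\<Prod>k<(2::nat). cmod (overlap W x0 x1 ((\<lambda>k. \<psi>) k)))" by simp
  also have "\<dots> \<le> (\<Sum>z<Suc c. sqrt (simulation_prob M N 2 \<sigma> (\<lambda>k. \<psi>) (xs' z) z * simulation_prob M N 2 \<sigma> (\<lambda>k. \<psi>) (ys' z) z))"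
  proof (rule simulation_fidelity_bound[where W=W and ?x0.0=x0 and ?x1.0=x1 and xa=xa and ya=ya])
    show "complementary x0 x1 2 (xs' z) (ys' z)" for z using pair hJ by (auto simp: xs'_def ys'_def)
    show "(\<Sum>z<Suc c. simulation_prob M N 2 \<sigma> (\<lambda>k. \<psi>) xa z) = joint_prob 2 (\<lambda>k. \<psi>) xa"
      using tot[OF len(3)] s[OF len(3)] by simp
    show "(\<Sum>z<Suc c. simulation_prob M N 2 \<sigma> (\<lambda>k. \<psi>) ya z) = joint_prob 2 (\<lambda>k. \<psi>) ya"
      using tot[OF len(4)] s[OF len(4)] by simp
  qed (fact M0 N contr pair(2) \<sigma>)+
  also have "\<dots> = (\<Sum>z<Suc c. sqrt (attack_prob \<psi> 2 E (xs' z) z * attack_prob \<psi> 2 E (ys' z) z))"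
    using s[OF cop'(1)] s[OF cop'(2)] by (intro sum.cong refl) auto
  also have "\<dots> = (\<Sum>z<c. sqrt (p (xs (h z)) (h z) * p (ys (h z)) (h z)))"
    using full ap[OF cop'(1)] ap[OF cop'(2)] by (simp add: xs'_def ys'_def)
  also have "\<dots> = (\<Sum>j\<in>J. sqrt (p (xs j) j * p (ys j) j))"
    by (rule sum.reindex_bij_betw[OF h])
  finally show ?thesis .
qed

lemma orthonormal_rotation:
  fixes \<alpha> \<beta> :: real
  assumes b: "orthonormal C J b" and ij: "i \<in> J" "j \<in> J" "i \<noteq> j" and ab: "\<alpha>\<^sup>2 + \<beta>\<^sup>2 = 1"
  shows "orthonormal C J (b(i := (\<lambda>l. of_real \<alpha> * b i l + of_real \<beta> * b j l),
    j := (\<lambda>l. of_real \<alpha> * b j l - of_real \<beta> * b i l)))"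
proof -
  have bb: "ip C (b k) (b l) = (if k = l then 1 else 0)" if "k \<in> J" "l \<in> J" for k l
    using b that by (simp add: orthonormal_def)
  have ab': "complex_of_real \<alpha> * of_real \<alpha> + of_real \<beta> * of_real \<beta> = 1"
    using ab by (metis of_real_1 of_real_add of_real_mult power2_eq_square)
  have left: "ip C (\<lambda>l. of_real r * f l + of_real s * g l) h = of_real r * ip C f h + of_real s * ip C g h"
    "ip C (\<lambda>l. of_real r * f l - of_real s * g l) h = of_real r * ip C f h - of_real s * ip C g h" for r s f g h
    by (simp_all add: ip_def algebra_simps sum.distrib sum_subtractf sum_distrib_left)
  show ?thesis
    unfolding orthonormal_def
    using ij ab' by (auto simp: left ip_add_right ip_diff_right ip_scale_right bb algebra_simps)
qed

lemma pmf_dependent_part: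
  fixes P :: "('x::finite \<times> 'y::finite) pmf"
  assumes "(\<Sum>y\<in>UNIV. pmf P (x, y)) > 0"
  shows "pmf (dependent_part P x) y = pmf P (x, y) / (\<Sum>y\<in>UNIV. pmf P (x, y))"
proof -
  let ?s = "{p :: 'x \<times> 'y. fst p = x}"
  have s: "?s = Pair x ` UNIV" by force
  have m: "measure (measure_pmf P) ?s = (\<Sum>y\<in>UNIV. pmf P (x, y))"
    unfolding s by (simp add: measure_measure_pmf_finite sum.reindex inj_on_def)
  have ne: "set_pmf P \<inter> ?s \<noteq> {}"
  proof
    assume "set_pmf P \<inter> ?s = {}"
    then have "pmf P (x, y) = 0" for y by (auto simp: set_pmf_iff)
    then show False using assms by simp
  qed
  have "pmf (dependent_part P x) y = measure (measure_pmf (cond_pmf P ?s)) (snd -` {y})"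
    by (simp add: dependent_part_def pmf_map)
  also have "\<dots> = (\<Sum>p\<in>snd -` {y}. pmf (cond_pmf P ?s) p)"
    by (rule measure_measure_pmf_finite) simp
  also have "\<dots> = (\<Sum>p\<in>{(x, y)}. pmf (cond_pmf P ?s) p)"
    using ne by (intro sum.mono_neutral_right) (auto simp: pmf_cond)
  also have "\<dots> = pmf P (x, y) / (\<Sum>y\<in>UNIV. pmf P (x, y))"
    using ne by (simp add: pmf_cond m)
  finally show ?thesis .
qed

section \<open>The overlap is a contraction\<close>

lemma cauchy_schwarz_sum:
  fixes f g :: "'i \<Rightarrow> complex"
  shows "(cmod (\<Sum>i\<in>I. cnj (f i) * g i))\<^sup>2 \<le> (\<Sum>i\<in>I. (cmod (f i))\<^sup>2) * (\<Sum>i\<in>I. (cmod (g i))\<^sup>2)"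
proof -
  have "cmod (\<Sum>i\<in>I. cnj (f i) * g i) \<le> (\<Sum>i\<in>I. cmod (f i) * cmod (g i))"
    by (rule order_trans[OF norm_sum]) (simp add: norm_mult)
  then have "(cmod (\<Sum>i\<in>I. cnj (f i) * g i))\<^sup>2 \<le> (\<Sum>i\<in>I. cmod (f i) * cmod (g i))\<^sup>2"
    by (intro power_mono) auto
  also have "\<dots> \<le> (\<Sum>i\<in>I. (cmod (f i))\<^sup>2) * (\<Sum>i\<in>I. (cmod (g i))\<^sup>2)"
    by (rule Cauchy_Schwarz_ineq_sum)
  finally show ?thesis .
qed

text \<open>Bessel's inequality in Alice's working space, for each \<open>q\<close> separately. The
  conjugate family enters because the combination is linear, not antilinear, in
  \<open>u k\<close>.\<close>

lemma orthonormal_combination_le: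
  fixes \<phi> :: "('x::finite, 'a::finite, 'y::finite, 'b::finite) state"
  assumes u: "orthonormal UNIV K u" and K: "finite K"
  shows "(\<Sum>k\<in>K. \<Sum>q\<in>UNIV. (cmod (\<Sum>a\<in>UNIV. u k a * \<phi> ((x, a), q)))\<^sup>2) \<le> output_prob \<phi> x"
proof -
  have ou: "orthonormal UNIV K (\<lambda>k a. cnj (u k a))"
    unfolding orthonormal_def
  proof (intro ballI)
    fix k l assume kl: "k \<in> K" "l \<in> K"
    have "ip UNIV (\<lambda>a. cnj (u k a)) (\<lambda>a. cnj (u l a)) = ip UNIV (u l) (u k)" by (simp add: ip_def mult.commute)
    then show "ip UNIV (\<lambda>a. cnj (u k a)) (\<lambda>a. cnj (u l a)) = (if k = l then 1 else 0)"
      using u kl by (auto simp: orthonormal_def)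
  qed
  have "(\<Sum>k\<in>K. \<Sum>q\<in>UNIV. (cmod (\<Sum>a\<in>UNIV. u k a * \<phi> ((x, a), q)))\<^sup>2)
      = (\<Sum>q\<in>UNIV. \<Sum>k\<in>K. (cmod (ip UNIV (\<lambda>a. cnj (u k a)) (\<lambda>a. \<phi> ((x, a), q))))\<^sup>2)"
    by (subst sum.swap) (simp add: ip_def)
  also have "\<dots> \<le> (\<Sum>q\<in>UNIV. \<Sum>a\<in>UNIV. (cmod (\<phi> ((x, a), q)))\<^sup>2)"
    by (intro sum_mono bessel_inequality[OF K ou])
  also have "\<dots> = output_prob \<phi> x" unfolding output_prob_def by (rule sum.swap)
  finally show ?thesis .
qed

lemma overlap_eq:
  fixes \<phi> :: "('x::finite, 'a::finite, 'y::finite, 'b::finite) state"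
  shows "overlap (\<lambda>a a'. \<Sum>k\<in>K. cnj (u k a) * v k a') x0 x1 \<phi>
    = (\<Sum>k\<in>K. ip UNIV (\<lambda>q. \<Sum>a\<in>UNIV. u k a * \<phi> ((x0, a), q)) (\<lambda>q. \<Sum>a\<in>UNIV. v k a * \<phi> ((x1, a), q)))"
proof -
  have "overlap (\<lambda>a a'. \<Sum>k\<in>K. cnj (u k a) * v k a') x0 x1 \<phi>
      = (\<Sum>a\<in>UNIV. \<Sum>a'\<in>UNIV. \<Sum>k\<in>K. cnj (u k a) * (v k a' * ip UNIV (\<lambda>q. \<phi> ((x0, a), q)) (\<lambda>q. \<phi> ((x1, a'), q))))"
    by (simp add: overlap_def sum_distrib_right mult.assoc)
  also have "\<dots> = (\<Sum>k\<in>K. \<Sum>a\<in>UNIV. \<Sum>a'\<in>UNIV. cnj (u k a) * (v k a' * ip UNIV (\<lambda>q. \<phi> ((x0, a), q)) (\<lambda>q. \<phi> ((x1, a'), q))))"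
    by (rule sum_swap3[symmetric])
  also have "\<dots> = (\<Sum>k\<in>K. ip UNIV (\<lambda>q. \<Sum>a\<in>UNIV. u k a * \<phi> ((x0, a), q)) (\<lambda>q. \<Sum>a\<in>UNIV. v k a * \<phi> ((x1, a), q)))"
    unfolding ip_sum_left ip_scale_left unfolding ip_sum_right ip_scale_right by (simp add: sum_distrib_left)
  finally show ?thesis .
qed

lemma sum_times_fst_snd: "(\<Sum>k\<in>K. \<Sum>q\<in>Q. F k q) = (\<Sum>p\<in>K \<times> Q. F (fst p) (snd p))"
  by (simp add: sum.cartesian_product case_prod_beta)

text \<open>This \<open>W\<close> is a partial isometry. Cauchy-Schwarz over the pairs of
  \<open>k\<close> and \<open>q\<close> leaves two sums, each bounded by the preceding Bessel
  estimate.\<close>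

lemma overlap_contraction:
  fixes \<phi> :: "('x::finite, 'a::finite, 'y::finite, 'b::finite) state"
  assumes K: "finite K" and u: "orthonormal UNIV K u" and v: "orthonormal UNIV K v"
  shows "(cmod (overlap (\<lambda>a a'. \<Sum>k\<in>K. cnj (u k a) * v k a') x0 x1 \<phi>))\<^sup>2 \<le> output_prob \<phi> x0 * output_prob \<phi> x1"
proof -
  define U where "U k q = (\<Sum>a\<in>UNIV. u k a * \<phi> ((x0, a), q))" for k q
  define V where "V k q = (\<Sum>a\<in>UNIV. v k a * \<phi> ((x1, a), q))" for k q
  have eq: "overlap (\<lambda>a a'. \<Sum>k\<in>K. cnj (u k a) * v k a') x0 x1 \<phi> = (\<Sum>p\<in>K \<times> UNIV. cnj (U (fst p) (snd p)) * V (fst p) (snd p))"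
    unfolding overlap_eq ip_def U_def[symmetric] V_def[symmetric] by (rule sum_times_fst_snd)
  have "(\<Sum>p\<in>K \<times> UNIV. (cmod (U (fst p) (snd p)))\<^sup>2) \<le> output_prob \<phi> x0"
    unfolding sum_times_fst_snd[of "\<lambda>k q. (cmod (U k q))\<^sup>2", symmetric] unfolding U_def by (rule orthonormal_combination_le[OF u K])
  moreover have "(\<Sum>p\<in>K \<times> UNIV. (cmod (V (fst p) (snd p)))\<^sup>2) \<le> output_prob \<phi> x1"
    unfolding sum_times_fst_snd[of "\<lambda>k q. (cmod (V k q))\<^sup>2", symmetric] unfolding V_def by (rule orthonormal_combination_le[OF v K])
  ultimately have "(\<Sum>p\<in>K \<times> UNIV. (cmod (U (fst p) (snd p)))\<^sup>2) * (\<Sum>p\<in>K \<times> UNIV. (cmod (V (fst p) (snd p)))\<^sup>2)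
      \<le> output_prob \<phi> x0 * output_prob \<phi> x1"
    by (intro mult_mono output_prob_nonneg sum_nonneg) auto
  then show ?thesis
    unfolding eq by (rule order_trans[OF cauchy_schwarz_sum])
qed

text \<open>Recombining an ensemble by a unitary matrix does not change its mixed state, hence no
  measurement statistics.\<close>

lemma unitary_combination_norm:
  fixes u :: "'a::finite \<Rightarrow> 'a \<Rightarrow> complex"
  assumes u: "onb UNIV u"
  shows "(\<Sum>k\<in>UNIV. (cmod (ip UNIV (\<lambda>q. \<Sum>a\<in>UNIV. u k a * g a q) w))\<^sup>2) = (\<Sum>a\<in>UNIV. (cmod (ip UNIV (g a) w))\<^sup>2)"
proof -
  have "ip UNIV (\<lambda>q. \<Sum>a\<in>UNIV. u k a * g a q) w = ip UNIV (u k) (\<lambda>a. ip UNIV (g a) w)" for k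
    unfolding ip_sum_left ip_scale_left by (simp add: ip_def[of UNIV "u k"])
  then show ?thesis using onb_parseval_norm(2)[OF _ u, of "\<lambda>a. ip UNIV (g a) w"] by simp
qed

text \<open>All inner products split over Bob's output \<open>y\<close>. For fixed \<open>y\<close>,
  multiplying \<open>T y\<close> by \<open>G0 y\<close> on the left or by \<open>G1 y\<close> on the
  right inserts Bob's operator \<open>R x0 y\<close> or \<open>R x1 y\<close>, and correctness makes
  these proportional. Correctness on Alice's side makes \<open>G0 y\<close> and \<open>G1 y\<close>
  multiples of operators independent of \<open>y\<close>, so that the relation survives
  summation.\<close>

lemma conditional_grams_commute:
  fixes P :: "('x::finite \<times> 'y::finite) pmf" and \<psi> :: "('x, 'a::finite, 'y, 'b::finite) state" and x0 x1 :: 'x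
  assumes emb: "embedding P \<psi>"
  defines "g0 \<equiv> \<lambda>a q. \<psi> ((x0, a), q)" and "g1 \<equiv> \<lambda>a q. \<psi> ((x1, a), q)"
    and "p0 \<equiv> \<Sum>y\<in>UNIV. pmf P (x0, y)" and "p1 \<equiv> \<Sum>y\<in>UNIV. pmf P (x1, y)"
  shows "of_real p0 * (\<Sum>b\<in>UNIV. cnj (g0 a (y, b)) * g0 a' (y, b)) = of_real (pmf P (x0, y)) * ip UNIV (g0 a) (g0 a')"
    and "of_real p1 * mmult (\<lambda>a a'. ip UNIV (g0 a) (g0 a')) (\<lambda>a a'. ip UNIV (g0 a) (g1 a')) a a'
      = of_real p0 * mmult (\<lambda>a a'. ip UNIV (g0 a) (g1 a')) (\<lambda>a a'. ip UNIV (g1 a) (g1 a')) a a'"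
proof -
  have pm: "pmf P (x, y) = (\<Sum>a\<in>UNIV. \<Sum>b\<in>UNIV. (cmod (\<psi> ((x, a), (y, b))))\<^sup>2)" for x y
    using emb by (auto simp: embedding_def honest_outputs_def)
  have zero: "\<psi> ((x, a), (y, b)) = 0" if "pmf P (x, y) = 0" for x y a b
  proof -
    have "(cmod (\<psi> ((x, a), (y, b))))\<^sup>2 \<le> (\<Sum>b\<in>UNIV. (cmod (\<psi> ((x, a), (y, b))))\<^sup>2)"
      by (rule member_le_sum) auto
    also have "\<dots> \<le> (\<Sum>a\<in>UNIV. \<Sum>b\<in>UNIV. (cmod (\<psi> ((x, a), (y, b))))\<^sup>2)"
      by (rule member_le_sum) (auto intro: sum_nonneg)
    finally show ?thesis using that pm[of x y] by simp
  qed
  have Y: "of_real (\<Sum>y\<in>UNIV. pmf P (x, y)) * (\<Sum>b\<in>UNIV. cnj (\<psi> ((x, a), (y, b))) * \<psi> ((x, a'), (y, b)))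
      = of_real (pmf P (x, y)) * ip UNIV (\<lambda>q. \<psi> ((x, a), q)) (\<lambda>q. \<psi> ((x, a'), q))" for x y a a'
    using embedding_structure(2)[OF emb, of x y a' a]
    unfolding gram_singleton_times by (simp add: gram_def ip_def mult.commute)
  show "of_real p0 * (\<Sum>b\<in>UNIV. cnj (g0 a (y, b)) * g0 a' (y, b)) = of_real (pmf P (x0, y)) * ip UNIV (g0 a) (g0 a')"
    unfolding p0_def g0_def by (rule Y)
  define R where "R x y = gram ({x} \<times> UNIV) (\<lambda>s b. \<psi> (s, (y, b)))" for x y
  have Rx: "R x y b b' = (\<Sum>a\<in>UNIV. \<psi> ((x, a), (y, b)) * cnj (\<psi> ((x, a), (y, b'))))" for x y b b'
    unfolding R_def by (rule gram_singleton_times)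
  \<comment> \<open>Both operators are multiples of the same average over \<open>x\<close>;
    cross-multiplication eliminates it.\<close>
  have RR: "of_real (pmf P (x1, y)) * R x0 y b b' = of_real (pmf P (x0, y)) * R x1 y b b'" for y b b'
  proof -
    let ?p = "complex_of_real (\<Sum>x\<in>UNIV. pmf P (x, y))"
    have B: "?p * R x y b b' = of_real (pmf P (x, y)) * gram UNIV (\<lambda>s b. \<psi> (s, (y, b))) b b'" for x
      unfolding R_def by (rule embedding_structure(1)[OF emb])
    show ?thesis
    proof (cases "?p = 0")
      case True
      then have "(\<Sum>x\<in>UNIV. pmf P (x, y)) = 0" by (simp only: of_real_eq_0_iff)
      then have "pmf P (x, y) = 0" for x by (subst (asm) sum_nonneg_eq_0_iff) auto
      then show ?thesis by simp
    next
      case False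
      have "?p * (of_real (pmf P (x1, y)) * R x0 y b b') = of_real (pmf P (x1, y)) * (?p * R x0 y b b')" by simp
      also have "\<dots> = of_real (pmf P (x0, y)) * (?p * R x1 y b b')" unfolding B by simp
      also have "\<dots> = ?p * (of_real (pmf P (x0, y)) * R x1 y b b')" by simp
      finally show ?thesis using False mult_left_cancel by blast
    qed
  qed
  define T where "T y a c = (\<Sum>b\<in>UNIV. cnj (g0 a (y, b)) * g1 c (y, b))" for y a c
  define G0 where "G0 y a c = (\<Sum>b\<in>UNIV. cnj (g0 a (y, b)) * g0 c (y, b))" for y a c
  define G1 where "G1 y a c = (\<Sum>b\<in>UNIV. cnj (g1 a (y, b)) * g1 c (y, b))" for y a c
  have G0: "of_real p0 * G0 y a c = of_real (pmf P (x0, y)) * ip UNIV (g0 a) (g0 c)" for y a c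
    unfolding G0_def p0_def g0_def by (rule Y)
  have G1: "of_real p1 * G1 y a c = of_real (pmf P (x1, y)) * ip UNIV (g1 a) (g1 c)" for y a c
    unfolding G1_def p1_def g1_def by (rule Y)
  have T: "ip UNIV (g0 a) (g1 c) = (\<Sum>y\<in>UNIV. T y a c)" for a c
    by (simp add: ip_def T_def sum_UNIV_prod)
  have GT: "(\<Sum>c\<in>UNIV. G0 y a c * T y c a') = (\<Sum>b\<in>UNIV. \<Sum>b'\<in>UNIV. cnj (g0 a (y, b)) * R x0 y b b' * g1 a' (y, b'))" for y
  proof -
    have "(\<Sum>c\<in>UNIV. G0 y a c * T y c a') = (\<Sum>c\<in>UNIV. \<Sum>b\<in>UNIV. \<Sum>b'\<in>UNIV.
        cnj (g0 a (y, b)) * (g0 c (y, b) * cnj (g0 c (y, b'))) * g1 a' (y, b'))"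
      unfolding G0_def T_def sum_product by (simp add: mult_ac)
    also have "\<dots> = (\<Sum>b\<in>UNIV. \<Sum>b'\<in>UNIV. \<Sum>c\<in>UNIV.
        cnj (g0 a (y, b)) * (g0 c (y, b) * cnj (g0 c (y, b'))) * g1 a' (y, b'))" by (rule sum_swap3)
    finally show ?thesis by (simp add: Rx g0_def sum_distrib_left sum_distrib_right)
  qed
  have TG: "(\<Sum>c\<in>UNIV. T y a c * G1 y c a') = (\<Sum>b\<in>UNIV. \<Sum>b'\<in>UNIV. cnj (g0 a (y, b)) * R x1 y b b' * g1 a' (y, b'))" for y
  proof -
    have "(\<Sum>c\<in>UNIV. T y a c * G1 y c a') = (\<Sum>c\<in>UNIV. \<Sum>b\<in>UNIV. \<Sum>b'\<in>UNIV.
        cnj (g0 a (y, b)) * (g1 c (y, b) * cnj (g1 c (y, b'))) * g1 a' (y, b'))"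
      unfolding G1_def T_def sum_product by (simp add: mult_ac)
    also have "\<dots> = (\<Sum>b\<in>UNIV. \<Sum>b'\<in>UNIV. \<Sum>c\<in>UNIV.
        cnj (g0 a (y, b)) * (g1 c (y, b) * cnj (g1 c (y, b'))) * g1 a' (y, b'))" by (rule sum_swap3)
    finally show ?thesis by (simp add: Rx g1_def sum_distrib_left sum_distrib_right)
  qed
  \<comment> \<open>If one of the two outputs has probability 0 together with \<open>y\<close>, then
    \<open>T y\<close> vanishes; otherwise the factor \<open>?q0 * ?q1\<close> can be
    cancelled.\<close>
  have per_y: "of_real p1 * (\<Sum>c\<in>UNIV. ip UNIV (g0 a) (g0 c) * T y c a') = of_real p0 * (\<Sum>c\<in>UNIV. T y a c * ip UNIV (g1 c) (g1 a'))" for y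
  proof (cases "pmf P (x0, y) = 0 \<or> pmf P (x1, y) = 0")
    case True
    then have "T y c c' = 0" for c c' by (auto simp: T_def g0_def g1_def zero)
    then show ?thesis by simp
  next
    case False
    let ?q0 = "complex_of_real (pmf P (x0, y))" and ?q1 = "complex_of_real (pmf P (x1, y))"
    have "(?q0 * ?q1) * (of_real p1 * (\<Sum>c\<in>UNIV. ip UNIV (g0 a) (g0 c) * T y c a'))
        = of_real p1 * ?q1 * (\<Sum>c\<in>UNIV. (?q0 * ip UNIV (g0 a) (g0 c)) * T y c a')"
      by (simp add: sum_distrib_left mult_ac)
    also have "\<dots> = of_real p0 * of_real p1 * (?q1 * (\<Sum>c\<in>UNIV. G0 y a c * T y c a'))"
      unfolding G0[symmetric] by (simp add: sum_distrib_left mult_ac)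
    also have "?q1 * (\<Sum>c\<in>UNIV. G0 y a c * T y c a') = (\<Sum>b\<in>UNIV. \<Sum>b'\<in>UNIV. cnj (g0 a (y, b)) * (?q1 * R x0 y b b') * g1 a' (y, b'))"
      unfolding GT by (simp add: sum_distrib_left mult_ac)
    also have "\<dots> = ?q0 * (\<Sum>c\<in>UNIV. T y a c * G1 y c a')"
      unfolding RR TG by (simp add: sum_distrib_left mult_ac)
    also have "of_real p0 * of_real p1 * (?q0 * (\<Sum>c\<in>UNIV. T y a c * G1 y c a'))
        = of_real p0 * ?q0 * (\<Sum>c\<in>UNIV. T y a c * (of_real p1 * G1 y c a'))"
      by (simp add: sum_distrib_left mult_ac)
    also have "\<dots> = (?q0 * ?q1) * (of_real p0 * (\<Sum>c\<in>UNIV. T y a c * ip UNIV (g1 c) (g1 a')))"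
      unfolding G1 by (simp add: sum_distrib_left mult_ac)
    finally show ?thesis using False by simp
  qed
  have "of_real p1 * mmult (\<lambda>a a'. ip UNIV (g0 a) (g0 a')) (\<lambda>a a'. ip UNIV (g0 a) (g1 a')) a a'
      = (\<Sum>y\<in>UNIV. of_real p1 * (\<Sum>c\<in>UNIV. ip UNIV (g0 a) (g0 c) * T y c a'))"
    unfolding mmult_def T sum_distrib_left by (rule sum.swap)
  also have "\<dots> = (\<Sum>y\<in>UNIV. of_real p0 * (\<Sum>c\<in>UNIV. T y a c * ip UNIV (g1 c) (g1 a')))"
    by (intro sum.cong refl per_y)
  also have "\<dots> = of_real p0 * mmult (\<lambda>a a'. ip UNIV (g0 a) (g1 a')) (\<lambda>a a'. ip UNIV (g1 a) (g1 a')) a a'"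
    unfolding mmult_def T sum_distrib_left sum_distrib_right by (rule sum.swap)
  finally show "of_real p1 * mmult (\<lambda>a a'. ip UNIV (g0 a) (g0 a')) (\<lambda>a a'. ip UNIV (g0 a) (g1 a')) a a'
      = of_real p0 * mmult (\<lambda>a a'. ip UNIV (g0 a) (g1 a')) (\<lambda>a a'. ip UNIV (g1 a) (g1 a')) a a'" .
qed

text \<open>Nonorthogonality would yield a positive principal value \<open>D k0\<close>, and
  different dependent parts a component of \<open>V\<close> that \<open>x0\<close> excludes;
  together they permit an attack below the fidelity bound.\<close>

lemma two_copy_attack_beats_queries:
  fixes P :: "('x::finite \<times> 'y::finite) pmf" and \<psi> :: "('x, 'a::finite, 'y, 'b::finite) state"
    and M :: "real \<Rightarrow> ('x \<times> 'a) measurement" and N :: "real \<Rightarrow> ('y \<times> 'b) measurement"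
  assumes emb: "embedding P \<psi>" and ID: "ideal_functionality M N" and sim: "attacks_simulated M N \<psi> 2"
    and dep: "dependent_part P x0 \<noteq> dependent_part P x1"
  shows "ip UNIV (\<lambda>q. \<psi> ((x0, a0), q)) (\<lambda>q. \<psi> ((x1, c0), q)) = 0"
proof (rule ccontr)
  assume nonorth: "ip UNIV (\<lambda>q. \<psi> ((x0, a0), q)) (\<lambda>q. \<psi> ((x1, c0), q)) \<noteq> 0"
  define g0 where "g0 a q = \<psi> ((x0, a), q)" for a q
  define g1 where "g1 a q = \<psi> ((x1, a), q)" for a q
  define p0 where "p0 = (\<Sum>y\<in>UNIV. pmf P (x0, y))"
  define p1 where "p1 = (\<Sum>y\<in>UNIV. pmf P (x1, y))"
  have g: "g0 a = (\<lambda>q. \<psi> ((x0, a), q))" "g1 a = (\<lambda>q. \<psi> ((x1, a), q))" for a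
    by (auto simp: g0_def g1_def)
  have pos: "0 < (\<Sum>y\<in>UNIV. pmf P (x, y))" if "\<psi> ((x, a), q) \<noteq> 0" for x a q
  proof (rule ccontr)
    assume "\<not> ?thesis"
    moreover have "0 \<le> (\<Sum>y\<in>UNIV. pmf P (x, y))" by (simp add: sum_nonneg)
    ultimately have "(\<Sum>y\<in>UNIV. pmf P (x, y)) = 0" by linarith
    then have "pmf P (x, fst q) = 0" by (subst (asm) sum_nonneg_eq_0_iff) auto
    then have "(\<Sum>a\<in>UNIV. \<Sum>b\<in>UNIV. (cmod (\<psi> ((x, a), (fst q, b))))\<^sup>2) = 0"
      using emb by (simp add: embedding_def honest_outputs_def)
    then have "(\<Sum>b\<in>UNIV. (cmod (\<psi> ((x, a), (fst q, b))))\<^sup>2) = 0"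
      by (subst (asm) sum_nonneg_eq_0_iff) (auto intro: sum_nonneg)
    then have "\<forall>b\<in>UNIV. (cmod (\<psi> ((x, a), (fst q, b))))\<^sup>2 = 0"
      by (subst (asm) sum_nonneg_eq_0_iff) auto
    then have "(cmod (\<psi> ((x, a), (fst q, snd q))))\<^sup>2 = 0" by blast
    then show False using that by simp
  qed
  have "(\<exists>q. \<psi> ((x0, a0), q) \<noteq> 0) \<and> (\<exists>q. \<psi> ((x1, c0), q) \<noteq> 0)"
  proof (rule ccontr)
    assume "\<not> ?thesis"
    then have "ip UNIV (\<lambda>q. \<psi> ((x0, a0), q)) (\<lambda>q. \<psi> ((x1, c0), q)) = 0"
      by (auto simp: ip_def simp del: split_paired_All split_paired_Ex)
    then show False using nonorth by simp
  qed
  then have p: "0 < p0" "0 < p1" using pos unfolding p0_def p1_def by blast+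
  obtain y0 where "pmf (dependent_part P x0) y0 \<noteq> pmf (dependent_part P x1) y0"
    using dep pmf_eqI[of "dependent_part P x0" "dependent_part P x1"] by auto
  then have ne: "pmf P (x0, y0) * p1 \<noteq> pmf P (x1, y0) * p0"
    using pmf_dependent_part[of P x0 y0] pmf_dependent_part[of P x1 y0] p unfolding p0_def p1_def
    by (simp add: frac_eq_eq)
  have "cnj (ip UNIV (g0 a0) (g1 c0)) \<noteq> 0" using nonorth by (simp add: g)
  then have nz: "ip UNIV (g1 c0) (g0 a0) \<noteq> 0" unfolding cnj_ip .
  have Y0: "of_real p0 * (\<Sum>b\<in>UNIV. cnj (g0 a (y, b)) * g0 a' (y, b)) = of_real (pmf P (x0, y)) * ip UNIV (g0 a) (g0 a')" for a a' y
    unfolding p0_def g by (rule conditional_grams_commute(1)[OF emb])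
  have Y1: "of_real p1 * (\<Sum>b\<in>UNIV. cnj (g1 a (y, b)) * g1 a' (y, b)) = of_real (pmf P (x1, y)) * ip UNIV (g1 a) (g1 a')" for a a' y
    unfolding p1_def g by (rule conditional_grams_commute(1)[OF emb])
  have comm: "of_real p1 * mmult (\<lambda>a a'. ip UNIV (g0 a) (g0 a')) (\<lambda>a a'. ip UNIV (g0 a) (g1 a')) a a'
      = of_real p0 * mmult (\<lambda>a a'. ip UNIV (g0 a) (g1 a')) (\<lambda>a a'. ip UNIV (g1 a) (g1 a')) a a'" for a a'
    unfolding p0_def p1_def g by (rule conditional_grams_commute(2)[OF emb])
  obtain u v :: "'a \<Rightarrow> 'a \<Rightarrow> complex" and lam D :: "'a \<Rightarrow> real" and k0 :: 'a and \<kappa> :: real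
    where u: "onb UNIV u"
    and UU': "\<And>k l. ip UNIV (\<lambda>q. \<Sum>a\<in>UNIV. u k a * g0 a q) (\<lambda>q. \<Sum>a\<in>UNIV. u l a * g0 a q) = (if k = l then of_real (lam k) else 0)"
    and D0: "\<And>k. 0 \<le> D k" and Dlam: "\<And>k. D k \<noteq> 0 \<Longrightarrow> lam k > 0" and Dk0: "D k0 > 0" and lam0: "\<And>k. lam k \<ge> 0"
    and v: "orthonormal UNIV {k. D k \<noteq> 0} v"
    and g1U': "\<And>a k. ip UNIV (g1 a) (\<lambda>q. \<Sum>a\<in>UNIV. u k a * g0 a q) = of_real (D k) * v k a"
    and g1V': "\<And>a. ip UNIV (g1 a) (\<lambda>q. \<Sum>a\<in>UNIV. v k0 a * g1 a q) = of_real \<kappa> * v k0 a"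
    and strict: "(D k0)\<^sup>2 < lam k0 * \<kappa>"
    by (rule principal_vectors[where ?P0.0="\<lambda>y. pmf P (x0, y)" and ?P1.0="\<lambda>y. pmf P (x1, y)", OF p comm Y0 Y1 ne nz])
      (rule that; assumption)
  define U where "U k = (\<lambda>q. \<Sum>a\<in>UNIV. u k a * g0 a q)" for k
  define V where "V = (\<lambda>q. \<Sum>a\<in>UNIV. v k0 a * g1 a q)"
  note UU = UU'[folded U_def] and g1U = g1U'[folded U_def] and g1V = g1V'[folded V_def]
  have lk: "lam k0 > 0" using Dlam[of k0] Dk0 by simp
  define d where "d = D k0"
  \<comment> \<open>\<open>A\<close> and \<open>\<nu>\<close> are the amplitudes along
    \<open>v k0\<close> with which \<open>x1\<close> yields \<open>uh k0\<close> and
    \<open>nh\<close>. Their squares add up to \<open>\<kappa>\<close>, and \<open>strict\<close>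
    makes \<open>\<nu>\<close> positive.\<close>
  define A where "A = d / sqrt (lam k0)"
  define \<nu> where "\<nu> = sqrt (\<kappa> - d\<^sup>2 / lam k0)"
  have \<nu>2: "\<nu>\<^sup>2 = \<kappa> - d\<^sup>2 / lam k0" and \<nu>0: "\<nu> > 0"
    using strict lk by (simp_all add: \<nu>_def d_def field_simps)
  have d0: "d > 0" and A0: "A > 0" and A2: "A\<^sup>2 = d\<^sup>2 / lam k0"
    using Dk0 lk by (simp_all add: d_def A_def power_divide)
  \<comment> \<open>If \<open>lam k = 0\<close>, this is the zero vector; such labels are excluded
    from \<open>K\<close> below.\<close>
  define uh where "uh k = (\<lambda>q. complex_of_real (1 / sqrt (lam k)) * U k q)" for k
  \<comment> \<open>The normalized part of \<open>V\<close> orthogonal to \<open>U k0\<close>. As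
    \<open>V\<close> is orthogonal to all other \<open>U l\<close> anyway, \<open>nh\<close> is
    orthogonal to every vector for \<open>x0\<close>.\<close>
  define nh where "nh = (\<lambda>q. complex_of_real (1 / \<nu>) * (V q - complex_of_real (d / lam k0) * U k0 q))"
  have UV: "ip UNIV (U l) V = (if l = k0 then of_real d else 0)" for l
  proof -
    have "ip UNIV (U l) V = (\<Sum>a\<in>UNIV. v k0 a * ip UNIV (U l) (g1 a))"
      unfolding V_def ip_sum_right ip_scale_right ..
    also have "\<dots> = (\<Sum>a\<in>UNIV. v k0 a * cnj (of_real (D l) * v l a))"
      unfolding g1U[symmetric] cnj_ip ..
    also have "\<dots> = of_real (D l) * ip UNIV (v l) (v k0)"
      by (simp add: ip_def sum_distrib_left mult_ac)
    also have "\<dots> = (if l = k0 then of_real d else 0)"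
      using v Dk0 by (cases "D l = 0") (auto simp: orthonormal_def d_def)
    finally show ?thesis .
  qed
  have Un: "ip UNIV (U l) nh = 0" for l
    unfolding nh_def ip_scale_right ip_diff_right UV UU using lk by auto
  have uhuh: "ip UNIV (uh k) (uh l) = (if k = l then 1 else 0)" if "lam k > 0" "lam l > 0" for k l
  proof -
    have "complex_of_real (sqrt (lam l)) * of_real (sqrt (lam l)) = of_real (lam l)"
      using that by (metis of_real_mult real_sqrt_mult_self abs_of_pos)
    then show ?thesis
      unfolding uh_def ip_scale_left ip_scale_right UU using that by (auto simp: field_simps)
  qed
  have uhn: "ip UNIV (uh k) nh = 0" for k
    unfolding uh_def ip_scale_left Un by simp
  have nuh: "ip UNIV nh (uh k) = 0" for k using uhn[of k] by (metis cnj_ip complex_cnj_zero)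
  have v1: "ip UNIV (v k0) (v k0) = 1" using v Dk0 by (simp add: orthonormal_def)
  have VV: "ip UNIV V V = of_real \<kappa>"
  proof -
    have "ip UNIV V V = (\<Sum>a\<in>UNIV. cnj (v k0 a) * ip UNIV (g1 a) V)"
      by (subst (1) V_def) (simp only: ip_sum_left ip_scale_left)
    also have "\<dots> = of_real \<kappa> * ip UNIV (v k0) (v k0)" by (simp only: g1V) (simp add: ip_def sum_distrib_left mult_ac)
    finally show ?thesis using v1 by simp
  qed
  have nn: "ip UNIV nh nh = 1"
  proof -
    have Vn: "ip UNIV V nh = of_real \<nu>"
    proof -
      have "ip UNIV V (U k0) = of_real d" using UV[of k0] by (metis cnj_ip complex_cnj_complex_of_real)
      then have "ip UNIV V nh = of_real (1 / \<nu> * (\<kappa> - d / lam k0 * d))"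
        unfolding nh_def ip_scale_right ip_diff_right VV by simp
      also have "1 / \<nu> * (\<kappa> - d / lam k0 * d) = 1 / \<nu> * \<nu>\<^sup>2" unfolding \<nu>2 by (simp add: power2_eq_square)
      also have "\<dots> = \<nu>" using \<nu>0 by (simp add: power2_eq_square)
      finally show ?thesis .
    qed
    have "ip UNIV nh nh = of_real (1 / \<nu>) * (ip UNIV V nh - of_real (d / lam k0) * ip UNIV (U k0) nh)"
      by (subst (1) nh_def) (simp add: ip_def sum_distrib_left sum_subtractf algebra_simps)
    then show ?thesis unfolding Vn Un using \<nu>0 by simp
  qed
  have norm_U: "(\<Sum>a\<in>UNIV. (cmod (ip UNIV (g0 a) w))\<^sup>2) = (\<Sum>k\<in>UNIV. (cmod (ip UNIV (U k) w))\<^sup>2)" for w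
    unfolding U_def by (rule unitary_combination_norm[OF u, symmetric])
  have g0n: "ip UNIV (g0 a) nh = 0" for a
  proof -
    have "(\<Sum>a\<in>UNIV. (cmod (ip UNIV (g0 a) nh))\<^sup>2) = 0"
      unfolding norm_U Un by simp
    then show ?thesis by (subst (asm) sum_nonneg_eq_0_iff) auto
  qed
  have g1uh: "ip UNIV (g1 a) (uh k) = of_real (D k / sqrt (lam k)) * v k a" for a k
    unfolding uh_def ip_scale_right g1U by simp
  have g1n: "ip UNIV (g1 a) nh = of_real \<nu> * v k0 a" for a
  proof -
    have "ip UNIV (g1 a) nh = of_real (1 / \<nu> * (\<kappa> - d / lam k0 * d)) * v k0 a"
      unfolding nh_def ip_scale_right ip_diff_right g1V g1U d_def by (simp add: algebra_simps)
    also have "1 / \<nu> * (\<kappa> - d / lam k0 * d) = 1 / \<nu> * \<nu>\<^sup>2" unfolding \<nu>2 by (simp add: power2_eq_square)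
    also have "\<dots> = \<nu>" using \<nu>0 by (simp add: power2_eq_square)
    finally show ?thesis .
  qed
  have m0: "(\<Sum>a\<in>UNIV. (cmod (ip UNIV (g0 a) (uh k)))\<^sup>2) = lam k" if "lam k > 0" for k
  proof -
    have "ip UNIV (U l) (uh k) = (if l = k then of_real (sqrt (lam k)) else 0)" for l
    proof -
      have "ip UNIV (U l) (uh k) = (if l = k then of_real (lam k / sqrt (lam k)) else 0)"
        unfolding uh_def ip_scale_right UU by simp
      also have "lam k / sqrt (lam k) = sqrt (lam k)" using that by (simp add: real_div_sqrt)
      finally show ?thesis .
    qed
    then have "(\<Sum>l\<in>UNIV. (cmod (ip UNIV (U l) (uh k)))\<^sup>2) = (\<Sum>l\<in>UNIV. if l = k then lam k else 0)"
      using that by (intro sum.cong refl) auto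
    then show ?thesis unfolding norm_U by simp
  qed
  have m1: "(\<Sum>a\<in>UNIV. (cmod (ip UNIV (g1 a) (uh k)))\<^sup>2) = (D k)\<^sup>2 / lam k" if "lam k > 0" for k
  proof (cases "D k = 0")
    case False
    then have "ip UNIV (v k) (v k) = 1" using v by (simp add: orthonormal_def)
    then have vk: "(\<Sum>a\<in>UNIV. (cmod (v k a))\<^sup>2) = 1" unfolding ip_self by (simp only: of_real_eq_1_iff)
    have "(\<Sum>a\<in>UNIV. (cmod (ip UNIV (g1 a) (uh k)))\<^sup>2) = (D k)\<^sup>2 / lam k * (\<Sum>a\<in>UNIV. (cmod (v k a))\<^sup>2)"
      unfolding g1uh sum_distrib_left using that by (simp add: norm_mult norm_divide power_mult_distrib power_divide)
    then show ?thesis using vk by simp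
  qed (simp add: g1uh)
  text \<open>Measuring every copy in the basis \<open>uh\<close> attains the fidelity bound.  Rotating \<open>uh k0 \<otimes> uh k0\<close>
    towards \<open>nh \<otimes> nh\<close> by the angle with \<open>\<alpha> A\<^sup>2 = \<beta> \<nu>\<^sup>2\<close> makes this outcome impossible for
    \<open>x1 x1\<close>, and the other rotated vector only contributes \<open>\<beta>\<^sup>2 d\<^sup>2\<close> instead of \<open>d\<^sup>2\<close>.\<close>
  define n2 where "n2 = sqrt (\<nu>^4 + A^4)"
  have n2: "n2 > 0" "n2\<^sup>2 = \<nu>^4 + A^4" using \<nu>0 A0 by (simp_all add: n2_def add_pos_pos)
  define \<alpha> where "\<alpha> = \<nu>\<^sup>2 / n2"
  define \<beta> where "\<beta> = A\<^sup>2 / n2"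
  have ab: "\<alpha>\<^sup>2 + \<beta>\<^sup>2 = 1"
  proof -
    have "\<alpha>\<^sup>2 + \<beta>\<^sup>2 = ((\<nu>\<^sup>2)\<^sup>2 + (A\<^sup>2)\<^sup>2) / n2\<^sup>2"
      by (simp add: \<alpha>_def \<beta>_def power_divide add_divide_distrib)
    also have "(\<nu>\<^sup>2)\<^sup>2 + (A\<^sup>2)\<^sup>2 = n2\<^sup>2" by (simp add: n2(2))
    also have "n2\<^sup>2 / n2\<^sup>2 = 1" using n2(1) by simp
    finally show ?thesis .
  qed
  have \<alpha>0: "\<alpha> > 0" using \<nu>0 n2 by (simp add: \<alpha>_def)
  have balance: "\<alpha> * A\<^sup>2 = \<beta> * \<nu>\<^sup>2" by (simp add: \<alpha>_def \<beta>_def)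
  define K where "K = {k. lam k > 0}"
  have k0K: "k0 \<in> K" using lk by (simp add: K_def)
  \<comment> \<open>\<open>None\<close> labels \<open>nh\<close> on both copies, and
    \<open>Some\<close> the products of eigenvectors for \<open>x0\<close>.\<close>
  define J where "J = insert None (Some ` (K \<times> K))"
  define b where "b j = (case j of None \<Rightarrow> tensor2 nh nh | Some (k, l) \<Rightarrow> tensor2 (uh k) (uh l))" for j
  have bo: "orthonormal (copies 2) J b"
    unfolding orthonormal_def J_def b_def
    by (auto simp: ip_tensor2 nn uhn nuh uhuh K_def)
  define e where "e = b(None := (\<lambda>l. of_real \<alpha> * b None l + of_real \<beta> * b (Some (k0, k0)) l),
    Some (k0, k0) := (\<lambda>l. of_real \<alpha> * b (Some (k0, k0)) l - of_real \<beta> * b None l))"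
  have eo: "orthonormal (copies 2) J e"
    unfolding e_def using k0K ab by (intro orthonormal_rotation[OF bo]) (auto simp: J_def)
  have finJ: "finite J" by (simp add: J_def)
  \<comment> \<open>The partial isometry that aligns the singular vectors of \<open>T\<close>; it
    makes every principal value count with sign plus.\<close>
  define W where "W a a' = (\<Sum>k\<in>{k. D k \<noteq> 0}. cnj (u k a) * v k a')" for a a'
  have ou: "orthonormal UNIV {k. D k \<noteq> 0} u" using u by (auto simp: onb_def orthonormal_def)
  have contr: "(cmod (overlap W x0 x1 \<phi>))\<^sup>2 \<le> output_prob \<phi> x0 * output_prob \<phi> x1" for \<phi> :: "('x, 'a, 'y, 'b) state"
    unfolding W_def[abs_def] by (rule overlap_contraction[OF _ ou v]) simp
  have ov: "overlap W x0 x1 \<psi> = of_real (\<Sum>k\<in>K. D k)"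
  proof -
    have "overlap W x0 x1 \<psi> = (\<Sum>k\<in>{k. D k \<noteq> 0}. ip UNIV (U k) (\<lambda>q. \<Sum>a\<in>UNIV. v k a * g1 a q))"
      unfolding W_def[abs_def] overlap_eq U_def g0_def g1_def ..
    also have "\<dots> = (\<Sum>k\<in>{k. D k \<noteq> 0}. of_real (D k))"
    proof (rule sum.cong[OF refl])
      fix k assume k: "k \<in> {k. D k \<noteq> 0}"
      have "ip UNIV (U k) (\<lambda>q. \<Sum>a\<in>UNIV. v k a * g1 a q) = (\<Sum>a\<in>UNIV. v k a * cnj (of_real (D k) * v k a))"
        unfolding ip_sum_right ip_scale_right g1U[symmetric] cnj_ip ..
      also have "\<dots> = of_real (D k) * ip UNIV (v k) (v k)" by (simp add: ip_def sum_distrib_left mult_ac)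
      finally show "ip UNIV (U k) (\<lambda>q. \<Sum>a\<in>UNIV. v k a * g1 a q) = of_real (D k)"
        using v k by (simp add: orthonormal_def)
    qed
    also have "\<dots> = (\<Sum>k\<in>K. of_real (D k))"
      using Dlam by (intro sum.mono_neutral_left) (auto simp: K_def)
    finally show ?thesis by simp
  qed
  define p where "p u j = (\<Sum>a\<in>UNIV. \<Sum>a'\<in>UNIV.
      (cmod (ip (copies 2) (e j) (tensor2 (\<lambda>q. \<psi> ((u ! 0, a), q)) (\<lambda>q. \<psi> ((u ! 1, a'), q)))))\<^sup>2)" for u j
  have csym: "cmod (ip (copies 2) s t) = cmod (ip (copies 2) t s)" for s t :: "('y \<times> 'b) list \<Rightarrow> complex"
    by (metis cnj_ip complex_mod_cnj)
  have pe: "p [x, x'] j = (\<Sum>a\<in>UNIV. \<Sum>a'\<in>UNIV.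
      (cmod (ip (copies 2) (tensor2 (\<lambda>q. \<psi> ((x, a), q)) (\<lambda>q. \<psi> ((x', a'), q))) (e j)))\<^sup>2)" for x x' j
    unfolding p_def by (simp add: csym[of "e j"])
  have eN: "e None = (\<lambda>l. of_real \<alpha> * tensor2 nh nh l + of_real \<beta> * tensor2 (uh k0) (uh k0) l)"
    by (simp add: e_def b_def)
  have e0: "e (Some (k0, k0)) = (\<lambda>l. of_real \<alpha> * tensor2 (uh k0) (uh k0) l - of_real \<beta> * tensor2 nh nh l)"
    by (simp add: e_def b_def)
  have ekl: "e (Some z) = tensor2 (uh (fst z)) (uh (snd z))" if "z \<noteq> (k0, k0)" for z
    using that by (simp add: e_def b_def case_prod_beta)
  have prod_sum: "(\<Sum>a\<in>UNIV. \<Sum>a'\<in>UNIV. (cmod (of_real r * (f a * h a')))\<^sup>2)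
      = r\<^sup>2 * ((\<Sum>a\<in>UNIV. (cmod (f a))\<^sup>2) * (\<Sum>a\<in>UNIV. (cmod (h a))\<^sup>2))" for r :: real and f h :: "'a \<Rightarrow> complex"
    by (subst sum_product) (simp add: sum_distrib_left norm_mult power_mult_distrib)
  have pN00: "p [x0, x0] None = \<beta>\<^sup>2 * (lam k0 * lam k0)"
    unfolding pe eN ip_add_right ip_scale_right ip_tensor2 g[symmetric] g0n
    using prod_sum[of \<beta> "\<lambda>a. ip UNIV (g0 a) (uh k0)" "\<lambda>a. ip UNIV (g0 a) (uh k0)"] m0[OF lk] by simp
  have pN01: "p [x0, x1] None = \<beta>\<^sup>2 * d\<^sup>2"
    unfolding pe eN ip_add_right ip_scale_right ip_tensor2 g[symmetric] g0n
    using prod_sum[of \<beta> "\<lambda>a. ip UNIV (g0 a) (uh k0)" "\<lambda>a. ip UNIV (g1 a) (uh k0)"] m0[OF lk] m1[OF lk] lk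
    by (simp add: d_def)
  have pN10: "p [x1, x0] None = \<beta>\<^sup>2 * d\<^sup>2"
    unfolding pe eN ip_add_right ip_scale_right ip_tensor2 g[symmetric] g0n
    using prod_sum[of \<beta> "\<lambda>a. ip UNIV (g1 a) (uh k0)" "\<lambda>a. ip UNIV (g0 a) (uh k0)"] m0[OF lk] m1[OF lk] lk
    by (simp add: d_def)
  have p000: "p [x0, x0] (Some (k0, k0)) = \<alpha>\<^sup>2 * (lam k0 * lam k0)"
    unfolding pe e0 ip_diff_right ip_scale_right ip_tensor2 g[symmetric] g0n
    using prod_sum[of \<alpha> "\<lambda>a. ip UNIV (g0 a) (uh k0)" "\<lambda>a. ip UNIV (g0 a) (uh k0)"] m0[OF lk] by simp
  \<comment> \<open>The amplitudes of \<open>uh k0\<close> and \<open>nh\<close> under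
    \<open>x1\<close> are multiples of the same vector \<open>v k0\<close>, so one choice of the
    angle cancels them for all \<open>a\<close> and \<open>a'\<close> at once.\<close>
  have p011: "p [x1, x1] (Some (k0, k0)) = 0"
  proof -
    have "of_real \<alpha> * (ip UNIV (g1 a) (uh k0) * ip UNIV (g1 a') (uh k0)) - of_real \<beta> * (ip UNIV (g1 a) nh * ip UNIV (g1 a') nh)
        = of_real (\<alpha> * A\<^sup>2 - \<beta> * \<nu>\<^sup>2) * (v k0 a * v k0 a')" for a a'
      unfolding g1uh g1n d_def[symmetric] A_def[symmetric] by (simp add: algebra_simps power2_eq_square)
    then show ?thesis
      unfolding pe e0 ip_diff_right ip_scale_right ip_tensor2 g[symmetric] balance by simp
  qed
  have pkl0: "p [x0, x0] (Some z) = lam (fst z) * lam (snd z)" if "z \<in> K \<times> K" "z \<noteq> (k0, k0)" for z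
    unfolding pe ekl[OF that(2)] ip_tensor2 g[symmetric]
    using that(1) prod_sum[of 1 "\<lambda>a. ip UNIV (g0 a) (uh (fst z))" "\<lambda>a. ip UNIV (g0 a) (uh (snd z))"] m0[of "fst z"] m0[of "snd z"]
    by (auto simp: K_def)
  have pkl1: "p [x1, x1] (Some z) = ((D (fst z))\<^sup>2 / lam (fst z)) * ((D (snd z))\<^sup>2 / lam (snd z))"
    if "z \<in> K \<times> K" "z \<noteq> (k0, k0)" for z
    unfolding pe ekl[OF that(2)] ip_tensor2 g[symmetric]
    using that(1) prod_sum[of 1 "\<lambda>a. ip UNIV (g1 a) (uh (fst z))" "\<lambda>a. ip UNIV (g1 a) (uh (snd z))"] m1[of "fst z"] m1[of "snd z"]
    by (auto simp: K_def)
  have sumJ: "(\<Sum>j\<in>J. F j) = F None + F (Some (k0, k0)) + (\<Sum>z\<in>K \<times> K - {(k0, k0)}. F (Some z))" for F :: "_ \<Rightarrow> real"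
  proof -
    have "(\<Sum>j\<in>J. F j) = F None + (\<Sum>z\<in>K \<times> K. F (Some z))"
      unfolding J_def by (subst sum.insert) (auto simp: sum.reindex inj_on_def)
    also have "(\<Sum>z\<in>K \<times> K. F (Some z)) = F (Some (k0, k0)) + (\<Sum>z\<in>K \<times> K - {(k0, k0)}. F (Some z))"
      using k0K by (intro sum.remove) auto
    finally show ?thesis by simp
  qed
  have sumKK: "(\<Sum>z\<in>K \<times> K - {(k0, k0)}. f (fst z) * f (snd z)) = (\<Sum>k\<in>K. f k)\<^sup>2 - (f k0)\<^sup>2" for f :: "'a \<Rightarrow> real"
  proof -
    have "(\<Sum>k\<in>K. f k)\<^sup>2 = (\<Sum>z\<in>K \<times> K. f (fst z) * f (snd z))"
      by (simp add: power2_eq_square sum_product sum_times_fst_snd)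
    also have "\<dots> = f k0 * f k0 + (\<Sum>z\<in>K \<times> K - {(k0, k0)}. f (fst z) * f (snd z))"
      using k0K by (subst sum.remove[of _ "(k0, k0)"]) auto
    finally show ?thesis by (simp add: power2_eq_square)
  qed
  \<comment> \<open>The products of the \<open>uh\<close> exhaust the state for
    \<open>x0 x0\<close>. The rotation only splits the weight of one of them between two outcomes,
    with fractions \<open>\<alpha>\<^sup>2\<close> and \<open>\<beta>\<^sup>2\<close>.\<close>
  have full: "(\<Sum>j\<in>J. p [x0, x0] j) = joint_prob 2 (\<lambda>_. \<psi>) [x0, x0]"
  proof -
    have "(\<Sum>j\<in>J. p [x0, x0] j) = (\<alpha>\<^sup>2 + \<beta>\<^sup>2) * (lam k0)\<^sup>2 + (\<Sum>z\<in>K \<times> K - {(k0, k0)}. lam (fst z) * lam (snd z))"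
      unfolding sumJ pN00 p000 using pkl0 by (simp add: algebra_simps power2_eq_square)
    also have "\<dots> = (\<Sum>k\<in>K. lam k)\<^sup>2" unfolding ab sumKK by simp
    also have "(\<Sum>k\<in>K. lam k) = (\<Sum>k\<in>UNIV. lam k)"
      using lam0 by (intro sum.mono_neutral_left) (auto simp: K_def less_le)
    also have "\<dots> = output_prob \<psi> x0"
    proof -
      have "output_prob \<psi> x0 = (\<Sum>q\<in>UNIV. \<Sum>a\<in>UNIV. (cmod (\<psi> ((x0, a), q)))\<^sup>2)"
        unfolding output_prob_def by (rule sum.swap)
      also have "\<dots> = (\<Sum>q\<in>UNIV. \<Sum>k\<in>UNIV. (cmod (U k q))\<^sup>2)"
      proof (rule sum.cong[OF refl])
        fix q
        \<comment> \<open>Applying the norm identity to vectors supported at the single point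
          \<open>q\<close> extracts its pointwise form.\<close>
        have "(\<Sum>k\<in>UNIV. (cmod (ip UNIV (\<lambda>q'. \<Sum>a\<in>UNIV. u k a * (if q' = q then \<psi> ((x0, a), q) else 0)) (\<lambda>q'. if q' = q then 1 else 0)))\<^sup>2)
            = (\<Sum>a\<in>UNIV. (cmod (ip UNIV (\<lambda>q'. if q' = q then \<psi> ((x0, a), q) else 0) (\<lambda>q'. if q' = q then 1 else 0)))\<^sup>2)"
          by (rule unitary_combination_norm[OF u])
        moreover have "ip UNIV f (\<lambda>q'. if q' = q then 1 else 0) = cnj (f q)" for f :: "'y \<times> 'b \<Rightarrow> complex"
          unfolding ip_def by (simp add: if_distrib cong: if_cong)
        ultimately show "(\<Sum>a\<in>UNIV. (cmod (\<psi> ((x0, a), q)))\<^sup>2) = (\<Sum>k\<in>UNIV. (cmod (U k q))\<^sup>2)"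
          by (simp add: U_def g0_def del: complex_cnj_mult cnj_sum)
      qed
      also have "\<dots> = (\<Sum>k\<in>UNIV. \<Sum>q\<in>UNIV. (cmod (U k q))\<^sup>2)" by (rule sum.swap)
      also have "\<dots> = (\<Sum>k\<in>UNIV. lam k)"
      proof (rule sum.cong[OF refl])
        fix k
        have "complex_of_real (\<Sum>q\<in>UNIV. (cmod (U k q))\<^sup>2) = of_real (lam k)"
          unfolding ip_self[symmetric] UU by simp
        then show "(\<Sum>q\<in>UNIV. (cmod (U k q))\<^sup>2) = lam k" by (simp only: of_real_eq_iff)
      qed
      finally show ?thesis by simp
    qed
    finally show ?thesis by (simp add: joint_prob_def numeral_2_eq_2)
  qed
  \<comment> \<open>Judged on \<open>x0 x0\<close> against \<open>x1 x1\<close>, the outcome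
    \<open>None\<close> would contribute \<open>\<beta> * lam k0 * n2 = d\<^sup>2\<close>, and
    nothing would be gained. On the mixed pair \<open>nh\<close> drops out, because each list
    contains an \<open>x0\<close>.\<close>
  define xs where "xs j = (if j = None then [x0, x1] else [x0, x0])" for j :: "('a \<times> 'a) option"
  define ys where "ys j = (if j = None then [x1, x0] else [x1, x1])" for j :: "('a \<times> 'a) option"
  have "(cmod (overlap W x0 x1 \<psi>))\<^sup>2 \<le> (\<Sum>j\<in>J. sqrt (p (xs j) j * p (ys j) j))"
    unfolding p_def
  proof (rule orthonormal_attack_bound[OF ID sim finJ eo contr])
    show "complementary x0 x1 2 (xs j) (ys j)" "complementary x0 x1 2 [x0, x0] [x1, x1]" for j
      by (auto simp: complementary_def xs_def ys_def less_2_cases_iff)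
    show "(\<Sum>j\<in>J. \<Sum>a\<in>UNIV. \<Sum>a'\<in>UNIV. (cmod (ip (copies 2) (e j)
        (tensor2 (\<lambda>q. \<psi> (([x0, x0] ! 0, a), q)) (\<lambda>q. \<psi> (([x0, x0] ! 1, a'), q)))))\<^sup>2) = joint_prob 2 (\<lambda>_. \<psi>) [x0, x0]"
      using full unfolding p_def .
  qed (auto simp: xs_def ys_def copies_def)
  also have "\<dots> = \<beta>\<^sup>2 * d\<^sup>2 + (\<Sum>z\<in>K \<times> K - {(k0, k0)}. D (fst z) * D (snd z))"
  proof -
    have "sqrt (p (xs (Some z)) (Some z) * p (ys (Some z)) (Some z)) = D (fst z) * D (snd z)"
      if z: "z \<in> K \<times> K - {(k0, k0)}" for z
    proof -
      have "p (xs (Some z)) (Some z) * p (ys (Some z)) (Some z) = (D (fst z) * D (snd z))\<^sup>2"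
        using z pkl0[of z] pkl1[of z] by (auto simp: xs_def ys_def K_def power_mult_distrib)
      then show ?thesis using D0 by simp
    qed
    moreover have "sqrt (p (xs None) None * p (ys None) None) = \<beta>\<^sup>2 * d\<^sup>2"
      by (simp add: xs_def ys_def pN01 pN10)
    moreover have "p (xs (Some (k0, k0))) (Some (k0, k0)) * p (ys (Some (k0, k0))) (Some (k0, k0)) = 0"
      by (simp add: ys_def p011)
    ultimately show ?thesis unfolding sumJ by simp
  qed
  also have "\<dots> = (\<Sum>k\<in>K. D k)\<^sup>2 - \<alpha>\<^sup>2 * d\<^sup>2"
    unfolding sumKK d_def[symmetric] using ab by (simp add: algebra_simps flip: distrib_right)
  also have "\<dots> < (\<Sum>k\<in>K. D k)\<^sup>2" using \<alpha>0 d0 by simp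
  finally show False unfolding ov norm_of_real by simp
qed

theorem corollary8p2:
  fixes P :: "('x::finite \<times> 'y::finite) pmf"
    and \<psi> :: "('x, 'a::finite, 'y, 'b::finite) state"
  assumes "embedding P \<psi>"
    and "weakly_self_composable \<psi>"
  shows "trivial_embedding P \<psi>"
proof -
  obtain M :: "real \<Rightarrow> ('x \<times> 'a) measurement" and N :: "real \<Rightarrow> ('y \<times> 'b) measurement"
    where ID: "ideal_functionality M N" and sim: "\<And>m. m > 0 \<Longrightarrow> attacks_simulated M N \<psi> m"
    using assms(2) unfolding weakly_self_composable_def by blast
  have "dependent_part_entropy P \<psi> = 0"
  proof (rule dependent_part_entropy_eq_0)
    fix s s' :: "'x \<times> 'a"
    assume "dependent_part P (fst s) \<noteq> dependent_part P (fst s')"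
    from two_copy_attack_beats_queries[OF assms(1) ID sim this, of "snd s" "snd s'"]
    show "ip UNIV (\<lambda>q. \<psi> (s, q)) (\<lambda>q. \<psi> (s', q)) = 0" by simp
  qed
  then show ?thesis by (simp add: trivial_embedding_def)
qed

end
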